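(* Let $u\in\mathcal{W}(I)$ be a solution of the unsteady obstacle problem described in the context, let $z\coloneqq\nabla u$ and $\Lambda\coloneqq f-\partial_tu-L^*z\in L^2(I;V^* )$. Then, for every $(y,\lambda,\eta)\in L^2(I;Y^* )\times\mathcal{W}(I)\times L^2(I;V^* )$ with $\lambda(t)\in K(t)$ for a.e. $t\in I$, $I_{\chi_K^*}(\eta)<+\infty$, and $\operatorname{div}y=\partial_t\lambda+\eta-f$ in $L^2(I;V^* )$, $$\begin{aligned}&\tfrac12\|y-z\|_Q^2+\tfrac12\|\nabla(\lambda-u)\|_Q^2+\tfrac12\|(\lambda-u)(T)\|_H^2+\langle-\eta,u-\zeta\rangle_{L^2(I;V)}+\langle-\Lambda,\lambda-\zeta\rangle_{L^2(I;V)}\\&\qquad=\tfrac12\|y-\nabla\lambda\|_Q^2+\langle-\eta,\lambda-\zeta\rangle_{L^2(I;V)}+\tfrac12\|\lambda(0)-u_0\|_H^2 .\end{aligned}$$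
   Context: $\Omega\subseteq\mathbb{R}^d$ is a bounded Lipschitz domain with boundary split into disjoint relatively open sets $\Gamma_D\ne\emptyset$ and $\Gamma_N$, $\overline\Gamma_D\cup\overline\Gamma_N=\partial\Omega$; $I=(0,T)$, $0<T<\infty$; $Q=I\times\Omega$. $V=W^{1,2}_D(\Omega)$ (zero trace on $\Gamma_D$) with norm $\|v\|_V=\|\nabla v\|_{L^2(\Omega)}$, $H=L^2(\Omega)$, $Y=Y^*=L^2(\Omega;\mathbb{R}^d)$. $V\hookrightarrow H\cong H^*\hookrightarrow V^*$ is the usual evolution triple and $\mathcal{W}(I)=\{v\in L^2(I;V)\mid\partial_tv\in L^2(I;V^* )\}\hookrightarrow C^0(\overline I;H)$. $L=\nabla\colon V\to Y$, $\langle L^*y,v\rangle_V=\int_\Omega y\cdot\nabla v\,dx$; in $V^*$, $\operatorname{div}y$ means $-L^*y$; $-\Delta=L^*\circ\nabla\colon V\to V^*$ (pointwise in time). $\|\cdot\|_Q$ is the $L^2(Q)$-norm. Obstacle: $\zeta\in L^2(I;V)\cap C^0(\overline I;H)$, $K(t)=\{v\in V\mid v\ge\zeta(t)\text{ a.e. in }\Omega\}$, $\chi_{K(t)}$ is the indicator functional of $K(t)$ on $V$ ($0$ on $K(t)$, $+\infty$ elsewhere), $\chi_{K(t)}^*$ its Fenchel conjugate on $V^*$, and $I_{\chi_K^*}(v^* )=\int_I\chi_{K(t)}^*(v^*(t))\,dt$ for $v^*\in L^2(I;V^* )$. Equivalently, $I_{\chi_K^*}(v^* )=\langle v^*,\zeta\rangle_{L^2(I;V)}$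 if for a.e. $t$ one has $\langle v^*(t),w\rangle_V\le0$ for all $w\in V$ with $w\ge0$ a.e., and $+\infty$ otherwise. Problem: $f\in L^2(I;V^* )$, $u_0\in K(0)$. It is assumed that there is a solution $u\in\mathcal{W}(I)$ of $\partial_tu(t)+(-\Delta)u(t)+N_{K(t)}(u(t))\ni f(t)$ in $V^*$ for a.e. $t\in I$, $u(0)=u_0$ in $H$, where $N_{K(t)}(v)=\partial\chi_{K(t)}(v)$ is the normal cone; hence $\Lambda(t)\in N_{K(t)}(u(t))$ for a.e. $t\in I$. *)

theory Defs
  imports "HOL-Analysis.Analysis"
begin

section \<open>Domain and boundary\<close>

text \<open>Near each boundary point the domain is, after a rotation, the strict epigraph of a
  Lipschitz function on the hyperplane orthogonal to a unit vector \<open>e\<close>.\<close>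

definition lipschitz_domain :: "'a::euclidean_space set \<Rightarrow> bool" where
  "lipschitz_domain \<Omega> \<longleftrightarrow> open \<Omega> \<and> connected \<Omega> \<and> \<Omega> \<noteq> {} \<and>
     (\<forall>p\<in>frontier \<Omega>. \<exists>e \<gamma> C r. norm e = 1 \<and> r > 0 \<and> C-lipschitz_on {x. x \<bullet> e = 0} \<gamma> \<and>
        \<Omega> \<inter> ball p r = {x \<in> ball p r. \<gamma> (x - (x \<bullet> e) *\<^sub>R e) < x \<bullet> e})"

definition boundary_partition :: "'a::euclidean_space set \<Rightarrow> 'a set \<Rightarrow> 'a set \<Rightarrow> bool" where
  "boundary_partition \<Omega> \<Gamma>\<^sub>D \<Gamma>\<^sub>N \<longleftrightarrow>
     openin (top_of_set (frontier \<Omega>)) \<Gamma>\<^sub>D \<and> openin (top_of_set (frontier \<Omega>)) \<Gamma>\<^sub>N \<and>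
     \<Gamma>\<^sub>D \<inter> \<Gamma>\<^sub>N = {} \<and> \<Gamma>\<^sub>D \<noteq> {} \<and> closure \<Gamma>\<^sub>D \<union> closure \<Gamma>\<^sub>N = frontier \<Omega>"

text \<open>The \<open>s\<close>-dimensional Hausdorff measure. The case distinction on \<open>U i = {}\<close> matters for
  \<open>s = 0\<close> (where \<open>0 ^ 0 = 1\<close>); boundedness is required because the diameter of an
  unbounded set is unspecified.\<close>

definition hausdorff_pre :: "real \<Rightarrow> nat \<Rightarrow> 'a::euclidean_space set \<Rightarrow> ennreal" where
  "hausdorff_pre \<delta> s A =
     (INF U \<in> {U :: nat \<Rightarrow> 'a set. A \<subseteq> (\<Union>i. U i) \<and> (\<forall>i. bounded (U i) \<and> diameter (U i) \<le> \<delta>)}.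
        \<Sum>i. if U i = {} then 0
             else ennreal (unit_ball_vol (real s) * (diameter (U i) / 2) ^ s))"

definition hausdorff_outer :: "nat \<Rightarrow> 'a::euclidean_space set \<Rightarrow> ennreal" where
  "hausdorff_outer s A = (SUP \<delta>\<in>{0<..}. hausdorff_pre \<delta> s A)"

definition hausdorff_measure :: "nat \<Rightarrow> 'a::euclidean_space measure" where
  "hausdorff_measure s = measure_of UNIV (sets borel) (hausdorff_outer s)"

definition surface_measure :: "'a::euclidean_space set \<Rightarrow> 'a measure" where
  "surface_measure \<Omega> = restrict_space (hausdorff_measure (DIM('a) - 1)) (frontier \<Omega>)"


section \<open>Lebesgue and Sobolev spaces on the domain\<close>

text \<open>Function spaces are sets of representatives; equality in them is equality almost
  everywhere, and the norms below are seminorms on representatives.\<close>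

definition L2_space :: "'a::euclidean_space set \<Rightarrow> ('a \<Rightarrow> 'b::euclidean_space) set" where
  "L2_space \<Omega> = {v. v \<in> borel_measurable (lebesgue_on \<Omega>) \<and>
                    integrable (lebesgue_on \<Omega>) (\<lambda>x. (norm (v x))\<^sup>2)}"

definition L2_inner :: "'a::euclidean_space set \<Rightarrow> ('a \<Rightarrow> 'b::euclidean_space) \<Rightarrow> ('a \<Rightarrow> 'b) \<Rightarrow> real" where
  "L2_inner \<Omega> v w = (LINT x|lebesgue_on \<Omega>. v x \<bullet> w x)"

definition L2_norm :: "'a::euclidean_space set \<Rightarrow> ('a \<Rightarrow> 'b::euclidean_space) \<Rightarrow> real" where
  "L2_norm \<Omega> v = sqrt (LINT x|lebesgue_on \<Omega>. (norm (v x))\<^sup>2)"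

definition partial_deriv :: "'a::euclidean_space \<Rightarrow> ('a \<Rightarrow> real) \<Rightarrow> 'a \<Rightarrow> real" where
  "partial_deriv i \<phi> = (\<lambda>x. frechet_derivative \<phi> (at x) i)"

primrec C_differentiable :: "nat \<Rightarrow> ('a::euclidean_space \<Rightarrow> real) \<Rightarrow> bool" where
  "C_differentiable 0 \<phi> \<longleftrightarrow> continuous_on UNIV \<phi>"
| "C_differentiable (Suc k) \<phi> \<longleftrightarrow> (\<forall>x. \<phi> differentiable (at x)) \<and>
     (\<forall>i\<in>Basis. C_differentiable k (partial_deriv i \<phi>))"

text \<open>\<open>test_functions S\<close> is the space of smooth functions with compact support in \<open>S\<close>.\<close>

definition test_functions :: "'a::euclidean_space set \<Rightarrow> ('a \<Rightarrow> real) set" where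
  "test_functions S = {\<phi>. (\<forall>k. C_differentiable k \<phi>) \<and>
     compact (closure {x. \<phi> x \<noteq> 0}) \<and> closure {x. \<phi> x \<noteq> 0} \<subseteq> S}"

definition is_weak_gradient :: "'a::euclidean_space set \<Rightarrow> ('a \<Rightarrow> real) \<Rightarrow> ('a \<Rightarrow> 'a) \<Rightarrow> bool" where
  "is_weak_gradient \<Omega> v g \<longleftrightarrow> (\<forall>\<phi>\<in>test_functions \<Omega>. \<forall>i\<in>Basis.
     (LINT x|lebesgue_on \<Omega>. v x * partial_deriv i \<phi> x) = - (LINT x|lebesgue_on \<Omega>. (g x \<bullet> i) * \<phi> x))"

definition W12_space :: "'a::euclidean_space set \<Rightarrow> ('a \<Rightarrow> real) set" where
  "W12_space \<Omega> = {v \<in> L2_space \<Omega>. \<exists>g\<in>L2_space \<Omega>. is_weak_gradient \<Omega> v g}"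

definition grad :: "'a::euclidean_space set \<Rightarrow> ('a \<Rightarrow> real) \<Rightarrow> 'a \<Rightarrow> 'a" where
  "grad \<Omega> v = (SOME g. g \<in> L2_space \<Omega> \<and> is_weak_gradient \<Omega> v g)"

definition W12_norm :: "'a::euclidean_space set \<Rightarrow> ('a \<Rightarrow> real) \<Rightarrow> real" where
  "W12_norm \<Omega> v = sqrt ((L2_norm \<Omega> v)\<^sup>2 + (L2_norm \<Omega> (grad \<Omega> v))\<^sup>2)"

text \<open>The trace operator is the continuous extension to \<open>W12_space \<Omega>\<close> of the restriction of
  smooth functions to the boundary, with values in \<open>L\<^sup>2\<close> of the surface measure.\<close>

definition has_trace :: "'a::euclidean_space set \<Rightarrow> ('a \<Rightarrow> real) \<Rightarrow> ('a \<Rightarrow> real) \<Rightarrow> bool" where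
  "has_trace \<Omega> v g \<longleftrightarrow> g \<in> borel_measurable (surface_measure \<Omega>) \<and>
     integrable (surface_measure \<Omega>) (\<lambda>x. (g x)\<^sup>2) \<and>
     (\<exists>\<phi> :: nat \<Rightarrow> 'a \<Rightarrow> real. (\<forall>n. \<phi> n \<in> test_functions UNIV) \<and>
        (\<lambda>n. W12_norm \<Omega> (\<phi> n - v)) \<longlonglongrightarrow> 0 \<and>
        (\<lambda>n. \<integral>\<^sup>+x. ennreal ((\<phi> n x - g x)\<^sup>2) \<partial>surface_measure \<Omega>) \<longlonglongrightarrow> 0)"

definition V_space :: "'a::euclidean_space set \<Rightarrow> 'a set \<Rightarrow> ('a \<Rightarrow> real) set" where
  "V_space \<Omega> \<Gamma>\<^sub>D = {v \<in> W12_space \<Omega>. \<exists>g. has_trace \<Omega> v g \<and>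
                       (AE x in surface_measure \<Omega>. x \<in> \<Gamma>\<^sub>D \<longrightarrow> g x = 0)}"

definition V_norm :: "'a::euclidean_space set \<Rightarrow> ('a \<Rightarrow> real) \<Rightarrow> real" where
  "V_norm \<Omega> v = L2_norm \<Omega> (grad \<Omega> v)"

text \<open>Elements of the dual are functionals whose values outside \<open>V_space\<close> are irrelevant, so
  equality in the dual is equality on \<open>V_space\<close>.\<close>

definition V_dual :: "'a::euclidean_space set \<Rightarrow> 'a set \<Rightarrow> (('a \<Rightarrow> real) \<Rightarrow> real) set" where
  "V_dual \<Omega> \<Gamma>\<^sub>D = {\<psi>.
     (\<forall>v\<in>V_space \<Omega> \<Gamma>\<^sub>D. \<forall>w\<in>V_space \<Omega> \<Gamma>\<^sub>D. \<forall>a b.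
        \<psi> (\<lambda>x. a * v x + b * w x) = a * \<psi> v + b * \<psi> w) \<and>
     (\<exists>C. \<forall>v\<in>V_space \<Omega> \<Gamma>\<^sub>D. \<bar>\<psi> v\<bar> \<le> C * V_norm \<Omega> v)}"

definition V_dual_norm :: "'a::euclidean_space set \<Rightarrow> 'a set \<Rightarrow> (('a \<Rightarrow> real) \<Rightarrow> real) \<Rightarrow> real" where
  "V_dual_norm \<Omega> \<Gamma>\<^sub>D \<psi> = (SUP v\<in>{v \<in> V_space \<Omega> \<Gamma>\<^sub>D. V_norm \<Omega> v \<le> 1}. \<bar>\<psi> v\<bar>)"

definition V_dual_eq ::
  "'a::euclidean_space set \<Rightarrow> 'a set \<Rightarrow> (('a \<Rightarrow> real) \<Rightarrow> real) \<Rightarrow> (('a \<Rightarrow> real) \<Rightarrow> real) \<Rightarrow> bool" where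
  "V_dual_eq \<Omega> \<Gamma>\<^sub>D \<psi> \<psi>' \<longleftrightarrow> (\<forall>v\<in>V_space \<Omega> \<Gamma>\<^sub>D. \<psi> v = \<psi>' v)"

text \<open>\<open>grad_adjoint\<close> is the adjoint of the gradient as a map from \<open>V\<close> to \<open>L\<^sup>2\<close>.\<close>

definition grad_adjoint :: "'a::euclidean_space set \<Rightarrow> ('a \<Rightarrow> 'a) \<Rightarrow> ('a \<Rightarrow> real) \<Rightarrow> real" where
  "grad_adjoint \<Omega> y = (\<lambda>v. L2_inner \<Omega> y (grad \<Omega> v))"

definition weak_div :: "'a::euclidean_space set \<Rightarrow> ('a \<Rightarrow> 'a) \<Rightarrow> ('a \<Rightarrow> real) \<Rightarrow> real" where
  "weak_div \<Omega> y = (\<lambda>v. - grad_adjoint \<Omega> y v)"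


section \<open>Bochner spaces\<close>

text \<open>Since \<open>V\<close> and its dual depend on the domain, they are carrier sets and not types, and the
  library's Bochner integral does not apply. The parameters \<open>S\<close> and \<open>nrm\<close> are the carrier of a
  function space and its (semi)norm.\<close>

definition bochner_measurable ::
  "'t measure \<Rightarrow> 'b::minus set \<Rightarrow> ('b \<Rightarrow> real) \<Rightarrow> ('t \<Rightarrow> 'b) \<Rightarrow> bool" where
  "bochner_measurable M S nrm w \<longleftrightarrow>
     (\<exists>s :: nat \<Rightarrow> 't \<Rightarrow> 'b. (\<forall>n. simple_function M (s n) \<and> s n ` space M \<subseteq> S) \<and>
        (AE t in M. (\<lambda>n. nrm (s n t - w t)) \<longlonglongrightarrow> 0))"

definition bochner_L2 :: "'t measure \<Rightarrow> 'b::minus set \<Rightarrow> ('b \<Rightarrow> real) \<Rightarrow> ('t \<Rightarrow> 'b) set" where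
  "bochner_L2 M S nrm = {w. (AE t in M. w t \<in> S) \<and> bochner_measurable M S nrm w \<and>
                            integrable M (\<lambda>t. (nrm (w t))\<^sup>2)}"

abbreviation time_measure :: "real \<Rightarrow> real measure" where
  "time_measure T \<equiv> lebesgue_on {0<..<T}"

definition L2_V :: "real \<Rightarrow> 'a::euclidean_space set \<Rightarrow> 'a set \<Rightarrow> (real \<Rightarrow> 'a \<Rightarrow> real) set" where
  "L2_V T \<Omega> \<Gamma>\<^sub>D = bochner_L2 (time_measure T) (V_space \<Omega> \<Gamma>\<^sub>D) (V_norm \<Omega>)"

definition L2_V_dual ::
  "real \<Rightarrow> 'a::euclidean_space set \<Rightarrow> 'a set \<Rightarrow> (real \<Rightarrow> ('a \<Rightarrow> real) \<Rightarrow> real) set" where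
  "L2_V_dual T \<Omega> \<Gamma>\<^sub>D = bochner_L2 (time_measure T) (V_dual \<Omega> \<Gamma>\<^sub>D) (V_dual_norm \<Omega> \<Gamma>\<^sub>D)"

definition L2_Y :: "real \<Rightarrow> 'a::euclidean_space set \<Rightarrow> (real \<Rightarrow> 'a \<Rightarrow> 'a) set" where
  "L2_Y T \<Omega> = bochner_L2 (time_measure T) (L2_space \<Omega>) (L2_norm \<Omega>)"

text \<open>The \<open>L\<^sup>2(Q)\<close> norm under the isometry of \<open>L\<^sup>2(I; L\<^sup>2(\<Omega>))\<close> with \<open>L\<^sup>2(Q)\<close>. The iterated form
  does not depend on the choice of representatives at the individual times \<open>t\<close>, which need
  not be jointly measurable.\<close>

definition Q_norm :: "real \<Rightarrow> 'a::euclidean_space set \<Rightarrow> (real \<Rightarrow> 'a \<Rightarrow> 'a) \<Rightarrow> real" where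
  "Q_norm T \<Omega> y = sqrt (LINT t|time_measure T. (L2_norm \<Omega> (y t))\<^sup>2)"

definition pairing ::
  "real \<Rightarrow> (real \<Rightarrow> ('a \<Rightarrow> real) \<Rightarrow> real) \<Rightarrow> (real \<Rightarrow> 'a \<Rightarrow> real) \<Rightarrow> real" where
  "pairing T \<psi> v = (LINT t|time_measure T. \<psi> t (v t))"

definition C0_H :: "real \<Rightarrow> 'a::euclidean_space set \<Rightarrow> (real \<Rightarrow> 'a \<Rightarrow> real) set" where
  "C0_H T \<Omega> = {w. (\<forall>t\<in>{0..T}. w t \<in> L2_space \<Omega>) \<and>
     (\<forall>t\<in>{0..T}. ((\<lambda>s. L2_norm \<Omega> (w s - w t)) \<longlongrightarrow> 0) (at t within {0..T}))}"

text \<open>Distributional time derivative in the dual of \<open>V\<close>; \<open>w t\<close> acts on \<open>V\<close> through the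
  inner product of \<open>L\<^sup>2(\<Omega>)\<close>, as in the evolution triple.\<close>

definition is_time_deriv ::
  "real \<Rightarrow> 'a::euclidean_space set \<Rightarrow> 'a set \<Rightarrow> (real \<Rightarrow> 'a \<Rightarrow> real) \<Rightarrow> (real \<Rightarrow> ('a \<Rightarrow> real) \<Rightarrow> real) \<Rightarrow> bool" where
  "is_time_deriv T \<Omega> \<Gamma>\<^sub>D w w' \<longleftrightarrow>
     (\<forall>v\<in>V_space \<Omega> \<Gamma>\<^sub>D. \<forall>\<phi>\<in>test_functions {0<..<T}.
        (LINT t|time_measure T. deriv \<phi> t * L2_inner \<Omega> (w t) v) =
        - (LINT t|time_measure T. \<phi> t * w' t v))"

definition time_deriv ::
  "real \<Rightarrow> 'a::euclidean_space set \<Rightarrow> 'a set \<Rightarrow> (real \<Rightarrow> 'a \<Rightarrow> real) \<Rightarrow> real \<Rightarrow> ('a \<Rightarrow> real) \<Rightarrow> real" where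
  "time_deriv T \<Omega> \<Gamma>\<^sub>D w = (SOME w'. w' \<in> L2_V_dual T \<Omega> \<Gamma>\<^sub>D \<and> is_time_deriv T \<Omega> \<Gamma>\<^sub>D w w')"

text \<open>By the embedding into the continuous functions with values in \<open>L\<^sup>2(\<Omega>)\<close>, every class of
  functions in \<open>W(I)\<close> has a unique continuous representative; membership in \<open>C0_H\<close> selects this
  representative, so that point values such as \<open>w 0\<close> and \<open>w T\<close> are meaningful.\<close>

definition W_space :: "real \<Rightarrow> 'a::euclidean_space set \<Rightarrow> 'a set \<Rightarrow> (real \<Rightarrow> 'a \<Rightarrow> real) set" where
  "W_space T \<Omega> \<Gamma>\<^sub>D = {w \<in> L2_V T \<Omega> \<Gamma>\<^sub>D \<inter> C0_H T \<Omega>.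
     \<exists>w'\<in>L2_V_dual T \<Omega> \<Gamma>\<^sub>D. is_time_deriv T \<Omega> \<Gamma>\<^sub>D w w'}"


section \<open>Convex analysis and the obstacle problem\<close>

definition constraint_set ::
  "'a::euclidean_space set \<Rightarrow> 'a set \<Rightarrow> (real \<Rightarrow> 'a \<Rightarrow> real) \<Rightarrow> real \<Rightarrow> ('a \<Rightarrow> real) set" where
  "constraint_set \<Omega> \<Gamma>\<^sub>D \<zeta> t = {v \<in> V_space \<Omega> \<Gamma>\<^sub>D. AE x in lebesgue_on \<Omega>. v x \<ge> \<zeta> t x}"

definition indicator_functional :: "'b set \<Rightarrow> 'b \<Rightarrow> ereal" where
  "indicator_functional K v = (if v \<in> K then 0 else \<infinity>)"

definition fenchel_conjugate :: "'b set \<Rightarrow> ('b \<Rightarrow> ereal) \<Rightarrow> ('b \<Rightarrow> real) \<Rightarrow> ereal" where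
  "fenchel_conjugate X F \<psi> = (SUP v\<in>X. ereal (\<psi> v) - F v)"

definition subdifferential ::
  "'b::minus set \<Rightarrow> ('b \<Rightarrow> real) set \<Rightarrow> ('b \<Rightarrow> ereal) \<Rightarrow> 'b \<Rightarrow> ('b \<Rightarrow> real) set" where
  "subdifferential X X' F v =
     {\<psi> \<in> X'. v \<in> X \<and> F v < \<infinity> \<and> (\<forall>w\<in>X. F v + ereal (\<psi> (w - v)) \<le> F w)}"

definition normal_cone ::
  "'a::euclidean_space set \<Rightarrow> 'a set \<Rightarrow> ('a \<Rightarrow> real) set \<Rightarrow> ('a \<Rightarrow> real) \<Rightarrow> (('a \<Rightarrow> real) \<Rightarrow> real) set" where
  "normal_cone \<Omega> \<Gamma>\<^sub>D K v =
     subdifferential (V_space \<Omega> \<Gamma>\<^sub>D) (V_dual \<Omega> \<Gamma>\<^sub>D) (indicator_functional K) v"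

text \<open>Integral of an extended real function as the difference of the integrals of its positive
  and negative parts (\<open>e2ennreal\<close> maps negative numbers to \<open>0\<close>).\<close>

definition ereal_integral :: "'t measure \<Rightarrow> ('t \<Rightarrow> ereal) \<Rightarrow> ereal" where
  "ereal_integral M g =
     enn2ereal (\<integral>\<^sup>+t. e2ennreal (g t) \<partial>M) - enn2ereal (\<integral>\<^sup>+t. e2ennreal (- g t) \<partial>M)"

definition I_conj ::
  "real \<Rightarrow> 'a::euclidean_space set \<Rightarrow> 'a set \<Rightarrow> (real \<Rightarrow> 'a \<Rightarrow> real) \<Rightarrow> (real \<Rightarrow> ('a \<Rightarrow> real) \<Rightarrow> real) \<Rightarrow> ereal" where
  "I_conj T \<Omega> \<Gamma>\<^sub>D \<zeta> \<psi> = ereal_integral (time_measure T)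
     (\<lambda>t. fenchel_conjugate (V_space \<Omega> \<Gamma>\<^sub>D)
            (indicator_functional (constraint_set \<Omega> \<Gamma>\<^sub>D \<zeta> t)) (\<psi> t))"

definition obstacle_solution ::
  "real \<Rightarrow> 'a::euclidean_space set \<Rightarrow> 'a set \<Rightarrow> (real \<Rightarrow> 'a \<Rightarrow> real) \<Rightarrow>
   (real \<Rightarrow> ('a \<Rightarrow> real) \<Rightarrow> real) \<Rightarrow> ('a \<Rightarrow> real) \<Rightarrow> (real \<Rightarrow> 'a \<Rightarrow> real) \<Rightarrow> bool" where
  "obstacle_solution T \<Omega> \<Gamma>\<^sub>D \<zeta> f u\<^sub>0 u \<longleftrightarrow>
     u \<in> W_space T \<Omega> \<Gamma>\<^sub>D \<and>
     (AE t in time_measure T. \<exists>\<nu>\<in>normal_cone \<Omega> \<Gamma>\<^sub>D (constraint_set \<Omega> \<Gamma>\<^sub>D \<zeta> t) (u t).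
        V_dual_eq \<Omega> \<Gamma>\<^sub>D (f t)
          (\<lambda>v. time_deriv T \<Omega> \<Gamma>\<^sub>D u t v + grad_adjoint \<Omega> (grad \<Omega> (u t)) v + \<nu> v)) \<and>
     (AE x in lebesgue_on \<Omega>. u 0 x = u\<^sub>0 x)"

end

theory Submission
  imports Defs "HOL-Library.Function_Algebras"
begin

text \<open>
  Subtracting the two equations and testing with \<open>lam - u\<close> turns the mixed term in
  \<open>\<parallel>y - \<nabla>lam\<parallel>\<^sup>2 = \<parallel>(y - z) - \<nabla>(lam - u)\<parallel>\<^sup>2\<close> into \<open>\<langle>\<partial>\<^sub>t(lam - u) + \<eta> - \<Lambda>, lam - u\<rangle>\<close>.
  The time derivative integrates to the boundary terms, and \<open>\<langle>\<Lambda>, u - \<zeta>\<rangle> = 0\<close> because \<open>\<Lambda>\<close> lies in the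
  normal cone. Integration by parts in time is obtained by averaging
  \<open>(w(t + h) - w(t - h), w(t))\<close> over \<open>t\<close>: by symmetry of the inner product the average
  telescopes, while the distributional derivative writes it as a double integral of
  \<open>\<langle>w'(r), w(t)\<rangle>\<close> over \<open>\<bar>t - r\<bar> \<le> h\<close>. Since all function spaces consist of representatives,
  additivity of the gradient needs uniqueness of weak gradients, hence the fundamental lemma
  of the calculus of variations.
\<close>

subsection \<open>Smooth functions\<close>

text \<open>No V-valued integral and no mollification of \<open>w\<close> occurs. Limits in time are
  taken for scalar functions obtained by pairing with elements of a carrier, and Bochner functions
  enter only through simple functions close to them in norm. The derivative is used through
  increments of \<open>L2_inner D (w t) v\<close> for a fixed \<open>v\<close> in V; these hold for
  all interior times and all \<open>v\<close> without an exceptional null set, so that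
  \<open>v = w t\<close> may be inserted at almost every \<open>t\<close>. The difference of
  \<open>w\<close> has to be centred at t. A forward difference w(t + h) - w(t) paired with w(t)
  also produces minus half the squared norm of the increment, which would need an estimate of its
  own. In the centred case the two inner products are values of one symmetric kernel, shifted by h
  against each other, and they cancel except on strips of width h at the two ends. The windows must
  stay inside (0, T), so the identity is proved on compact subintervals first and reaches 0 and T by
  continuity in L2.\<close>

lemma partial_deriv_eqI:
  assumes "(\<phi> has_derivative D) (at x)"
  shows "partial_deriv i \<phi> x = D i"
  unfolding partial_deriv_def using frechet_derivative_at[OF assms] by simp

lemma has_derivative_partial_deriv:
  assumes "\<phi> differentiable (at x)"
  shows "(\<phi> has_derivative frechet_derivative \<phi> (at x)) (at x)"
  using assms frechet_derivative_works by blast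

lemma partial_deriv_has_real_derivative:
  fixes \<theta> :: "real \<Rightarrow> real"
  assumes "(\<theta> has_real_derivative d) (at x)"
  shows "partial_deriv i \<theta> x = d * i"
  using assms partial_deriv_eqI[of \<theta> "(*) d" x i] by (simp add: has_field_derivative_def)

lemma C_differentiable_continuous: "C_differentiable k \<phi> \<Longrightarrow> continuous_on UNIV \<phi>"
  by (cases k) (auto intro!: differentiable_imp_continuous_on simp: differentiable_on_def)

lemma C_differentiable_lower: "C_differentiable (Suc k) \<phi> \<Longrightarrow> C_differentiable k \<phi>"
proof (induction k arbitrary: \<phi>)
  case 0
  then show ?case using C_differentiable_continuous[OF 0] by simp
next
  case (Suc k)
  then show ?case unfolding C_differentiable.simps(2)[of "Suc k"] C_differentiable.simps(2)[of k]
    by blast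
qed

lemma C_differentiable_const: "C_differentiable k (\<lambda>x. c)"
proof (induction k arbitrary: c)
  case (Suc k)
  have "partial_deriv i (\<lambda>x::'a. c) = (\<lambda>x. 0)" for i
    by (rule ext, subst partial_deriv_eqI[OF has_derivative_const]) simp
  then show ?case using Suc by simp
qed simp

lemma C_differentiable_add:
  "C_differentiable k \<phi> \<Longrightarrow> C_differentiable k \<psi> \<Longrightarrow> C_differentiable k (\<lambda>x. \<phi> x + \<psi> x)"
proof (induction k arbitrary: \<phi> \<psi>)
  case (Suc k)
  have "partial_deriv i (\<lambda>x. \<phi> x + \<psi> x) = (\<lambda>x. partial_deriv i \<phi> x + partial_deriv i \<psi> x)" for i
  proof
    fix x
    show "partial_deriv i (\<lambda>x. \<phi> x + \<psi> x) x = partial_deriv i \<phi> x + partial_deriv i \<psi> x"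
      unfolding partial_deriv_def[of _ \<phi>] partial_deriv_def[of _ \<psi>] using Suc.prems
      by (intro partial_deriv_eqI has_derivative_add has_derivative_partial_deriv) auto
  qed
  then show ?case using Suc by (auto intro!: differentiable_add)
qed (auto intro: continuous_on_add)

lemma partial_deriv_mult:
  assumes "\<phi> differentiable (at x)" "\<psi> differentiable (at x)"
  shows "partial_deriv i (\<lambda>x. \<phi> x * \<psi> x) x = \<phi> x * partial_deriv i \<psi> x + partial_deriv i \<phi> x * \<psi> x"
  unfolding partial_deriv_def[of _ \<phi>] partial_deriv_def[of _ \<psi>] using assms
  by (intro partial_deriv_eqI has_derivative_mult has_derivative_partial_deriv)

lemma C_differentiable_mult:
  "C_differentiable k \<phi> \<Longrightarrow> C_differentiable k \<psi> \<Longrightarrow> C_differentiable k (\<lambda>x. \<phi> x * \<psi> x)"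
proof (induction k arbitrary: \<phi> \<psi>)
  case (Suc k)
  have "partial_deriv i (\<lambda>x. \<phi> x * \<psi> x)
      = (\<lambda>x. \<phi> x * partial_deriv i \<psi> x + partial_deriv i \<phi> x * \<psi> x)" for i
    using Suc.prems by (auto intro!: partial_deriv_mult)
  \<comment> \<open>The product rule leaves one factor undifferentiated in each summand, so the
    induction hypothesis needs the factors themselves at level \<open>k\<close>.\<close>
  moreover have "C_differentiable k \<phi>" "C_differentiable k \<psi>"
    using Suc.prems C_differentiable_lower by blast+
  ultimately show ?case using Suc by (auto intro!: differentiable_mult C_differentiable_add)
qed (auto intro: continuous_on_mult)

lemma C_differentiable_cmult: "C_differentiable k \<phi> \<Longrightarrow> C_differentiable k (\<lambda>x. c * \<phi> x)"
  by (intro C_differentiable_mult C_differentiable_const)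

lemma C_differentiable_prod:
  assumes "\<And>i. i \<in> A \<Longrightarrow> C_differentiable k (\<phi> i)"
  shows "C_differentiable k (\<lambda>x. \<Prod>i\<in>A. \<phi> i x)"
  using assms
  by (induction A rule: infinite_finite_induct)
     (auto intro: C_differentiable_const C_differentiable_mult)

text \<open>Each partial derivative is a constant times the same composition with the derivative of
  \<open>\<theta>\<close>, so induction over arbitrary \<open>\<theta>\<close> closes. Affine
  functions of one coordinate suffice: bumps on boxes are products over coordinates, and on the real
  line with \<open>i = 1\<close> the lemma covers scaling and shifting.\<close>

lemma C_differentiable_compose_affine:
  fixes \<theta> :: "real \<Rightarrow> real" and i :: "'a::euclidean_space"
  shows "C_differentiable k \<theta> \<Longrightarrow> C_differentiable k (\<lambda>x. \<theta> (c * (x \<bullet> i) + d))"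
proof (induction k arbitrary: \<theta>)
  case 0
  then show ?case by (auto intro!: continuous_on_compose2[of UNIV \<theta>] continuous_intros)
next
  case (Suc k)
  have *: "((\<lambda>x. \<theta> (c * (x \<bullet> i) + d)) has_derivative
      (\<lambda>h. frechet_derivative \<theta> (at (c * (x \<bullet> i) + d)) (c * (h \<bullet> i)))) (at x)" for x
  proof -
    have 1: "((\<lambda>x. c * (x \<bullet> i) + d) has_derivative (\<lambda>h. c * (h \<bullet> i))) (at x)"
      by (auto intro!: derivative_eq_intros)
    have 2: "(\<theta> has_derivative frechet_derivative \<theta> (at (c * (x \<bullet> i) + d))) (at (c * (x \<bullet> i) + d))"
      using Suc.prems by (intro has_derivative_partial_deriv) simp
    show ?thesis by (rule has_derivative_compose[OF 1 2])
  qed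
  have "partial_deriv j (\<lambda>x. \<theta> (c * (x \<bullet> i) + d))
      = (\<lambda>x. (c * (j \<bullet> i)) * partial_deriv 1 \<theta> (c * (x \<bullet> i) + d))" for j
  proof
    fix x
    have "linear (frechet_derivative \<theta> (at (c * (x \<bullet> i) + d)))"
      using Suc.prems by (auto intro: linear_frechet_derivative)
    from linear_scale[OF this, of "c * (j \<bullet> i)" 1]
    show "partial_deriv j (\<lambda>x. \<theta> (c * (x \<bullet> i) + d)) x
        = (c * (j \<bullet> i)) * partial_deriv 1 \<theta> (c * (x \<bullet> i) + d)"
      by (subst partial_deriv_eqI[OF *]) (simp add: partial_deriv_def)
  qed
  moreover have "C_differentiable k (partial_deriv 1 \<theta>)" using Suc.prems by simp
  moreover have "(\<lambda>x. \<theta> (c * (x \<bullet> i) + d)) differentiable (at x)" for x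
    using * differentiable_def by blast
  ultimately show ?case using Suc.IH by (auto intro!: C_differentiable_cmult)
qed

section \<open>A smooth function on the line that is flat at 0\<close>

definition flat_exp :: "nat \<Rightarrow> real \<Rightarrow> real" where
  "flat_exp m x = (if x > 0 then (1 / x) ^ m * exp (- (1 / x)) else 0)"

text \<open>The powers \<open>(1 / x) ^ m\<close> are carried along because differentiation then
  maps the family into its own linear span, which yields derivatives of every order of exp(-1/x) by
  induction.\<close>

lemma flat_exp_has_derivative:
  "(flat_exp m has_real_derivative (flat_exp (m + 2) x - of_nat m * flat_exp (m + 1) x)) (at x)"
proof (cases x "0::real" rule: linorder_cases)
  case less
  have "((\<lambda>x. 0) has_real_derivative 0) (at x)" by simp
  then have "(flat_exp m has_real_derivative 0) (at x)"
    by (rule DERIV_cong_ev[THEN iffD1, rotated -1, OF _ refl _ refl])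
       (use less in \<open>auto simp: flat_exp_def eventually_nhds intro!: exI[of _ "{..<0}"]\<close>)
  then show ?thesis using less by (simp add: flat_exp_def)
next
  case greater
  have d: "((\<lambda>x. 1 / x) has_real_derivative (- ((1 / x)\<^sup>2))) (at x)"
    using greater by (auto intro!: derivative_eq_intros simp: power2_eq_square)
  have "((\<lambda>x. (1 / x) ^ m * exp (- (1 / x))) has_real_derivative
      of_nat m * (1 / x) ^ (m - 1) * (- (1 / x)\<^sup>2) * exp (- (1 / x)) + exp (- (1 / x)) * (- (- (1 / x)\<^sup>2)) * (1 / x) ^ m) (at x)"
    by (rule DERIV_mult DERIV_power DERIV_fun_exp DERIV_minus d derivative_eq_intros refl)+
       (simp add: algebra_simps)
  \<comment> \<open>At \<open>m = 0\<close> the exponent \<open>m - 1\<close> is truncated to 0; the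
    factor \<open>of_nat m\<close> removes that term.\<close>
  moreover have "of_nat m * (1 / x) ^ (m - 1) * (- (1 / x)\<^sup>2) * exp (- (1 / x)) + exp (- (1 / x)) * (- (- (1 / x)\<^sup>2)) * (1 / x) ^ m
    = (1 / x) ^ (m + 2) * exp (- (1 / x)) - of_nat m * ((1 / x) ^ (m + 1) * exp (- (1 / x)))"
    by (cases m) (simp_all add: algebra_simps power2_eq_square flip: add_divide_distrib)
  ultimately have "((\<lambda>x. (1 / x) ^ m * exp (- (1 / x))) has_real_derivative
     (flat_exp (m + 2) x - of_nat m * flat_exp (m + 1) x)) (at x)"
    using greater by (simp add: flat_exp_def)
  then show ?thesis
    by (rule DERIV_cong_ev[THEN iffD1, rotated -1, OF _ refl _ refl])
       (use greater in \<open>auto simp: flat_exp_def eventually_nhds intro!: exI[of _ "{0<..}"]\<close>)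
next
  case equal
  \<comment> \<open>With \<open>y = 1 / h\<close> this is the difference quotient at 0 from the
    right; from the left the quotient vanishes.\<close>
  have "((\<lambda>y::real. y ^ (m + 1) / exp y) \<longlongrightarrow> 0) at_top"
    by (rule tendsto_power_div_exp_0)
  then have "((\<lambda>h::real. (1 / h) ^ (m + 1) / exp (1 / h)) \<longlongrightarrow> 0) (at_right 0)"
    by (rule filterlim_compose) (use filterlim_inverse_at_top_right in \<open>simp add: inverse_eq_divide\<close>)
  then have r: "((\<lambda>h. (flat_exp m h - flat_exp m 0) / h) \<longlongrightarrow> 0) (at_right 0)"
    by (rule Lim_transform_eventually)
       (auto simp: eventually_at_filter flat_exp_def exp_minus divide_simps)
  have l: "((\<lambda>h. (flat_exp m h - flat_exp m 0) / h) \<longlongrightarrow> 0) (at_left 0)"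
    by (rule Lim_transform_eventually[OF tendsto_const]) (auto simp: eventually_at_filter flat_exp_def)
  have "((\<lambda>h. (flat_exp m h - flat_exp m 0) / h) \<longlongrightarrow> 0) (at 0)"
    using l r by (simp add: filterlim_split_at)
  then have "(flat_exp m has_real_derivative 0) (at 0)"
    by (simp add: DERIV_def)
  then show ?thesis using equal by (simp add: flat_exp_def)
qed

lemma C_differentiable_flat_exp: "C_differentiable k (flat_exp m)"
proof (induction k arbitrary: m)
  case 0
  show ?case using DERIV_isCont[OF flat_exp_has_derivative]
    by (simp add: continuous_on_eq_continuous_at)
next
  case (Suc k)
  have "partial_deriv 1 (flat_exp m) = (\<lambda>x. flat_exp (m + 2) x + (- of_nat m) * flat_exp (m + 1) x)"
    using partial_deriv_has_real_derivative[OF flat_exp_has_derivative] by (auto simp: fun_eq_iff)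
  moreover have "flat_exp m differentiable (at x)" for x
    using flat_exp_has_derivative real_differentiable_def by blast
  moreover have "C_differentiable k (\<lambda>x. flat_exp (m + 2) x + (- of_nat m) * flat_exp (m + 1) x)"
    by (intro C_differentiable_add C_differentiable_cmult Suc)
  ultimately show ?case by simp
qed

lemma flat_exp_nonneg: "0 \<le> flat_exp m x" by (simp add: flat_exp_def)

lemma flat_exp_0_le_1: "flat_exp 0 x \<le> 1" by (simp add: flat_exp_def)

text \<open>The shift by 1 makes the function vanish for \<open>c \<le> 1 / n\<close>. With
  \<open>c\<close> a distance to a face of a box, the supports thus keep a positive distance from
  the face and are compact in the open box.\<close>

lemma flat_exp_0_limit: "(\<lambda>n. flat_exp 0 (real n * c - 1)) \<longlonglongrightarrow> (if c > 0 then 1 else 0)"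
proof (cases "c > 0")
  case True
  have *: "filterlim (\<lambda>n. real n * c - 1) at_top sequentially"
    using True filterlim_tendsto_add_at_top[OF tendsto_const[of "-1::real"]
      filterlim_at_top_mult_tendsto_pos[OF tendsto_const[of c] True filterlim_real_sequentially]]
    by (simp add: algebra_simps)
  then have ev: "\<forall>\<^sub>F n in sequentially. real n * c - 1 > 0"
    by (simp only: filterlim_at_top_dense)
  have "(\<lambda>n. exp (- (1 / (real n * c - 1)))) \<longlonglongrightarrow> exp (- 0)"
    by (intro tendsto_intros real_tendsto_divide_at_top[OF tendsto_const] *)
  moreover have "\<forall>\<^sub>F n in sequentially. exp (- (1 / (real n * c - 1))) = flat_exp 0 (real n * c - 1)"
    using ev by eventually_elim (simp add: flat_exp_def)
  ultimately show ?thesis using True Lim_transform_eventually by fastforce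
next
  case False
  then have le: "real n * c - 1 \<le> 0" for n
    by (smt (verit) mult_nonneg_nonpos of_nat_0_le_iff)
  have "flat_exp 0 (real n * c - 1) = 0" for n
    using le[of n] by (simp add: flat_exp_def not_less)
  then show ?thesis using False by simp
qed

subsection \<open>Test functions\<close>

lemma test_functionsI:
  assumes "\<And>k. C_differentiable k \<phi>" "compact K" "K \<subseteq> S" "\<And>x. x \<notin> K \<Longrightarrow> \<phi> x = 0"
  shows "\<phi> \<in> test_functions S"
proof -
  have "closure {x. \<phi> x \<noteq> 0} \<subseteq> K"
    using assms compact_imp_closed by (intro closure_minimal) auto
  moreover from this have "compact (closure {x. \<phi> x \<noteq> 0})"
    using assms(2) bounded_subset compact_imp_bounded compact_eq_bounded_closed by (metis closed_closure)
  ultimately show ?thesis using assms(1,3) unfolding test_functions_def by blast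
qed

lemma test_functionsD:
  assumes "\<phi> \<in> test_functions S"
  shows "C_differentiable k \<phi>" "compact (closure {x. \<phi> x \<noteq> 0})" "closure {x. \<phi> x \<noteq> 0} \<subseteq> S"
    "x \<notin> closure {x. \<phi> x \<noteq> 0} \<Longrightarrow> \<phi> x = 0"
  using assms closure_subset[of "{x. \<phi> x \<noteq> 0}"] by (auto simp: test_functions_def)

lemma test_functions_differentiable: "\<phi> \<in> test_functions S \<Longrightarrow> \<phi> differentiable (at x)"
  using test_functionsD(1)[of \<phi> S 1] by simp

lemma test_functions_continuous: "\<phi> \<in> test_functions S \<Longrightarrow> continuous_on UNIV \<phi>"
  using test_functionsD(1) C_differentiable_continuous by blast

lemma test_functions_mono: "\<phi> \<in> test_functions S \<Longrightarrow> S \<subseteq> S' \<Longrightarrow> \<phi> \<in> test_functions S'"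
  by (auto simp: test_functions_def)

lemma test_functions_add:
  assumes "\<phi> \<in> test_functions S" "\<psi> \<in> test_functions S"
  shows "(\<lambda>x. \<phi> x + \<psi> x) \<in> test_functions S"
proof (rule test_functionsI)
  show "compact (closure {x. \<phi> x \<noteq> 0} \<union> closure {x. \<psi> x \<noteq> 0})"
    using test_functionsD(2) assms by (intro compact_Un) blast+
  show "closure {x. \<phi> x \<noteq> 0} \<union> closure {x. \<psi> x \<noteq> 0} \<subseteq> S"
    using test_functionsD(3) assms by (intro Un_least) blast+
  show "\<phi> x + \<psi> x = 0" if "x \<notin> closure {x. \<phi> x \<noteq> 0} \<union> closure {x. \<psi> x \<noteq> 0}" for x
    using that test_functionsD(4)[OF assms(1), of x] test_functionsD(4)[OF assms(2), of x] by simp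
  show "C_differentiable k (\<lambda>x. \<phi> x + \<psi> x)" for k
    using test_functionsD(1) assms by (intro C_differentiable_add) blast+
qed

lemma test_functions_mult:
  assumes "\<phi> \<in> test_functions S" "\<And>k. C_differentiable k \<psi>"
  shows "(\<lambda>x. \<phi> x * \<psi> x) \<in> test_functions S"
proof (rule test_functionsI)
  show "compact (closure {x. \<phi> x \<noteq> 0})" "closure {x. \<phi> x \<noteq> 0} \<subseteq> S"
    using test_functionsD assms by blast+
  show "\<phi> x * \<psi> x = 0" if "x \<notin> closure {x. \<phi> x \<noteq> 0}" for x
    using that test_functionsD(4)[OF assms(1), of x] by simp
  show "C_differentiable k (\<lambda>x. \<phi> x * \<psi> x)" for k
    using test_functionsD(1) assms by (intro C_differentiable_mult) blast+
qed

lemma test_functions_cmult: "\<phi> \<in> test_functions S \<Longrightarrow> (\<lambda>x. c * \<phi> x) \<in> test_functions S"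
  using test_functions_mult[of \<phi> S "\<lambda>x. c"] by (simp add: C_differentiable_const mult.commute)

lemma test_functions_zero: "(\<lambda>x. 0) \<in> test_functions S"
  by (rule test_functionsI[of _ "{}"]) (auto simp: C_differentiable_const)

lemma test_functions_partial_deriv:
  assumes "\<phi> \<in> test_functions S" "i \<in> Basis"
  shows "partial_deriv i \<phi> \<in> test_functions S"
proof (rule test_functionsI[of _ "closure {x. \<phi> x \<noteq> 0}"])
  show "C_differentiable k (partial_deriv i \<phi>)" for k
    using test_functionsD(1)[OF assms(1), of "Suc k"] assms(2) by simp
  fix x assume x: "x \<notin> closure {x. \<phi> x \<noteq> 0}"
  have "((\<lambda>_. 0) has_derivative (\<lambda>_. 0)) (at x)" by simp
  then have "(\<phi> has_derivative (\<lambda>_. 0)) (at x)"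
  proof (rule has_derivative_transform_within_open)
    show "open (- closure {x. \<phi> x \<noteq> 0})" "x \<in> - closure {x. \<phi> x \<noteq> 0}" using x by auto
    show "0 = \<phi> y" if "y \<in> - closure {x. \<phi> x \<noteq> 0}" for y
      using that test_functionsD(4)[OF assms(1), of y] by simp
  qed
  then show "partial_deriv i \<phi> x = 0" by (rule partial_deriv_eqI)
qed (rule test_functionsD(2,3)[OF assms(1)])+

lemma test_functions_bounded:
  assumes "\<phi> \<in> test_functions S"
  obtains B where "\<And>x. \<bar>\<phi> x\<bar> \<le> B"
proof -
  have "compact (\<phi> ` closure {x. \<phi> x \<noteq> 0})"
    by (rule compact_continuous_image[OF continuous_on_subset[OF test_functions_continuous[OF assms]]
          test_functionsD(2)[OF assms]]) simp
  then obtain B where B: "\<And>x. x \<in> closure {x. \<phi> x \<noteq> 0} \<Longrightarrow> \<bar>\<phi> x\<bar> \<le> B"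
    using bounded_real compact_imp_bounded by (metis imageI)
  have "\<bar>\<phi> x\<bar> \<le> max B 0" for x
    using B[of x] test_functionsD(4)[OF assms, of x] by (cases "x \<in> closure {x. \<phi> x \<noteq> 0}") auto
  then show thesis using that by blast
qed

lemma test_functions_measurable: "\<phi> \<in> test_functions S \<Longrightarrow> \<phi> \<in> borel_measurable borel"
  using test_functions_continuous borel_measurable_continuous_onI by blast

text \<open>Pointwise convergence together with the bound by 1 is what dominated convergence against
  an arbitrary integrable function requires. The range between 0 and 1 also makes the class stable
  under finite unions.\<close>

definition bump_limit :: "'a::euclidean_space set \<Rightarrow> 'a set \<Rightarrow> bool" where
  "bump_limit S U \<longleftrightarrow> (\<exists>\<phi>. (\<forall>n. \<phi> n \<in> test_functions S) \<and> (\<forall>n x. 0 \<le> \<phi> n x \<and> \<phi> n x \<le> 1) \<and>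
     (\<forall>x. (\<lambda>n. \<phi> n x) \<longlonglongrightarrow> indicator U x))"

lemma bump_limit_mono: "bump_limit S U \<Longrightarrow> S \<subseteq> S' \<Longrightarrow> bump_limit S' U"
  unfolding bump_limit_def using test_functions_mono by metis

lemma bump_limit_empty: "bump_limit S {}"
  unfolding bump_limit_def using test_functions_zero
  by (intro exI[of _ "\<lambda>_ _. 0"]) auto

lemma bump_limit_box:
  fixes a b :: "'a::euclidean_space"
  shows "bump_limit (box a b) (box a b)"
proof -
  define \<phi> where "\<phi> n x = (\<Prod>i\<in>Basis. flat_exp 0 (real (Suc n) * (x \<bullet> i - a \<bullet> i) - 1)
      * flat_exp 0 (real (Suc n) * (b \<bullet> i - x \<bullet> i) - 1))" for n x
  have "\<phi> n \<in> test_functions (box a b)" for n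
  proof (rule test_functionsI)
    \<comment> \<open>A factor of \<open>\<phi> n\<close> is nonzero only if the coordinate is
      farther than \<open>1 / Suc n\<close> from the corresponding face, so the support lies in this
      shrunken box. \<open>Suc n\<close> keeps the margin positive for every index.\<close>
    let ?K = "cbox (a + (1 / Suc n) *\<^sub>R One) (b - (1 / Suc n) *\<^sub>R One)"
    show "compact ?K" by simp
    have s: "0 < 1 / real (Suc n)" by simp
    show "?K \<subseteq> box a b"
    proof
      fix x assume "x \<in> ?K"
      then have "a \<bullet> i + 1 / Suc n \<le> x \<bullet> i \<and> x \<bullet> i \<le> b \<bullet> i - 1 / Suc n" if "i \<in> Basis" for i
        using that by (auto simp: mem_box inner_add_left inner_diff_left simp del: of_nat_Suc)
      then have "a \<bullet> i < x \<bullet> i \<and> x \<bullet> i < b \<bullet> i" if "i \<in> Basis" for i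
        using s that by (smt (verit))
      then show "x \<in> box a b" by (simp add: mem_box)
    qed
    show "\<phi> n x = 0" if "x \<notin> ?K" for x
    proof -
      obtain i where i: "i \<in> Basis" "x \<bullet> i < a \<bullet> i + 1 / Suc n \<or> b \<bullet> i - 1 / Suc n < x \<bullet> i"
        using \<open>x \<notin> ?K\<close> by (auto simp: mem_box inner_add_left inner_diff_left not_le)
      then have "real (Suc n) * (x \<bullet> i - a \<bullet> i) - 1 \<le> 0 \<or> real (Suc n) * (b \<bullet> i - x \<bullet> i) - 1 \<le> 0"
        by (auto simp: field_simps)
      then have "flat_exp 0 (real (Suc n) * (x \<bullet> i - a \<bullet> i) - 1)
        * flat_exp 0 (real (Suc n) * (b \<bullet> i - x \<bullet> i) - 1) = 0"
        by (auto simp: flat_exp_def)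
      then show ?thesis using i unfolding \<phi>_def by (intro prod_zero) auto
    qed
    fix k
    have "C_differentiable k (\<lambda>x. flat_exp 0 (real (Suc n) * (x \<bullet> i) + (- real (Suc n) * (a \<bullet> i) - 1))
      * flat_exp 0 (- real (Suc n) * (x \<bullet> i) + (real (Suc n) * (b \<bullet> i) - 1)))" for i :: 'a
      by (intro C_differentiable_mult C_differentiable_compose_affine C_differentiable_flat_exp)
    also have "(\<lambda>x. flat_exp 0 (real (Suc n) * (x \<bullet> i) + (- real (Suc n) * (a \<bullet> i) - 1))
      * flat_exp 0 (- real (Suc n) * (x \<bullet> i) + (real (Suc n) * (b \<bullet> i) - 1)))
      = (\<lambda>x. flat_exp 0 (real (Suc n) * (x \<bullet> i - a \<bullet> i) - 1)
      * flat_exp 0 (real (Suc n) * (b \<bullet> i - x \<bullet> i) - 1))" for i :: 'a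
      by (simp add: algebra_simps)
    finally show "C_differentiable k (\<phi> n)"
      unfolding \<phi>_def by (intro C_differentiable_prod)
  qed
  moreover have "0 \<le> \<phi> n x \<and> \<phi> n x \<le> 1" for n x
    unfolding \<phi>_def
    by (auto intro!: prod_nonneg prod_le_1 mult_nonneg_nonneg mult_le_one simp: flat_exp_nonneg flat_exp_0_le_1)
  moreover have "(\<lambda>n. \<phi> n x) \<longlonglongrightarrow> indicator (box a b) x" for x
  proof -
    have "(\<lambda>n. \<phi> n x) \<longlonglongrightarrow> (\<Prod>i\<in>Basis. (if x \<bullet> i - a \<bullet> i > 0 then 1 else 0) * (if b \<bullet> i - x \<bullet> i > 0 then 1 else 0))"
      unfolding \<phi>_def by (intro tendsto_prod tendsto_mult LIMSEQ_Suc[OF flat_exp_0_limit])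
    also have "(\<Prod>i\<in>Basis. (if x \<bullet> i - a \<bullet> i > 0 then 1 else 0) * (if b \<bullet> i - x \<bullet> i > 0 then 1 else 0))
        = (indicator (box a b) x :: real)"
    proof (cases "x \<in> box a b")
      case True
      then show ?thesis by (auto simp: mem_box intro!: prod.neutral)
    next
      case False
      then obtain i where "i \<in> Basis" "\<not> (a \<bullet> i < x \<bullet> i \<and> x \<bullet> i < b \<bullet> i)" by (auto simp: mem_box)
      then show ?thesis using False by (auto intro!: prod_zero bexI[of _ i])
    qed
    finally show ?thesis .
  qed
  ultimately show ?thesis unfolding bump_limit_def by blast
qed

text \<open>A maximum would not be smooth. The combination \<phi> + \<psi> - \<phi>\<psi> = 1 - (1 -
  \<phi>)(1 - \<psi>) is, stays between 0 and 1, and turns indicators into the indicator of the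
  union.\<close>

lemma bump_limit_Un:
  assumes "bump_limit S U" "bump_limit S V"
  shows "bump_limit S (U \<union> V)"
proof -
  obtain \<phi> where \<phi>: "\<And>n. \<phi> n \<in> test_functions S" "\<And>n x. 0 \<le> \<phi> n x" "\<And>n x. \<phi> n x \<le> 1"
     "\<And>x. (\<lambda>n. \<phi> n x) \<longlonglongrightarrow> indicator U x" using assms(1) by (auto simp: bump_limit_def)
  obtain \<psi> where \<psi>: "\<And>n. \<psi> n \<in> test_functions S" "\<And>n x. 0 \<le> \<psi> n x" "\<And>n x. \<psi> n x \<le> 1"
     "\<And>x. (\<lambda>n. \<psi> n x) \<longlonglongrightarrow> indicator V x" using assms(2) by (auto simp: bump_limit_def)
  have 1: "(\<lambda>x. \<phi> n x + (\<psi> n x + (- 1) * (\<phi> n x * \<psi> n x))) \<in> test_functions S" for n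
    by (intro test_functions_add test_functions_cmult test_functions_mult \<phi>(1) \<psi>(1) test_functionsD(1)[OF \<psi>(1)])
  have 2: "0 \<le> \<phi> n x + (\<psi> n x + (- 1) * (\<phi> n x * \<psi> n x))" for n x
    using mult_nonneg_nonneg[of "\<psi> n x" "1 - \<phi> n x"] \<phi>(2,3)[of n x] \<psi>(2)[of n x] by (simp add: algebra_simps)
  have 3: "\<phi> n x + (\<psi> n x + (- 1) * (\<phi> n x * \<psi> n x)) \<le> 1" for n x
    using mult_nonneg_nonneg[of "1 - \<psi> n x" "1 - \<phi> n x"] \<phi>(3)[of n x] \<psi>(3)[of n x] by (simp add: algebra_simps)
  have "(\<lambda>n. \<phi> n x + (\<psi> n x + (- 1) * (\<phi> n x * \<psi> n x))) \<longlonglongrightarrow> indicator (U \<union> V) x" for x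
  proof -
    have "(\<lambda>n. \<phi> n x + (\<psi> n x + (- 1) * (\<phi> n x * \<psi> n x)))
      \<longlonglongrightarrow> indicator U x + (indicator V x + (- 1) * (indicator U x * indicator V x))"
      by (intro tendsto_intros \<phi> \<psi>)
    then show ?thesis by (auto simp: indicator_def split: if_splits)
  qed
  with 1 2 3 show ?thesis
    unfolding bump_limit_def
    by (intro exI[of _ "\<lambda>n x. \<phi> n x + (\<psi> n x + (- 1) * (\<phi> n x * \<psi> n x))"]) blast
qed

lemma bump_limit_Union:
  assumes "finite F" "\<And>U. U \<in> F \<Longrightarrow> bump_limit S U"
  shows "bump_limit S (\<Union>F)"
  using assms by (induction F) (auto intro: bump_limit_empty bump_limit_Un)

text \<open>The step is the primitive of a smooth bump on the unit interval, normalised by its total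
  increase. Rescaled copies of \<open>\<sigma>'\<close> act as an approximate identity, and rescaled
  copies of \<open>\<sigma>\<close> approximate jumps.\<close>

lemma smooth_step_exists:
  obtains \<sigma> \<sigma>' :: "real \<Rightarrow> real" where "\<And>k. C_differentiable k \<sigma>" "continuous_on UNIV \<sigma>'"
    "\<And>x. (\<sigma> has_real_derivative \<sigma>' x) (at x)" "\<And>x. 0 \<le> \<sigma>' x"
    "\<And>x. x \<le> 0 \<Longrightarrow> \<sigma> x = 0" "\<And>x. 1 \<le> x \<Longrightarrow> \<sigma> x = 1"
    "\<And>x. x \<le> 0 \<or> 1 \<le> x \<Longrightarrow> \<sigma>' x = 0"
proof -
  define \<rho> where "\<rho> x = flat_exp 0 x * flat_exp 0 (1 - x)" for x
  have "C_differentiable k (\<lambda>x. flat_exp 0 (1 * (x \<bullet> 1) + 0) * flat_exp 0 (- 1 * (x \<bullet> 1) + 1))" for k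
    by (intro C_differentiable_mult C_differentiable_compose_affine C_differentiable_flat_exp)
  then have smooth: "C_differentiable k \<rho>" for k
    by (rule back_subst[of "C_differentiable k"]) (simp add: fun_eq_iff \<rho>_def)
  then have cont: "continuous_on UNIV \<rho>" using C_differentiable_continuous by blast
  have nonneg: "0 \<le> \<rho> x" for x by (simp add: \<rho>_def flat_exp_nonneg)
  have zero: "\<rho> x = 0" if "x \<le> 0 \<or> 1 \<le> x" for x using that by (auto simp: \<rho>_def flat_exp_def)
  have pos: "0 < \<rho> x" if "0 < x" "x < 1" for x using that by (simp add: \<rho>_def flat_exp_def)
  obtain F where F: "\<And>x. (F has_real_derivative \<rho> x) (at x)"
    using einterval_antiderivative[of "-\<infinity>" \<infinity> \<rho>] cont
    by (auto simp: continuous_on_eq_continuous_at has_real_derivative_iff_has_vector_derivative)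
  have F_cont: "continuous_on X F" for X
    using DERIV_isCont[OF F] by (simp add: continuous_at_imp_continuous_on)
  have F_deriv0: "(F has_real_derivative 0) (at x)" if "x \<le> 0 \<or> 1 \<le> x" for x
    using F[of x] zero[OF that] by simp
  have F_low: "F x = F 0" if "x \<le> 0" for x
    using DERIV_isconst_end[of x 0 F] F_cont F_deriv0 that by (cases "x = 0") auto
  have F_high: "F x = F 1" if "1 \<le> x" for x
    using DERIV_isconst_end[of 1 x F] F_cont F_deriv0 that by (cases "x = 1") auto
  have less: "F 0 < F 1"
  proof (rule DERIV_pos_imp_increasing_open[of 0 1 F])
    show "\<exists>y. (F has_real_derivative y) (at x) \<and> 0 < y" if "0 < x" "x < 1" for x
      using F pos that by blast
  qed (use F_cont in auto)
  \<comment> \<open>Written as a multiple of \<open>F\<close> plus a constant to match the closure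
    lemmas for smooth functions; \<open>\<sigma>_alt\<close> is the normalised increment.\<close>
  define \<sigma> where "\<sigma> x = (1 / (F 1 - F 0)) * F x + - F 0 / (F 1 - F 0)" for x
  have \<sigma>_alt: "\<sigma> x = (F x - F 0) / (F 1 - F 0)" for x
    by (simp add: \<sigma>_def diff_divide_distrib)
  have F_smooth: "C_differentiable k F" for k
  proof (cases k)
    case (Suc m)
    have "partial_deriv 1 F = \<rho>" using partial_deriv_has_real_derivative[OF F] by (simp add: fun_eq_iff)
    then show ?thesis using Suc smooth F real_differentiable_def by auto
  qed (use F_cont in simp)
  show thesis
  proof
    show "C_differentiable k \<sigma>" for k
      unfolding \<sigma>_def by (intro C_differentiable_add C_differentiable_cmult C_differentiable_const F_smooth)
    show "continuous_on UNIV (\<lambda>x. \<rho> x / (F 1 - F 0))"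
      using less by (intro continuous_intros cont) auto
    show "(\<sigma> has_real_derivative \<rho> x / (F 1 - F 0)) (at x)" for x
      unfolding \<sigma>_alt[abs_def] using less by (auto intro!: derivative_eq_intros F)
    show "0 \<le> \<rho> x / (F 1 - F 0)" for x using nonneg less by simp
    show "\<sigma> x = 0" if "x \<le> 0" for x using F_low[OF that] by (simp add: \<sigma>_alt)
    show "\<sigma> x = 1" if "1 \<le> x" for x using F_high[OF that] less by (simp add: \<sigma>_alt)
    show "\<rho> x / (F 1 - F 0) = 0" if "x \<le> 0 \<or> 1 \<le> x" for x using zero[OF that] by simp
  qed
qed

subsection \<open>The space of square integrable functions\<close>

lemma L2_space_measurable: "v \<in> L2_space D \<Longrightarrow> v \<in> borel_measurable (lebesgue_on D)"
  by (simp add: L2_space_def)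

lemma L2_inner_integrable:
  assumes "v \<in> L2_space D" "w \<in> L2_space D"
  shows "integrable (lebesgue_on D) (\<lambda>x. v x \<bullet> w x)"
proof (rule Bochner_Integration.integrable_bound)
  show "integrable (lebesgue_on D) (\<lambda>x. (norm (v x))\<^sup>2 + (norm (w x))\<^sup>2)"
    using assms by (auto simp: L2_space_def)
  show "(\<lambda>x. v x \<bullet> w x) \<in> borel_measurable (lebesgue_on D)"
    using assms by (intro borel_measurable_inner L2_space_measurable)
  have "\<bar>a \<bullet> b\<bar> \<le> (norm a)\<^sup>2 + (norm b)\<^sup>2" for a b :: 'b
  proof -
    have "\<bar>a \<bullet> b\<bar> \<le> norm a * norm b" by (rule Cauchy_Schwarz_ineq2)
    also have "\<dots> \<le> (norm a)\<^sup>2 + (norm b)\<^sup>2"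
      using sum_squares_bound[of "norm a" "norm b"] mult_nonneg_nonneg[of "norm a" "norm b"]
      by (simp del: mult_nonneg_nonneg)
    finally show ?thesis .
  qed
  then show "AE x in lebesgue_on D. norm (v x \<bullet> w x) \<le> norm ((norm (v x))\<^sup>2 + (norm (w x))\<^sup>2)"
    by simp
qed

lemma L2_space_lincomb:
  assumes "v \<in> L2_space D" "w \<in> L2_space D"
  shows "(\<lambda>x. a *\<^sub>R v x + b *\<^sub>R w x) \<in> L2_space D"
proof -
  have "integrable (lebesgue_on D)
      (\<lambda>x. a\<^sup>2 * (v x \<bullet> v x) + 2 * a * b * (v x \<bullet> w x) + b\<^sup>2 * (w x \<bullet> w x))"
    by (intro Bochner_Integration.integrable_add integrable_mult_right L2_inner_integrable assms)
  moreover have "(norm (a *\<^sub>R p + b *\<^sub>R q))\<^sup>2 = a\<^sup>2 * (p \<bullet> p) + 2 * a * b * (p \<bullet> q) + b\<^sup>2 * (q \<bullet> q)" for p q :: 'b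
    unfolding power2_norm_eq_inner
    by (simp add: inner_add_left inner_add_right inner_commute power2_eq_square algebra_simps)
  moreover have "(\<lambda>x. a *\<^sub>R v x + b *\<^sub>R w x) \<in> borel_measurable (lebesgue_on D)"
    by (intro borel_measurable_add borel_measurable_scaleR borel_measurable_const L2_space_measurable assms)
  ultimately show ?thesis by (simp add: L2_space_def)
qed

lemma L2_inner_commute: "L2_inner D v w = L2_inner D w v"
  by (simp add: L2_inner_def inner_commute)

lemma L2_inner_lincomb:
  assumes "v \<in> L2_space D" "w \<in> L2_space D" "u \<in> L2_space D"
  shows "L2_inner D (\<lambda>x. a *\<^sub>R v x + b *\<^sub>R w x) u = a * L2_inner D v u + b * L2_inner D w u"
  unfolding L2_inner_def using assms
  by (simp add: inner_add_left L2_inner_integrable)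

lemma L2_inner_cong_AE:
  assumes "AE x in lebesgue_on D. v x = v' x" "AE x in lebesgue_on D. w x = w' x"
    "v \<in> borel_measurable (lebesgue_on D)" "v' \<in> borel_measurable (lebesgue_on D)"
    "w \<in> borel_measurable (lebesgue_on D)" "w' \<in> borel_measurable (lebesgue_on D)"
  shows "L2_inner D v w = L2_inner D v' w'"
  unfolding L2_inner_def
  by (rule integral_cong_AE) (use assms in \<open>auto intro: borel_measurable_inner\<close>)

lemma L2_norm_nonneg: "0 \<le> L2_norm D v"
  by (simp add: L2_norm_def)

lemma L2_norm_power2: "(L2_norm D v)\<^sup>2 = L2_inner D v v"
  by (simp add: L2_norm_def L2_inner_def power2_norm_eq_inner)

lemma L2_norm_eq_sqrt: "L2_norm D v = sqrt (L2_inner D v v)"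
  by (simp add: L2_norm_def L2_inner_def power2_norm_eq_inner)

lemma L2_norm_lincomb_power2:
  assumes "v \<in> L2_space D" "w \<in> L2_space D"
  shows "(L2_norm D (\<lambda>x. a *\<^sub>R v x + b *\<^sub>R w x))\<^sup>2
     = a\<^sup>2 * (L2_norm D v)\<^sup>2 + 2 * a * b * L2_inner D v w + b\<^sup>2 * (L2_norm D w)\<^sup>2"
proof -
  let ?s = "\<lambda>x. a *\<^sub>R v x + b *\<^sub>R w x"
  have "L2_inner D ?s ?s = a * L2_inner D v ?s + b * L2_inner D w ?s"
    by (intro L2_inner_lincomb L2_space_lincomb assms)
  then show ?thesis
    unfolding L2_norm_power2 L2_inner_commute[of _ v ?s] L2_inner_commute[of _ w ?s]
      L2_inner_lincomb[OF assms assms(1)] L2_inner_lincomb[OF assms assms(2)] L2_inner_commute[of _ w v]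
    by (simp add: algebra_simps power2_eq_square)
qed

lemma L2_Cauchy_Schwarz:
  assumes "v \<in> L2_space D" "w \<in> L2_space D"
  shows "\<bar>L2_inner D v w\<bar> \<le> L2_norm D v * L2_norm D w"
proof -
  let ?A = "(L2_norm D v)\<^sup>2" and ?B = "L2_inner D v w" and ?C = "(L2_norm D w)\<^sup>2"
  have q: "0 \<le> a\<^sup>2 * ?A + 2 * a * b * ?B + b\<^sup>2 * ?C" for a b
    using L2_norm_lincomb_power2[OF assms, of a b] zero_le_power2 by metis
  have "?B\<^sup>2 \<le> ?A * ?C"
  proof (cases "?C = 0")
    case True
    \<comment> \<open>Norm zero does not make the representative \<open>w\<close> zero, so this case
      needs its own argument: the form is now affine in \<open>b\<close>, and being nonnegative for
      every multiple \<open>- k * ?B\<close> forces \<open>?B = 0\<close>. The value of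
      \<open>k\<close> chosen next would make it equal to -1.\<close>
    have "0 \<le> ?A - 2 * k * ?B\<^sup>2" for k
      using q[of 1 "- k * ?B"] True by (simp add: power2_eq_square algebra_simps)
    from this[of "(?A + 1) / (2 * ?B\<^sup>2)"] have "?B = 0" by (cases "?B = 0") auto
    then show ?thesis using True by simp
  next
    case False
    \<comment> \<open>The form at \<open>a = ?C\<close>, \<open>b = - ?B\<close>, which is its
      minimiser in \<open>b\<close> for that \<open>a\<close>.\<close>
    have "0 \<le> ?C * (?A * ?C - ?B\<^sup>2)"
      using q[of ?C "- ?B"] by (simp add: power2_eq_square algebra_simps)
    moreover have "0 < ?C" using False by simp
    ultimately show ?thesis by (simp add: zero_le_mult_iff)
  qed
  then have "\<bar>?B\<bar>\<^sup>2 \<le> (L2_norm D v * L2_norm D w)\<^sup>2" by (simp add: power_mult_distrib)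
  then show ?thesis by (rule power2_le_imp_le) (simp add: L2_norm_nonneg)
qed

lemma L2_norm_lincomb_le:
  assumes "v \<in> L2_space D" "w \<in> L2_space D"
  shows "L2_norm D (\<lambda>x. a *\<^sub>R v x + b *\<^sub>R w x) \<le> \<bar>a\<bar> * L2_norm D v + \<bar>b\<bar> * L2_norm D w"
proof (rule power2_le_imp_le)
  have "2 * a * b * L2_inner D v w \<le> 2 * \<bar>a\<bar> * \<bar>b\<bar> * \<bar>L2_inner D v w\<bar>"
    by (metis abs_ge_self abs_mult abs_numeral)
  also have "\<dots> \<le> 2 * \<bar>a\<bar> * \<bar>b\<bar> * (L2_norm D v * L2_norm D w)"
    by (intro mult_left_mono L2_Cauchy_Schwarz assms) auto
  finally show "(L2_norm D (\<lambda>x. a *\<^sub>R v x + b *\<^sub>R w x))\<^sup>2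
      \<le> (\<bar>a\<bar> * L2_norm D v + \<bar>b\<bar> * L2_norm D w)\<^sup>2"
    unfolding L2_norm_lincomb_power2[OF assms] by (simp add: power2_sum power_mult_distrib mult_ac)
  show "0 \<le> \<bar>a\<bar> * L2_norm D v + \<bar>b\<bar> * L2_norm D w" by (simp add: L2_norm_nonneg)
qed

lemma L2_space_diff:
  assumes "v \<in> L2_space D" "w \<in> L2_space D" shows "v - w \<in> L2_space D"
  using L2_space_lincomb[OF assms, of 1 "-1"] by (simp add: fun_diff_def)

lemma L2_space_zero: "0 \<in> L2_space D"
  by (simp add: L2_space_def zero_fun_def)

lemma L2_norm_diff_le:
  assumes "v \<in> L2_space D" "w \<in> L2_space D"
  shows "L2_norm D (v - w) \<le> L2_norm D v + L2_norm D w"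
  using L2_norm_lincomb_le[OF assms, of 1 "-1"] by (simp add: fun_diff_def)

lemma L2_norm_diff_power2:
  assumes "v \<in> L2_space D" "w \<in> L2_space D"
  shows "(L2_norm D (v - w))\<^sup>2 = (L2_norm D v)\<^sup>2 - 2 * L2_inner D v w + (L2_norm D w)\<^sup>2"
  using L2_norm_lincomb_power2[OF assms, of 1 "-1"] by (simp add: fun_diff_def)

lemma L2_inner_diff_left:
  assumes "v \<in> L2_space D" "w \<in> L2_space D" "u \<in> L2_space D"
  shows "L2_inner D (v - w) u = L2_inner D v u - L2_inner D w u"
  using L2_inner_lincomb[OF assms, of 1 "-1"] by (simp add: fun_diff_def)

lemma L2_inner_diff_right:
  assumes "v \<in> L2_space D" "w \<in> L2_space D" "u \<in> L2_space D"
  shows "L2_inner D u (v - w) = L2_inner D u v - L2_inner D u w"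
  using L2_inner_diff_left[OF assms] by (simp add: L2_inner_commute)

lemma L2_norm_cong_AE:
  assumes "AE x in lebesgue_on D. v x = v' x"
    "v \<in> borel_measurable (lebesgue_on D)" "v' \<in> borel_measurable (lebesgue_on D)"
  shows "L2_norm D v = L2_norm D v'"
  unfolding L2_norm_eq_sqrt using L2_inner_cong_AE[OF assms(1,1) assms(2,3,2,3)] by simp

section \<open>The fundamental lemma of the calculus of variations\<close>

lemma integral_mult_indicator_limit:
  fixes g :: "'a \<Rightarrow> real"
  assumes "integrable M g" "\<And>n. \<phi> n \<in> borel_measurable M" "U \<inter> space M \<in> sets M"
    "\<And>n x. \<bar>\<phi> n x\<bar> \<le> 1" "\<And>x. x \<in> space M \<Longrightarrow> (\<lambda>n. \<phi> n x) \<longlonglongrightarrow> (indicator U x :: real)"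
  shows "(\<lambda>n. LINT x|M. g x * \<phi> n x) \<longlonglongrightarrow> (LINT x|M. g x * indicator U x)"
proof (rule integral_dominated_convergence[where w="\<lambda>x. \<bar>g x\<bar>"])
  have [measurable]: "g \<in> borel_measurable M" using assms(1) by auto
  show "(\<lambda>x. g x * indicator U x) \<in> borel_measurable M"
    using assms(3) by (intro borel_measurable_times borel_measurable_indicator_iff[THEN iffD2]) auto
  show "(\<lambda>x. g x * \<phi> n x) \<in> borel_measurable M" for n using assms(2) by measurable
  show "AE x in M. norm (g x * \<phi> n x) \<le> \<bar>g x\<bar>" for n
    using assms(4)[of n] by (auto simp: abs_mult intro!: mult_left_le)
  show "AE x in M. (\<lambda>n. g x * \<phi> n x) \<longlonglongrightarrow> g x * indicator U x"
    using assms(5) by (auto intro!: tendsto_intros)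
qed (use assms in auto)

lemma test_functions_measurable_lebesgue_on:
  "\<phi> \<in> test_functions S \<Longrightarrow> \<phi> \<in> borel_measurable (lebesgue_on D)"
  by (intro measurable_restrict_space1 measurable_completion)
     (simp add: test_functions_measurable)

text \<open>The integral of \<open>g\<close> vanishes over finite unions of boxes by bump limits,
  over open subsets by exhausting them with such unions, over compact subsets by subtracting the
  complement in \<open>D\<close>, and over countable unions of compact sets by exhaustion again. A
  Lebesgue set is such a union up to a null set, and vanishing integrals over all measurable sets
  force \<open>g = 0\<close> almost everywhere.\<close>

lemma fundamental_lemma_calculus_of_variations:
  fixes g :: "'a::euclidean_space \<Rightarrow> real"
  assumes "open D" "bounded D" and g: "integrable (lebesgue_on D) g"
    and 0: "\<And>\<phi>. \<phi> \<in> test_functions D \<Longrightarrow> (LINT x|lebesgue_on D. g x * \<phi> x) = 0"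
  shows "AE x in lebesgue_on D. g x = 0"
proof -
  let ?M = "lebesgue_on D"
  have sets: "A \<inter> D \<in> sets ?M" if "A \<in> sets lebesgue" for A
    using that assms(1) by (auto simp: sets_restrict_space_iff intro!: sets.Int)
  have limit0: "(LINT x|?M. g x * indicator U x) = 0" if U: "bump_limit D U" "U \<in> sets lebesgue" for U
  proof -
    obtain \<phi> where \<phi>: "\<And>n. \<phi> n \<in> test_functions D" "\<And>n x. 0 \<le> \<phi> n x" "\<And>n x. \<phi> n x \<le> 1"
      "\<And>x. (\<lambda>n. \<phi> n x) \<longlonglongrightarrow> indicator U x" using U(1) by (auto simp: bump_limit_def)
    have "(\<lambda>n. LINT x|?M. g x * \<phi> n x) \<longlonglongrightarrow> (LINT x|?M. g x * indicator U x)"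
    proof (rule integral_mult_indicator_limit[OF g])
      show "\<phi> n \<in> borel_measurable ?M" for n
        by (rule test_functions_measurable_lebesgue_on[OF \<phi>(1)])
      show "U \<inter> space ?M \<in> sets ?M" using sets[OF U(2)] by simp
      show "\<bar>\<phi> n x\<bar> \<le> 1" for n x using \<phi>(2,3)[of n x] by simp
      show "(\<lambda>n. \<phi> n x) \<longlonglongrightarrow> indicator U x" for x by (rule \<phi>(4))
    qed
    then show ?thesis using 0[OF \<phi>(1)] by (simp add: LIMSEQ_const_iff)
  qed
  have open0: "(LINT x|?M. g x * indicator U x) = 0" if U: "open U" "U \<subseteq> D" for U
  proof -
    obtain \<B> where \<B>: "countable \<B>" "\<B> \<subseteq> Pow U" "\<And>X. X \<in> \<B> \<Longrightarrow> \<exists>a b. X = box a b" "\<Union>\<B> = U"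
      using open_countable_Union_open_box[OF U(1)] by metis
    \<comment> \<open>\<open>from_nat_into\<close> enumerates a countable set only if it is
      nonempty; adding the empty set handles an empty \<open>\<B>\<close> and leaves the union
      unchanged.\<close>
    define X where "X n = \<Union>(from_nat_into (insert {} \<B>) ` {..<n})" for n :: nat
    have rng: "range (from_nat_into (insert {} \<B>)) = insert {} \<B>"
      using \<B>(1) by (simp add: range_from_nat_into)
    have X: "bump_limit D (X n) \<and> open (X n)" for n
    proof -
      have Y: "bump_limit D Y \<and> open Y" if "Y \<in> insert {} \<B>" for Y
      proof (cases "Y = {}")
        case False
        then have "Y \<in> \<B>" using that by blast
        then obtain a b where "Y = box a b" "box a b \<subseteq> D" using \<B>(2,3) U(2) by blast
        then show ?thesis by (auto intro: bump_limit_mono[OF bump_limit_box] open_box)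
      qed (simp add: bump_limit_empty)
      have "from_nat_into (insert {} \<B>) ` {..<n} \<subseteq> insert {} \<B>" using rng by blast
      with Y have "bump_limit D Z \<and> open Z" if "Z \<in> from_nat_into (insert {} \<B>) ` {..<n}" for Z
        using that by blast
      then show ?thesis unfolding X_def by (intro conjI bump_limit_Union open_Union) blast+
    qed
    have "(\<lambda>n. LINT x|?M. g x * indicator (X n) x) \<longlonglongrightarrow> (LINT x|?M. g x * indicator U x)"
    proof (rule integral_mult_indicator_limit[OF g])
      show "indicat_real (X n) \<in> borel_measurable ?M" for n
        using X sets by (intro borel_measurable_indicator_iff[THEN iffD2]) auto
      show "U \<inter> space ?M \<in> sets ?M" using U sets by auto
      have U_eq: "(\<Union>n. X n) = U"
      proof -
        have "(\<Union>n. X n) = \<Union>(range (from_nat_into (insert {} \<B>)))" unfolding X_def by blast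
        then show ?thesis using rng \<B>(4) by simp
      qed
      have "incseq X" unfolding X_def by (intro monoI Union_mono image_mono) auto
      from LIMSEQ_indicator_incseq[OF this] U_eq
      show "(\<lambda>n. indicator (X n) x) \<longlonglongrightarrow> (indicator U x :: real)" for x by simp
    qed auto
    then show ?thesis using limit0 X by (simp add: LIMSEQ_const_iff)
  qed
  have "set_lebesgue_integral ?M A g = 0" if A: "A \<in> sets ?M" for A
  proof -
    have A': "A \<in> sets lebesgue" "A \<subseteq> D"
      using A assms(1) by (auto simp: sets_restrict_space_iff)
    obtain C N where C: "fsigma C" "N \<in> null_sets lebesgue" "C \<union> N = A" "disjnt C N"
      using lebesgue_set_almost_fsigma[OF A'(1)] by metis
    obtain F :: "nat \<Rightarrow> 'a set" where F: "range F \<subseteq> Collect compact" "C = \<Union>(range F)"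
      using fsigma_Union_compact C(1) by metis
    have C_sets: "C \<in> sets lebesgue"
      unfolding F(2) using F(1) by (intro sets.countable_UN) (auto intro!: fmeasurableD lmeasurable_compact)
    define K where "K n = \<Union>(F ` {..<n})" for n
    have K: "compact (K n)" for n unfolding K_def using F(1) by (intro compact_UN) auto
    have KD: "K n \<subseteq> D" for n using A' C F by (auto simp: K_def)
    have K0: "(LINT x|?M. g x * indicator (K n) x) = 0" for n
    proof -
      have int: "integrable ?M (\<lambda>x. g x * indicator U x)" if "open U" for U
      proof -
        have "integrable ?M (\<lambda>x. indicator (U \<inter> D) x *\<^sub>R g x)"
          using that by (intro integrable_mult_indicator sets g) auto
        moreover have "indicator (U \<inter> D) x *\<^sub>R g x = g x * indicator U x" if "x \<in> space ?M" for x
          using that by (auto simp: indicator_def)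
        ultimately show ?thesis using Bochner_Integration.integrable_cong[OF refl] by (metis (no_types, lifting))
      qed
      have "(LINT x|?M. g x * indicator (K n) x)
          = (LINT x|?M. g x * indicator D x - g x * indicator (D - K n) x)"
        using KD by (intro Bochner_Integration.integral_cong) (auto simp: indicator_def)
      also have "\<dots> = (LINT x|?M. g x * indicator D x) - (LINT x|?M. g x * indicator (D - K n) x)"
        using K compact_imp_closed assms(1) by (intro Bochner_Integration.integral_diff int) auto
      also have "\<dots> = 0" using open0[of D] open0[OF open_Diff[OF assms(1) compact_imp_closed[OF K[of n]]]] assms(1) by simp
      finally show ?thesis .
    qed
    have "(\<lambda>n. LINT x|?M. g x * indicator (K n) x) \<longlonglongrightarrow> (LINT x|?M. g x * indicator C x)"
    proof (rule integral_mult_indicator_limit[OF g])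
      show "indicat_real (K n) \<in> borel_measurable ?M" for n
        using sets[OF fmeasurableD[OF lmeasurable_compact[OF K[of n]]]] by (intro borel_measurable_indicator_iff[THEN iffD2]) auto
      show "C \<inter> space ?M \<in> sets ?M" using sets[OF C_sets] by simp
      have "incseq K" unfolding K_def by (intro monoI Union_mono image_mono) auto
      moreover have "(\<Union>n. K n) = C" unfolding K_def F(2) by blast
      ultimately show "(\<lambda>n. indicator (K n) x) \<longlonglongrightarrow> (indicator C x :: real)" for x
        using LIMSEQ_indicator_incseq by metis
    qed auto
    then have C0: "(LINT x|?M. g x * indicator C x) = 0" using K0 by (simp add: LIMSEQ_const_iff)
    have "set_lebesgue_integral ?M A g = (LINT x|?M. g x * indicator C x)"
      unfolding set_lebesgue_integral_def
    proof (rule integral_cong_AE)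
      have "AE x in lebesgue. x \<notin> N" using C(2) by (rule AE_not_in)
      then have "AE x in ?M. x \<notin> N" using assms(1) by (simp add: AE_restrict_space_iff) (auto elim: eventually_mono)
      then show "AE x in ?M. indicator A x *\<^sub>R g x = g x * indicator C x"
        by eventually_elim (use C in \<open>auto simp: indicator_def\<close>)
      show "(\<lambda>x. g x * indicator C x) \<in> borel_measurable ?M"
        using g sets[OF C_sets] by (intro borel_measurable_times borel_measurable_indicator_iff[THEN iffD2]) auto
      show "(\<lambda>x. indicator A x *\<^sub>R g x) \<in> borel_measurable ?M" using g A by measurable
    qed
    then show ?thesis using C0 by simp
  qed
  moreover have "finite_measure ?M"
    using assms(1,2) by (intro finite_measure_lebesgue_on bounded_set_imp_lmeasurable) auto
  ultimately show ?thesis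
    using sigma_finite_measure.density_zero[OF finite_measure.axioms(1) g] by blast
qed

subsection \<open>Weak gradients\<close>

text \<open>The partial derivative is a limit of difference quotients, and each quotient has
  integral 0 because Lebesgue measure is translation invariant. The mean value theorem bounds the
  quotients by a bound of the derivative, and they vanish outside one fixed ball, so dominated
  convergence applies.\<close>

lemma integral_partial_deriv_eq_0:
  fixes \<psi> :: "'a::euclidean_space \<Rightarrow> real"
  assumes \<psi>: "\<psi> \<in> test_functions UNIV" and i: "i \<in> Basis"
  shows "(LINT x|lborel. partial_deriv i \<psi> x) = 0"
proof -
  obtain B where B: "\<And>x. \<bar>partial_deriv i \<psi> x\<bar> \<le> B"
    using test_functions_bounded[OF test_functions_partial_deriv[OF assms]] by metis
  obtain R where R: "0 < R" "closure {x. \<psi> x \<noteq> 0} \<subseteq> ball 0 R"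
    using bounded_subset_ballD[OF compact_imp_bounded[OF test_functionsD(2)[OF \<psi>]]] by metis
  have zero: "\<psi> x = 0" if "R \<le> norm x" for x
    using that R test_functionsD(4)[OF \<psi>, of x] by fastforce
  have [measurable]: "\<psi> \<in> borel_measurable borel" by (rule test_functions_measurable[OF \<psi>])
  have int: "integrable lborel \<psi>"
  proof -
    have "integrable lborel (\<lambda>x. indicator (cball 0 R) x *\<^sub>R \<psi> x)"
      using borel_integrable_compact[OF compact_cball, of 0 R \<psi>]
        continuous_on_subset[OF test_functions_continuous[OF \<psi>]] by (simp add: set_integrable_def)
    then show ?thesis
      by (rule Bochner_Integration.integrable_cong[THEN iffD1, rotated -1])
         (use zero in \<open>auto simp: indicator_def dist_norm\<close>)
  qed
  have shift: "has_bochner_integral lborel (\<lambda>x. \<psi> (c + x)) (LINT x|lborel. \<psi> x)" for c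
    using integrable_distr_eq[of "(+) c" lborel borel \<psi>] integral_distr[of "(+) c" lborel borel \<psi>]
      int lborel_distr_plus[of c]
    by (simp add: has_bochner_integral_iff)
  define q where "q n x = real (Suc n) * (\<psi> ((1 / real (Suc n)) *\<^sub>R i + x) - \<psi> x)" for n x
  have deriv_line: "((\<lambda>t. \<psi> (t *\<^sub>R i + x)) has_real_derivative partial_deriv i \<psi> (t *\<^sub>R i + x)) (at t)" for t x
  proof -
    have "((\<lambda>t. t *\<^sub>R i + x) has_derivative (\<lambda>h. h *\<^sub>R i)) (at t)"
      by (auto intro!: derivative_eq_intros)
    note d = has_derivative_compose[OF this has_derivative_partial_deriv[OF test_functions_differentiable[OF \<psi>]]]
    have "frechet_derivative \<psi> (at (t *\<^sub>R i + x)) (h *\<^sub>R i) = partial_deriv i \<psi> (t *\<^sub>R i + x) * h" for h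
      using linear_scale[OF linear_frechet_derivative[OF test_functions_differentiable[OF \<psi>]]]
      by (simp add: partial_deriv_def)
    then show ?thesis using d by (simp add: has_field_derivative_def mult.commute[of _ "partial_deriv i \<psi> _"])
  qed
  have q_lim: "(\<lambda>n. q n x) \<longlonglongrightarrow> partial_deriv i \<psi> x" for x
  proof -
    have "((\<lambda>h. (\<psi> (h *\<^sub>R i + x) - \<psi> x) / h) \<longlongrightarrow> partial_deriv i \<psi> x) (at 0)"
      using deriv_line[of x 0] by (simp add: DERIV_def)
    moreover have "filterlim (\<lambda>n. 1 / real (Suc n)) (at 0) sequentially"
      by (intro filterlim_atI LIMSEQ_Suc[OF lim_1_over_n]) auto
    ultimately have "(\<lambda>n. (\<psi> ((1 / real (Suc n)) *\<^sub>R i + x) - \<psi> x) / (1 / real (Suc n))) \<longlonglongrightarrow> partial_deriv i \<psi> x"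
      by (rule filterlim_compose)
    then show ?thesis by (simp add: q_def mult.commute)
  qed
  \<comment> \<open>The translation has length at most 1, which explains the radius
    \<open>R + 1\<close>.\<close>
  have q_bound: "\<bar>q n x\<bar> \<le> B * indicator (cball 0 (R + 1)) x" for n x
  proof -
    have s: "0 < 1 / real (Suc n)" "1 / real (Suc n) \<le> 1" by auto
    obtain t where t: "0 < t" "t < 1 / real (Suc n)"
      "\<psi> ((1 / real (Suc n)) *\<^sub>R i + x) - \<psi> (0 *\<^sub>R i + x) = (1 / real (Suc n) - 0) * partial_deriv i \<psi> (t *\<^sub>R i + x)"
      using MVT2[OF s(1) deriv_line[of x]] by metis
    then have q: "q n x = partial_deriv i \<psi> (t *\<^sub>R i + x)" by (simp add: q_def del: of_nat_Suc)
    show ?thesis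
    proof (cases "x \<in> cball 0 (R + 1)")
      case False
      have "norm x \<le> norm ((1 / real (Suc n)) *\<^sub>R i + x) + norm ((1 / real (Suc n)) *\<^sub>R i)"
        by (metis add_diff_cancel_left' norm_triangle_ineq4)
      moreover have "norm ((1 / real (Suc n)) *\<^sub>R i) \<le> 1" using i s by simp
      moreover have "R + 1 < norm x" using False by simp
      ultimately have "R \<le> norm ((1 / real (Suc n)) *\<^sub>R i + x)" "R \<le> norm x" by linarith+
      then have "\<psi> ((1 / real (Suc n)) *\<^sub>R i + x) = 0" "\<psi> x = 0" by (auto intro: zero simp del: of_nat_Suc)
      then show ?thesis using False by (simp add: q_def)
    qed (use q B in auto)
  qed
  have "(\<lambda>n. LINT x|lborel. q n x) \<longlonglongrightarrow> (LINT x|lborel. partial_deriv i \<psi> x)"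
  proof (rule integral_dominated_convergence[where w="\<lambda>x. B * indicator (cball 0 (R + 1)) x"])
    show "partial_deriv i \<psi> \<in> borel_measurable lborel"
      using test_functions_measurable[OF test_functions_partial_deriv[OF assms]] by simp
    show "q n \<in> borel_measurable lborel" for n unfolding q_def[abs_def] by measurable
    show "integrable lborel (\<lambda>x::'a. B * indicator (cball 0 (R + 1)) x :: real)"
      using emeasure_bounded_finite[OF bounded_cball, of "0::'a" "R + 1"] by (intro integrable_mult_right integrable_real_indicator) auto
  qed (use q_lim q_bound in auto)
  moreover have "(LINT x|lborel. q n x) = 0" for n
    using shift[of "(1 / real (Suc n)) *\<^sub>R i"] int
    unfolding q_def has_bochner_integral_iff by simp
  ultimately show ?thesis by (simp add: LIMSEQ_const_iff)
qed

text \<open>Connects the measure in which the function spaces are defined with the one in which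
  translation invariance was used.\<close>

lemma integral_lebesgue_on_eq_lborel:
  fixes h :: "'a::euclidean_space \<Rightarrow> real"
  assumes "open D" "h \<in> borel_measurable borel" "\<And>x. x \<notin> D \<Longrightarrow> h x = 0"
  shows "(LINT x|lebesgue_on D. h x) = (LINT x|lborel. h x)"
proof -
  have "(LINT x|lebesgue_on D. h x) = (LINT x|lebesgue. indicator D x *\<^sub>R h x)"
    using assms(1) by (simp add: integral_restrict_space)
  also have "(\<lambda>x. indicator D x *\<^sub>R h x) = h" using assms(3) by (auto simp: indicator_def fun_eq_iff)
  finally show ?thesis using assms(2) by (simp add: integral_completion)
qed

lemma square_lincomb_le: "(a * p + b * q)\<^sup>2 \<le> 2 * a\<^sup>2 * p\<^sup>2 + 2 * b\<^sup>2 * (q::real)\<^sup>2"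
proof -
  have "0 \<le> (a * p - b * q)\<^sup>2" by simp
  then show ?thesis by (simp add: power2_eq_square algebra_simps)
qed

locale bounded_domain =
  fixes D :: "'a::euclidean_space set"
  assumes open_domain: "open D" and bounded_domain: "bounded D"
begin

lemma finite_measure_domain: "finite_measure (lebesgue_on D)"
  using open_domain bounded_domain
  by (intro finite_measure_lebesgue_on bounded_set_imp_lmeasurable) auto

lemma L2_space_of_bounded:
  assumes "v \<in> borel_measurable (lebesgue_on D)" "\<And>x. norm (v x) \<le> B"
  shows "v \<in> L2_space D"
proof -
  interpret finite_measure "lebesgue_on D" by (rule finite_measure_domain)
  have "(norm (v x))\<^sup>2 \<le> B\<^sup>2" for x using assms(2) by (intro power_mono) auto
  then have "integrable (lebesgue_on D) (\<lambda>x. (norm (v x))\<^sup>2)"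
    using assms(1) by (intro integrable_const_bound[of _ "B\<^sup>2"]) auto
  then show ?thesis using assms by (simp add: L2_space_def)
qed

lemma test_functions_L2: "\<phi> \<in> test_functions S \<Longrightarrow> \<phi> \<in> L2_space D"
  using test_functions_bounded test_functions_measurable_lebesgue_on L2_space_of_bounded
  by (metis real_norm_def)

lemma component_L2:
  assumes "g \<in> L2_space D" "i \<in> Basis"
  shows "(\<lambda>x. g x \<bullet> i) \<in> L2_space D"
proof -
  have "integrable (lebesgue_on D) (\<lambda>x. (norm (g x \<bullet> i))\<^sup>2)"
  proof (rule Bochner_Integration.integrable_bound)
    show "integrable (lebesgue_on D) (\<lambda>x. (norm (g x))\<^sup>2)" using assms by (simp add: L2_space_def)
    show "(\<lambda>x. (norm (g x \<bullet> i))\<^sup>2) \<in> borel_measurable (lebesgue_on D)"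
      using L2_space_measurable[OF assms(1)] by measurable
    show "AE x in lebesgue_on D. norm ((norm (g x \<bullet> i))\<^sup>2) \<le> norm ((norm (g x))\<^sup>2)"
    proof (rule AE_I2)
      fix x
      have "(norm (g x \<bullet> i))\<^sup>2 \<le> (norm (g x))\<^sup>2"
        using Basis_le_norm[OF assms(2), of "g x"] by (intro power_mono) auto
      then show "norm ((norm (g x \<bullet> i))\<^sup>2) \<le> norm ((norm (g x))\<^sup>2)" by simp
    qed
  qed
  moreover have "(\<lambda>x. g x \<bullet> i) \<in> borel_measurable (lebesgue_on D)"
    using L2_space_measurable[OF assms(1)] by measurable
  ultimately show ?thesis by (simp add: L2_space_def)
qed

lemma L2_integrable_mult_test:
  assumes "v \<in> L2_space D" "\<phi> \<in> test_functions S"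
  shows "integrable (lebesgue_on D) (\<lambda>x. v x * \<phi> x)"
  using L2_inner_integrable[OF assms(1) test_functions_L2[OF assms(2)]] by simp

lemma is_weak_gradient_lincomb:
  assumes "v \<in> L2_space D" "w \<in> L2_space D" "g \<in> L2_space D" "h \<in> L2_space D"
    "is_weak_gradient D v g" "is_weak_gradient D w h"
  shows "is_weak_gradient D (\<lambda>x. a *\<^sub>R v x + b *\<^sub>R w x) (\<lambda>x. a *\<^sub>R g x + b *\<^sub>R h x)"
  unfolding is_weak_gradient_def
proof (intro ballI)
  fix \<phi> and i :: 'a assume \<phi>: "\<phi> \<in> test_functions D" and i: "i \<in> Basis"
  note int = L2_integrable_mult_test[OF assms(1) test_functions_partial_deriv[OF \<phi> i]]
    L2_integrable_mult_test[OF assms(2) test_functions_partial_deriv[OF \<phi> i]]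
    L2_integrable_mult_test[OF component_L2[OF assms(3) i] \<phi>]
    L2_integrable_mult_test[OF component_L2[OF assms(4) i] \<phi>]
  have "(LINT x|lebesgue_on D. (a *\<^sub>R v x + b *\<^sub>R w x) * partial_deriv i \<phi> x)
      = (LINT x|lebesgue_on D. a * (v x * partial_deriv i \<phi> x) + b * (w x * partial_deriv i \<phi> x))"
    by (simp add: algebra_simps)
  also have "\<dots> = a * - (LINT x|lebesgue_on D. (g x \<bullet> i) * \<phi> x) + b * - (LINT x|lebesgue_on D. (h x \<bullet> i) * \<phi> x)"
    using int assms(5,6) \<phi> i by (simp add: is_weak_gradient_def)
  also have "\<dots> = - (LINT x|lebesgue_on D. a * ((g x \<bullet> i) * \<phi> x) + b * ((h x \<bullet> i) * \<phi> x))"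
    using int by simp
  also have "\<dots> = - (LINT x|lebesgue_on D. ((a *\<^sub>R g x + b *\<^sub>R h x) \<bullet> i) * \<phi> x)"
    by (simp add: inner_add_left algebra_simps)
  finally show "(LINT x|lebesgue_on D. (a *\<^sub>R v x + b *\<^sub>R w x) * partial_deriv i \<phi> x)
      = - (LINT x|lebesgue_on D. ((a *\<^sub>R g x + b *\<^sub>R h x) \<bullet> i) * \<phi> x)" .
qed

lemma is_weak_gradient_unique:
  assumes "g \<in> L2_space D" "h \<in> L2_space D" "is_weak_gradient D v g" "is_weak_gradient D v h"
  shows "AE x in lebesgue_on D. g x = h x"
proof -
  interpret finite_measure "lebesgue_on D" by (rule finite_measure_domain)
  \<comment> \<open>The domain has finite measure, so pairing with the constant 1 makes square
    integrable components integrable, as the fundamental lemma requires.\<close>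
  have one: "(\<lambda>x. 1::real) \<in> L2_space D" by (rule L2_space_of_bounded[of _ 1]) auto
  have "AE x in lebesgue_on D. g x \<bullet> i - h x \<bullet> i = 0" if i: "i \<in> Basis" for i
  proof (rule fundamental_lemma_calculus_of_variations[OF open_domain bounded_domain])
    show "integrable (lebesgue_on D) (\<lambda>x. g x \<bullet> i - h x \<bullet> i)"
      using L2_inner_integrable[OF component_L2[OF assms(1) i] one]
        L2_inner_integrable[OF component_L2[OF assms(2) i] one] by simp
    fix \<phi> assume \<phi>: "\<phi> \<in> test_functions D"
    have "(LINT x|lebesgue_on D. (g x \<bullet> i) * \<phi> x) = (LINT x|lebesgue_on D. (h x \<bullet> i) * \<phi> x)"
      using assms(3,4) \<phi> i by (simp add: is_weak_gradient_def)
    then show "(LINT x|lebesgue_on D. (g x \<bullet> i - h x \<bullet> i) * \<phi> x) = 0"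
      using L2_integrable_mult_test[OF component_L2[OF assms(1) i] \<phi>]
        L2_integrable_mult_test[OF component_L2[OF assms(2) i] \<phi>]
      by (simp add: left_diff_distrib)
  qed
  then have "AE x in lebesgue_on D. \<forall>i\<in>Basis. g x \<bullet> i - h x \<bullet> i = 0"
    by (intro AE_finite_allI) auto
  then show ?thesis by eventually_elim (auto intro: euclidean_eqI)
qed

lemma W12_L2: "v \<in> W12_space D \<Longrightarrow> v \<in> L2_space D"
  by (simp add: W12_space_def)

lemma grad_L2: "v \<in> W12_space D \<Longrightarrow> grad D v \<in> L2_space D"
  and is_weak_gradient_grad: "v \<in> W12_space D \<Longrightarrow> is_weak_gradient D v (grad D v)"
proof -
  assume "v \<in> W12_space D"
  then have "\<exists>g. g \<in> L2_space D \<and> is_weak_gradient D v g" by (auto simp: W12_space_def)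
  from someI_ex[OF this] show "grad D v \<in> L2_space D" "is_weak_gradient D v (grad D v)"
    by (auto simp: grad_def)
qed

lemma W12_lincomb:
  assumes "v \<in> W12_space D" "w \<in> W12_space D"
  shows "(\<lambda>x. a * v x + b * w x) \<in> W12_space D"
proof -
  have "is_weak_gradient D (\<lambda>x. a * v x + b * w x) (\<lambda>x. a *\<^sub>R grad D v x + b *\<^sub>R grad D w x)"
    using is_weak_gradient_lincomb[of v w "grad D v" "grad D w" a b] assms
    by (simp add: W12_L2 grad_L2 is_weak_gradient_grad)
  moreover have "(\<lambda>x. a *\<^sub>R grad D v x + b *\<^sub>R grad D w x) \<in> L2_space D"
    by (intro L2_space_lincomb grad_L2 assms)
  moreover have "(\<lambda>x. a * v x + b * w x) \<in> L2_space D"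
    using L2_space_lincomb[OF W12_L2[OF assms(1)] W12_L2[OF assms(2)], of a b] by simp
  ultimately show ?thesis by (auto simp: W12_space_def)
qed

lemma grad_lincomb:
  assumes "v \<in> W12_space D" "w \<in> W12_space D"
  shows "AE x in lebesgue_on D. grad D (\<lambda>x. a * v x + b * w x) x = a *\<^sub>R grad D v x + b *\<^sub>R grad D w x"
proof (rule is_weak_gradient_unique)
  show "is_weak_gradient D (\<lambda>x. a * v x + b * w x) (\<lambda>x. a *\<^sub>R grad D v x + b *\<^sub>R grad D w x)"
    using is_weak_gradient_lincomb[of v w "grad D v" "grad D w" a b] assms
    by (simp add: W12_L2 grad_L2 is_weak_gradient_grad)
qed (use assms in \<open>simp_all add: W12_lincomb is_weak_gradient_grad L2_space_lincomb grad_L2\<close>)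

text \<open>Traces are limits of restricted test functions; the triangle inequality for
  \<open>W12_norm D (\<phi> n - v)\<close> is available only if test functions lie in the Sobolev
  space. That the classical gradient is a weak one follows from
  \<open>integral_partial_deriv_eq_0\<close> for the product with a test function of the
  domain.\<close>

lemma test_functions_W12:
  assumes \<phi>: "\<phi> \<in> test_functions UNIV"
  shows "\<phi> \<in> W12_space D"
proof -
  define g where "g x = (\<Sum>i\<in>Basis. partial_deriv i \<phi> x *\<^sub>R i)" for x
  have gi: "g x \<bullet> i = partial_deriv i \<phi> x" if "i \<in> Basis" for x i
    using that by (simp add: g_def inner_sum_left_Basis)
  have "\<exists>B. \<forall>x. \<bar>partial_deriv i \<phi> x\<bar> \<le> B" if "i \<in> Basis" for i
    using test_functions_bounded[OF test_functions_partial_deriv[OF \<phi> that]] by metis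
  then obtain B where B: "\<And>i x. i \<in> Basis \<Longrightarrow> \<bar>partial_deriv i \<phi> x\<bar> \<le> B i" by metis
  have "g \<in> L2_space D"
  proof (rule L2_space_of_bounded)
    show "g \<in> borel_measurable (lebesgue_on D)"
      unfolding g_def[abs_def]
      by (intro borel_measurable_sum borel_measurable_scaleR borel_measurable_const
          test_functions_measurable_lebesgue_on[where S=UNIV] test_functions_partial_deriv[OF \<phi>])
    show "norm (g x) \<le> (\<Sum>i\<in>Basis. B i)" for x
      unfolding g_def by (rule sum_norm_le) (use B in auto)
  qed
  moreover have "is_weak_gradient D \<phi> g"
    unfolding is_weak_gradient_def
  proof (intro ballI)
    fix \<psi> and i :: 'a assume \<psi>: "\<psi> \<in> test_functions D" and i: "i \<in> Basis"
    have \<psi>': "\<psi> \<in> test_functions UNIV" by (rule test_functions_mono[OF \<psi>]) simp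
    have out: "\<psi> x = 0" "partial_deriv i \<psi> x = 0" if "x \<notin> D" for x
      using that test_functionsD(3,4)[OF \<psi>] test_functionsD(3,4)[OF test_functions_partial_deriv[OF \<psi> i]] by blast+
    have [measurable]: "\<phi> \<in> borel_measurable borel" "\<psi> \<in> borel_measurable borel"
      "partial_deriv i \<phi> \<in> borel_measurable borel" "partial_deriv i \<psi> \<in> borel_measurable borel"
      using \<phi> \<psi> test_functions_partial_deriv[OF _ i] test_functions_measurable by blast+
    have eq: "partial_deriv i (\<lambda>x. \<psi> x * \<phi> x) x = \<phi> x * partial_deriv i \<psi> x + g x \<bullet> i * \<psi> x" for x
      using partial_deriv_mult[OF test_functions_differentiable[OF \<psi>] test_functions_differentiable[OF \<phi>]]
      by (simp add: gi i algebra_simps)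
    have "(LINT x|lebesgue_on D. \<phi> x * partial_deriv i \<psi> x + (g x \<bullet> i) * \<psi> x)
        = (LINT x|lborel. \<phi> x * partial_deriv i \<psi> x + (g x \<bullet> i) * \<psi> x)"
      by (rule integral_lebesgue_on_eq_lborel) (simp_all add: open_domain out gi i)
    also have "\<dots> = 0"
      unfolding eq[symmetric]
      by (intro integral_partial_deriv_eq_0 i test_functions_mult \<psi>' test_functionsD(1)[OF \<phi>])
    finally show "(LINT x|lebesgue_on D. \<phi> x * partial_deriv i \<psi> x) = - (LINT x|lebesgue_on D. (g x \<bullet> i) * \<psi> x)"
      using L2_integrable_mult_test[OF test_functions_L2[OF \<phi>] test_functions_partial_deriv[OF \<psi> i]]
        L2_integrable_mult_test[OF test_functions_L2[OF test_functions_partial_deriv[OF \<phi> i]] \<psi>]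
      by (simp add: gi i)
  qed
  ultimately show ?thesis using test_functions_L2[OF \<phi>] by (auto simp: W12_space_def)
qed

lemma V_norm_lincomb_eq:
  assumes "v \<in> W12_space D" "w \<in> W12_space D"
  shows "V_norm D (\<lambda>x. a * v x + b * w x) = L2_norm D (\<lambda>x. a *\<^sub>R grad D v x + b *\<^sub>R grad D w x)"
  unfolding V_norm_def
  by (intro L2_norm_cong_AE grad_lincomb assms L2_space_measurable grad_L2 W12_lincomb L2_space_lincomb)

lemma V_norm_lincomb_le:
  assumes "v \<in> W12_space D" "w \<in> W12_space D"
  shows "V_norm D (\<lambda>x. a * v x + b * w x) \<le> \<bar>a\<bar> * V_norm D v + \<bar>b\<bar> * V_norm D w"
  unfolding V_norm_lincomb_eq[OF assms] unfolding V_norm_def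
  by (intro L2_norm_lincomb_le grad_L2 assms)

lemma W12_norm_lincomb_le:
  assumes "v \<in> W12_space D" "w \<in> W12_space D"
  shows "W12_norm D (\<lambda>x. a * v x + b * w x) \<le> \<bar>a\<bar> * W12_norm D v + \<bar>b\<bar> * W12_norm D w"
proof -
  have scale: "\<bar>c\<bar> * W12_norm D u = sqrt ((\<bar>c\<bar> * L2_norm D u)\<^sup>2 + (\<bar>c\<bar> * V_norm D u)\<^sup>2)" for c u
    by (simp add: W12_norm_def V_norm_def power_mult_distrib real_sqrt_mult flip: distrib_left)
  have "W12_norm D (\<lambda>x. a * v x + b * w x)
     \<le> sqrt ((\<bar>a\<bar> * L2_norm D v + \<bar>b\<bar> * L2_norm D w)\<^sup>2 + (\<bar>a\<bar> * V_norm D v + \<bar>b\<bar> * V_norm D w)\<^sup>2)"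
    unfolding W12_norm_def V_norm_def[symmetric]
    using L2_norm_lincomb_le[OF W12_L2[OF assms(1)] W12_L2[OF assms(2)], of a b] V_norm_lincomb_le[OF assms, of a b]
    by (intro real_sqrt_le_mono add_mono power_mono) (auto simp: L2_norm_nonneg V_norm_def)
  also have "\<dots> \<le> \<bar>a\<bar> * W12_norm D v + \<bar>b\<bar> * W12_norm D w"
    unfolding scale by (rule real_sqrt_sum_squares_triangle_ineq)
  finally show ?thesis .
qed

end

subsection \<open>The space with zero trace and its dual\<close>

context bounded_domain
begin

text \<open>Only the sigma-algebra matters: \<open>measure_of\<close> over the Borel sets has the
  Borel sets as its measurable sets, whatever set function it is given.\<close>

lemma surface_test_measurable:
  assumes "\<phi> \<in> test_functions UNIV"
  shows "\<phi> \<in> borel_measurable (surface_measure D)"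
proof -
  have "sets (hausdorff_measure (DIM('a) - 1) :: 'a measure) = sets borel"
    unfolding hausdorff_measure_def by (simp add: sigma_algebra.sigma_sets_eq[OF sets.sigma_algebra_axioms[of borel, simplified]])
  then have "\<phi> \<in> borel_measurable (hausdorff_measure (DIM('a) - 1))"
    using test_functions_measurable[OF assms] measurable_cong_sets by blast
  then show ?thesis unfolding surface_measure_def by (rule measurable_restrict_space1)
qed

lemma W12_norm_nonneg: "0 \<le> W12_norm D v"
  by (simp add: W12_norm_def)

text \<open>The same linear combination of the approximating sequences works. On the boundary the
  errors are squared integrals in \<open>ennreal\<close>, and \<open>square_lincomb_le\<close> takes
  the place of a triangle inequality. This makes the space with zero trace linear.\<close>

lemma has_trace_lincomb:
  assumes "v \<in> W12_space D" "w \<in> W12_space D" "has_trace D v g" "has_trace D w h"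
  shows "has_trace D (\<lambda>x. a * v x + b * w x) (\<lambda>x. a * g x + b * h x)"
proof -
  let ?S = "surface_measure D"
  obtain \<phi> where \<phi>: "\<And>n. \<phi> n \<in> test_functions UNIV" "(\<lambda>n. W12_norm D (\<phi> n - v)) \<longlonglongrightarrow> 0"
    "(\<lambda>n. \<integral>\<^sup>+x. ennreal ((\<phi> n x - g x)\<^sup>2) \<partial>?S) \<longlonglongrightarrow> 0"
    using assms(3) by (auto simp: has_trace_def)
  obtain \<psi> where \<psi>: "\<And>n. \<psi> n \<in> test_functions UNIV" "(\<lambda>n. W12_norm D (\<psi> n - w)) \<longlonglongrightarrow> 0"
    "(\<lambda>n. \<integral>\<^sup>+x. ennreal ((\<psi> n x - h x)\<^sup>2) \<partial>?S) \<longlonglongrightarrow> 0"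
    using assms(4) by (auto simp: has_trace_def)
  have [measurable]: "g \<in> borel_measurable ?S" "h \<in> borel_measurable ?S"
    "\<And>n. \<phi> n \<in> borel_measurable ?S" "\<And>n. \<psi> n \<in> borel_measurable ?S"
    using assms(3,4) surface_test_measurable \<phi>(1) \<psi>(1) by (auto simp: has_trace_def)
  define \<theta> where "\<theta> n = (\<lambda>x. a * \<phi> n x + b * \<psi> n x)" for n
  have 1: "\<theta> n \<in> test_functions UNIV" for n
    unfolding \<theta>_def by (intro test_functions_add test_functions_cmult \<phi> \<psi>)
  have W: "\<phi> n - v \<in> W12_space D" "\<psi> n - w \<in> W12_space D" for n
    using W12_lincomb[OF test_functions_W12[OF \<phi>(1)] assms(1), where a=1 and b="-1"]
      W12_lincomb[OF test_functions_W12[OF \<psi>(1)] assms(2), where a=1 and b="-1"] by (simp_all add: fun_diff_def)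
  have 2: "(\<lambda>n. W12_norm D (\<theta> n - (\<lambda>x. a * v x + b * w x))) \<longlonglongrightarrow> 0"
  proof (rule tendsto_sandwich[OF _ _ tendsto_const])
    show "(\<lambda>n. \<bar>a\<bar> * W12_norm D (\<phi> n - v) + \<bar>b\<bar> * W12_norm D (\<psi> n - w)) \<longlonglongrightarrow> 0"
      by (intro tendsto_add_zero tendsto_mult_right_zero \<phi> \<psi>)
    have "\<theta> n - (\<lambda>x. a * v x + b * w x) = (\<lambda>x. a * (\<phi> n - v) x + b * (\<psi> n - w) x)" for n
      by (simp add: \<theta>_def fun_eq_iff algebra_simps)
    then show "\<forall>\<^sub>F n in sequentially. W12_norm D (\<theta> n - (\<lambda>x. a * v x + b * w x))
        \<le> \<bar>a\<bar> * W12_norm D (\<phi> n - v) + \<bar>b\<bar> * W12_norm D (\<psi> n - w)"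
      using W12_norm_lincomb_le[OF W] by simp
  qed (simp add: W12_norm_nonneg)
  have 3: "(\<lambda>n. \<integral>\<^sup>+x. ennreal ((\<theta> n x - (a * g x + b * h x))\<^sup>2) \<partial>?S) \<longlonglongrightarrow> 0"
  proof (rule tendsto_sandwich[OF _ _ tendsto_const])
    let ?b = "\<lambda>n. ennreal (2 * a\<^sup>2) * (\<integral>\<^sup>+x. ennreal ((\<phi> n x - g x)\<^sup>2) \<partial>?S)
        + ennreal (2 * b\<^sup>2) * (\<integral>\<^sup>+x. ennreal ((\<psi> n x - h x)\<^sup>2) \<partial>?S)"
    have "?b \<longlonglongrightarrow> ennreal (2 * a\<^sup>2) * 0 + ennreal (2 * b\<^sup>2) * 0"
      by (intro tendsto_add ennreal_tendsto_cmult \<phi> \<psi>) auto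
    then show "?b \<longlonglongrightarrow> 0" by simp
    have "(\<integral>\<^sup>+x. ennreal ((\<theta> n x - (a * g x + b * h x))\<^sup>2) \<partial>?S) \<le> ?b n" for n
    proof -
      have "(\<theta> n x - (a * g x + b * h x))\<^sup>2 \<le> 2 * a\<^sup>2 * (\<phi> n x - g x)\<^sup>2 + 2 * b\<^sup>2 * (\<psi> n x - h x)\<^sup>2" for x
        using square_lincomb_le[of a "\<phi> n x - g x" b "\<psi> n x - h x"] by (simp add: \<theta>_def algebra_simps)
      then have "(\<integral>\<^sup>+x. ennreal ((\<theta> n x - (a * g x + b * h x))\<^sup>2) \<partial>?S)
          \<le> (\<integral>\<^sup>+x. ennreal (2 * a\<^sup>2) * ennreal ((\<phi> n x - g x)\<^sup>2) + ennreal (2 * b\<^sup>2) * ennreal ((\<psi> n x - h x)\<^sup>2) \<partial>?S)"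
        by (intro nn_integral_mono) (simp flip: ennreal_mult ennreal_plus)
      also have "\<dots> = ?b n" by (simp add: nn_integral_add nn_integral_cmult)
      finally show ?thesis .
    qed
    then show "\<forall>\<^sub>F n in sequentially. (\<integral>\<^sup>+x. ennreal ((\<theta> n x - (a * g x + b * h x))\<^sup>2) \<partial>?S) \<le> ?b n" by simp
  qed simp
  have 4: "integrable ?S (\<lambda>x. (a * g x + b * h x)\<^sup>2)"
  proof (rule Bochner_Integration.integrable_bound)
    show "integrable ?S (\<lambda>x. 2 * a\<^sup>2 * (g x)\<^sup>2 + 2 * b\<^sup>2 * (h x)\<^sup>2)"
      using assms(3,4) by (intro Bochner_Integration.integrable_add integrable_mult_right) (auto simp: has_trace_def)
    show "AE x in ?S. norm ((a * g x + b * h x)\<^sup>2) \<le> norm (2 * a\<^sup>2 * (g x)\<^sup>2 + 2 * b\<^sup>2 * (h x)\<^sup>2)"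
      using square_lincomb_le[of a _ b] by (simp add: abs_of_nonneg)
  qed measurable
  show ?thesis unfolding has_trace_def using 1 2 3 4 by (intro conjI exI[of _ \<theta>]) auto
qed

lemma V_W12: "v \<in> V_space D \<Gamma> \<Longrightarrow> v \<in> W12_space D"
  by (simp add: V_space_def)

lemma V_L2: "v \<in> V_space D \<Gamma> \<Longrightarrow> v \<in> L2_space D"
  using V_W12 W12_L2 by blast

lemma V_grad_L2: "v \<in> V_space D \<Gamma> \<Longrightarrow> grad D v \<in> L2_space D"
  using V_W12 grad_L2 by blast

lemma V_lincomb:
  assumes "v \<in> V_space D \<Gamma>" "w \<in> V_space D \<Gamma>"
  shows "(\<lambda>x. a * v x + b * w x) \<in> V_space D \<Gamma>"
proof -
  obtain g where g: "has_trace D v g" "AE x in surface_measure D. x \<in> \<Gamma> \<longrightarrow> g x = 0"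
    using assms(1) by (auto simp: V_space_def)
  obtain h where h: "has_trace D w h" "AE x in surface_measure D. x \<in> \<Gamma> \<longrightarrow> h x = 0"
    using assms(2) by (auto simp: V_space_def)
  have "AE x in surface_measure D. x \<in> \<Gamma> \<longrightarrow> a * g x + b * h x = 0"
    using g(2) h(2) by eventually_elim auto
  with has_trace_lincomb[OF V_W12[OF assms(1)] V_W12[OF assms(2)] g(1) h(1)] show ?thesis
    using W12_lincomb[OF V_W12[OF assms(1)] V_W12[OF assms(2)]] by (auto simp: V_space_def)
qed

lemma V_diff: "v \<in> V_space D \<Gamma> \<Longrightarrow> w \<in> V_space D \<Gamma> \<Longrightarrow> v - w \<in> V_space D \<Gamma>"
  using V_lincomb[of v \<Gamma> w 1 "-1"] by (simp add: fun_diff_def)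

lemma W12_zero: "0 \<in> W12_space D"
  using test_functions_W12[OF test_functions_zero] by (simp add: zero_fun_def)

lemma V_norm_nonneg: "0 \<le> V_norm D v"
  by (simp add: V_norm_def L2_norm_nonneg)

lemma V_norm_zero: "V_norm D 0 = 0"
  using V_norm_lincomb_le[OF W12_zero W12_zero, of 0 0] V_norm_nonneg[of 0] by (simp add: zero_fun_def)

lemma W12_norm_zero: "W12_norm D 0 = 0"
  using W12_norm_lincomb_le[OF W12_zero W12_zero, of 0 0] W12_norm_nonneg[of 0] by (simp add: zero_fun_def)

lemma V_zero: "0 \<in> V_space D \<Gamma>"
proof -
  have "has_trace D 0 (\<lambda>x. 0)"
    unfolding has_trace_def using test_functions_zero[of UNIV] W12_norm_zero
    by (auto intro!: exI[of _ "\<lambda>n x. 0"] simp: zero_fun_def fun_diff_def)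
  then show ?thesis using W12_zero by (auto simp: V_space_def)
qed

lemma V_norm_diff_le:
  assumes "v \<in> V_space D \<Gamma>" "w \<in> V_space D \<Gamma>"
  shows "V_norm D (v - w) \<le> V_norm D v + V_norm D w"
  using V_norm_lincomb_le[OF V_W12[OF assms(1)] V_W12[OF assms(2)], of 1 "-1"] by (simp add: fun_diff_def)

lemma grad_diff:
  assumes "v \<in> V_space D \<Gamma>" "w \<in> V_space D \<Gamma>"
  shows "AE x in lebesgue_on D. grad D (v - w) x = (grad D v - grad D w) x"
  using grad_lincomb[OF V_W12[OF assms(1)] V_W12[OF assms(2)], of 1 "-1"] by (simp add: fun_diff_def)

lemma V_dual_lincomb:
  assumes "\<psi> \<in> V_dual D \<Gamma>" "v \<in> V_space D \<Gamma>" "w \<in> V_space D \<Gamma>"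
  shows "\<psi> (\<lambda>x. a * v x + b * w x) = a * \<psi> v + b * \<psi> w"
  using assms by (simp add: V_dual_def)

lemma V_dual_diff_arg:
  assumes "\<psi> \<in> V_dual D \<Gamma>" "v \<in> V_space D \<Gamma>" "w \<in> V_space D \<Gamma>"
  shows "\<psi> (v - w) = \<psi> v - \<psi> w"
  using V_dual_lincomb[OF assms, of 1 "-1"] by (simp add: fun_diff_def)

lemma V_dual_bdd_above:
  assumes "\<psi> \<in> V_dual D \<Gamma>"
  shows "bdd_above ((\<lambda>v. \<bar>\<psi> v\<bar>) ` {v \<in> V_space D \<Gamma>. V_norm D v \<le> 1})"
proof -
  obtain C where C: "\<And>v. v \<in> V_space D \<Gamma> \<Longrightarrow> \<bar>\<psi> v\<bar> \<le> C * V_norm D v"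
    using assms unfolding V_dual_def mem_Collect_eq by metis
  have "\<bar>\<psi> v\<bar> \<le> \<bar>C\<bar>" if "v \<in> V_space D \<Gamma>" "V_norm D v \<le> 1" for v
  proof -
    have "\<bar>\<psi> v\<bar> \<le> \<bar>C\<bar> * V_norm D v"
      using C[OF that(1)] mult_right_mono[OF abs_ge_self V_norm_nonneg] by (rule order_trans)
    also have "\<dots> \<le> \<bar>C\<bar>" using that(2) V_norm_nonneg by (intro mult_left_le) auto
    finally show ?thesis .
  qed
  then show ?thesis by (intro bdd_aboveI[of _ "\<bar>C\<bar>"]) auto
qed

lemma V_dual_le:
  assumes \<psi>: "\<psi> \<in> V_dual D \<Gamma>" and v: "v \<in> V_space D \<Gamma>"
  shows "\<bar>\<psi> v\<bar> \<le> V_dual_norm D \<Gamma> \<psi> * V_norm D v"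
proof (cases "V_norm D v = 0")
  case True
  \<comment> \<open>Such a \<open>v\<close> cannot be normalised, but the bound with constant
    \<open>C\<close> in \<open>V_dual_def\<close> already gives \<open>\<psi> v = 0\<close>.\<close>
  then show ?thesis using \<psi> v by (auto simp: V_dual_def)
next
  case False
  then have pos: "0 < V_norm D v" using V_norm_nonneg[of v] by simp
  \<comment> \<open>The zero second summand brings the normalised vector into the two-term form that
    linearity is stated for.\<close>
  define w where "w = (\<lambda>x. (1 / V_norm D v) * v x + 0 * v x)"
  have w: "w \<in> V_space D \<Gamma>" unfolding w_def by (intro V_lincomb v)
  have "V_norm D w \<le> 1"
    using V_norm_lincomb_le[OF V_W12[OF v] V_W12[OF v], of "1 / V_norm D v" 0] pos by (simp add: w_def)
  then have "\<bar>\<psi> w\<bar> \<le> V_dual_norm D \<Gamma> \<psi>"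
    unfolding V_dual_norm_def using w by (intro cSUP_upper V_dual_bdd_above[OF \<psi>]) auto
  moreover have "\<psi> w = \<psi> v / V_norm D v"
    unfolding w_def V_dual_lincomb[OF \<psi> v v] by simp
  ultimately show ?thesis using pos by (simp add: field_simps)
qed

lemma V_dual_norm_nonneg: "\<psi> \<in> V_dual D \<Gamma> \<Longrightarrow> 0 \<le> V_dual_norm D \<Gamma> \<psi>"
  unfolding V_dual_norm_def
  by (rule cSUP_upper2[OF V_dual_bdd_above, of _ _ 0]) (auto simp: V_zero V_norm_zero)

lemma V_dual_zero: "0 \<in> V_dual D \<Gamma>"
  by (auto simp: V_dual_def intro: exI[of _ 0])

lemma V_dual_diff:
  assumes "\<psi> \<in> V_dual D \<Gamma>" "\<xi> \<in> V_dual D \<Gamma>"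
  shows "\<psi> - \<xi> \<in> V_dual D \<Gamma>"
proof -
  have "\<bar>(\<psi> - \<xi>) v\<bar> \<le> (V_dual_norm D \<Gamma> \<psi> + V_dual_norm D \<Gamma> \<xi>) * V_norm D v" if "v \<in> V_space D \<Gamma>" for v
    using V_dual_le[OF assms(1) that] V_dual_le[OF assms(2) that] by (simp add: algebra_simps)
  moreover have "(\<psi> - \<xi>) (\<lambda>x. a * v x + b * w x) = a * (\<psi> - \<xi>) v + b * (\<psi> - \<xi>) w"
    if "v \<in> V_space D \<Gamma>" "w \<in> V_space D \<Gamma>" for v w a b
    using V_dual_lincomb[OF assms(1) that] V_dual_lincomb[OF assms(2) that] by (simp add: algebra_simps)
  ultimately show ?thesis unfolding V_dual_def by blast
qed

lemma V_dual_norm_zero: "V_dual_norm D \<Gamma> 0 = 0"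
proof -
  have "V_dual_norm D \<Gamma> 0 \<le> 0"
    unfolding V_dual_norm_def by (rule cSUP_least) (auto simp: V_norm_zero intro!: exI[of _ 0] V_zero)
  then show ?thesis using V_dual_norm_nonneg[OF V_dual_zero] by (rule order_antisym)
qed

lemma V_dual_norm_diff_le:
  assumes "\<psi> \<in> V_dual D \<Gamma>" "\<xi> \<in> V_dual D \<Gamma>"
  shows "V_dual_norm D \<Gamma> (\<psi> - \<xi>) \<le> V_dual_norm D \<Gamma> \<psi> + V_dual_norm D \<Gamma> \<xi>"
  unfolding V_dual_norm_def[of _ _ "\<psi> - \<xi>"]
proof (rule cSUP_least)
  show "{v \<in> V_space D \<Gamma>. V_norm D v \<le> 1} \<noteq> {}"
    using V_zero V_norm_zero by (auto intro!: exI[of _ 0])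
  fix v assume v: "v \<in> {v \<in> V_space D \<Gamma>. V_norm D v \<le> 1}"
  have "\<bar>\<psi> v\<bar> \<le> V_dual_norm D \<Gamma> \<psi>" "\<bar>\<xi> v\<bar> \<le> V_dual_norm D \<Gamma> \<xi>"
    unfolding V_dual_norm_def using v by (intro cSUP_upper V_dual_bdd_above assms; simp)+
  then show "\<bar>(\<psi> - \<xi>) v\<bar> \<le> V_dual_norm D \<Gamma> \<psi> + V_dual_norm D \<Gamma> \<xi>" by simp
qed

end

subsection \<open>Bochner measurability for seminormed carriers\<close>

lemma LIMSEQ_squeeze_zero:
  fixes g h :: "nat \<Rightarrow> real"
  assumes "h \<longlonglongrightarrow> 0" "\<And>n. 0 \<le> g n" "\<And>n. g n \<le> h n"
  shows "g \<longlonglongrightarrow> 0"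
  by (rule tendsto_sandwich[OF _ _ tendsto_const assms(1)]) (simp_all add: assms(2,3))

text \<open>Bochner functions belong to the carrier, and are limits of simple functions, only almost
  everywhere. Completeness of the measure is what carries measurability across the exceptional null
  sets.\<close>

lemma (in complete_measure) borel_measurable_AE_eq:
  fixes f g :: "'a \<Rightarrow> 'b::topological_space"
  assumes f: "f \<in> borel_measurable M" and ae: "AE x in M. f x = g x"
  shows "g \<in> borel_measurable M"
proof (rule measurableI)
  fix A :: "'b set" assume A: "A \<in> sets borel"
  have "AE x in M. x \<in> f -` A \<inter> space M \<longleftrightarrow> x \<in> g -` A \<inter> space M"
    using ae by eventually_elim auto
  then show "g -` A \<inter> space M \<in> sets M"
    by (rule in_sets_AE) (use f A measurable_sets in auto)
qed simp

lemma complete_measure_lebesgue_on: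
  assumes "I \<in> sets lebesgue"
  shows "complete_measure (lebesgue_on I)"
proof
  fix A B :: "'a set" assume "B \<subseteq> A" "A \<in> null_sets (lebesgue_on I)"
  then show "B \<in> sets (lebesgue_on I)"
    using assms completion.complete2[of B A lborel]
    by (auto simp: null_sets_restrict_space sets_restrict_space_iff)
qed

locale finite_complete_measure = finite_measure M + complete_measure M for M :: "'t measure"
begin

lemma borel_measurable_AE_limit:
  fixes f :: "nat \<Rightarrow> 't \<Rightarrow> real"
  assumes f: "\<And>n. f n \<in> borel_measurable M" and ae: "AE t in M. (\<lambda>n. f n t) \<longlonglongrightarrow> g t"
  shows "g \<in> borel_measurable M"
proof (rule borel_measurable_AE_eq)
  show "(\<lambda>t. lim (\<lambda>n. f n t)) \<in> borel_measurable M" using f by (rule borel_measurable_lim_metric)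
  show "AE t in M. lim (\<lambda>n. f n t) = g t" using ae by eventually_elim (rule limI)
qed

end

text \<open>Everything is expressed by 0 and differences because \<open>bochner_measurable\<close>
  measures \<open>s n t - w t\<close>; negation and the reverse triangle inequality are derived from
  them. Elements with \<open>nrm x = 0\<close> may be nonzero, as representatives demand.\<close>

locale seminormed_carrier =
  fixes S :: "'b::ab_group_add set" and nrm :: "'b \<Rightarrow> real"
  assumes zero_mem: "0 \<in> S"
    and diff_mem: "x \<in> S \<Longrightarrow> y \<in> S \<Longrightarrow> x - y \<in> S"
    and nrm_nonneg: "x \<in> S \<Longrightarrow> 0 \<le> nrm x"
    and nrm_zero: "nrm 0 = 0"
    and nrm_diff_le: "x \<in> S \<Longrightarrow> y \<in> S \<Longrightarrow> nrm (x - y) \<le> nrm x + nrm y"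
begin

lemma nrm_le_diff_add:
  assumes "x \<in> S" "y \<in> S"
  shows "nrm x \<le> nrm (x - y) + nrm y"
proof -
  have "nrm x = nrm ((x - y) - (0 - y))" by simp
  also have "\<dots> \<le> nrm (x - y) + nrm (0 - y)" by (intro nrm_diff_le diff_mem zero_mem assms)
  also have "nrm (0 - y) \<le> nrm y" using nrm_diff_le[OF zero_mem assms(2)] nrm_zero by simp
  finally show ?thesis by simp
qed

lemma nrm_diff_commute:
  assumes "x \<in> S" "y \<in> S"
  shows "nrm (x - y) = nrm (y - x)"
proof -
  have "nrm (0 - z) \<le> nrm z" if "z \<in> S" for z
    using nrm_diff_le[OF zero_mem that] nrm_zero by simp
  from this[of "x - y"] this[of "y - x"] show ?thesis
    using assms diff_mem by (simp add: order_antisym)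
qed

lemma abs_nrm_diff_le:
  assumes "x \<in> S" "y \<in> S"
  shows "\<bar>nrm x - nrm y\<bar> \<le> nrm (x - y)"
  using nrm_le_diff_add[OF assms] nrm_le_diff_add[OF assms(2,1)] nrm_diff_commute[OF assms] by simp

lemma tendsto_nrm:
  assumes "\<And>n. s n \<in> S" "w \<in> S" "(\<lambda>n. nrm (s n - w)) \<longlonglongrightarrow> 0"
  shows "(\<lambda>n. nrm (s n)) \<longlonglongrightarrow> nrm w"
proof -
  have "(\<lambda>n. \<bar>nrm (s n) - nrm w\<bar>) \<longlonglongrightarrow> 0"
    using abs_nrm_diff_le[OF assms(1,2)]
    by (intro tendsto_sandwich[OF _ _ tendsto_const assms(3)] always_eventually) auto
  then show ?thesis by (simp add: tendsto_rabs_zero_iff LIM_zero_iff)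
qed

end

locale bochner_space = seminormed_carrier S nrm + finite_complete_measure M
  for S :: "'b::ab_group_add set" and nrm and M :: "'t measure"
begin

lemma bochner_measurableE:
  assumes "bochner_measurable M S nrm w"
  obtains s where "\<And>n. simple_function M (s n)" "\<And>n t. t \<in> space M \<Longrightarrow> s n t \<in> S"
    "AE t in M. (\<lambda>n. nrm (s n t - w t)) \<longlonglongrightarrow> 0"
proof -
  obtain s where "\<forall>n. simple_function M (s n) \<and> s n ` space M \<subseteq> S"
    "AE t in M. (\<lambda>n. nrm (s n t - w t)) \<longlonglongrightarrow> 0"
    using assms unfolding bochner_measurable_def by (elim exE conjE)
  then show thesis by (intro that[of s]) (auto simp: image_subset_iff)
qed

lemma nrm_measurable:
  assumes "bochner_measurable M S nrm w" "AE t in M. w t \<in> S"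
  shows "(\<lambda>t. nrm (w t)) \<in> borel_measurable M"
proof -
  obtain s where s: "\<And>n. simple_function M (s n)" "\<And>n t. t \<in> space M \<Longrightarrow> s n t \<in> S"
    "AE t in M. (\<lambda>n. nrm (s n t - w t)) \<longlonglongrightarrow> 0" by (rule bochner_measurableE[OF assms(1)]) (rule that)
  have "(\<lambda>t. nrm (s n t)) \<in> borel_measurable M" for n
    by (rule borel_measurable_simple_function[OF simple_function_compose1[OF s(1)]])
  moreover have "AE t in M. (\<lambda>n. nrm (s n t)) \<longlonglongrightarrow> nrm (w t)"
    using s(3) assms(2) AE_space by eventually_elim (rule tendsto_nrm[OF s(2)])
  ultimately show ?thesis by (rule borel_measurable_AE_limit)
qed

lemma bochner_measurable_diff:
  assumes "bochner_measurable M S nrm w" "AE t in M. w t \<in> S"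
    "bochner_measurable M S nrm v" "AE t in M. v t \<in> S"
  shows "bochner_measurable M S nrm (\<lambda>t. w t - v t)"
proof -
  obtain s where s: "\<And>n. simple_function M (s n)" "\<And>n t. t \<in> space M \<Longrightarrow> s n t \<in> S"
    "AE t in M. (\<lambda>n. nrm (s n t - w t)) \<longlonglongrightarrow> 0" by (rule bochner_measurableE[OF assms(1)]) (rule that)
  obtain r where r: "\<And>n. simple_function M (r n)" "\<And>n t. t \<in> space M \<Longrightarrow> r n t \<in> S"
    "AE t in M. (\<lambda>n. nrm (r n t - v t)) \<longlonglongrightarrow> 0" by (rule bochner_measurableE[OF assms(3)]) (rule that)
  have "AE t in M. (\<lambda>n. nrm ((s n t - r n t) - (w t - v t))) \<longlonglongrightarrow> 0"
    using s(3) r(3) assms(2,4) AE_space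
  proof eventually_elim
    case (elim t)
    note mem = s(2)[OF elim(5)] r(2)[OF elim(5)] elim(3,4)
    have "(\<lambda>n. nrm (s n t - w t) + nrm (r n t - v t)) \<longlonglongrightarrow> 0"
      using elim(1,2) by (rule tendsto_add_zero)
    moreover have le: "nrm ((s n t - r n t) - (w t - v t)) \<le> nrm (s n t - w t) + nrm (r n t - v t)" for n
    proof -
      have "(s n t - r n t) - (w t - v t) = (s n t - w t) - (r n t - v t)" by (simp add: algebra_simps)
      then show ?thesis by (simp only:) (intro nrm_diff_le diff_mem mem)
    qed
    moreover have "0 \<le> nrm ((s n t - r n t) - (w t - v t))" for n
      by (intro nrm_nonneg diff_mem mem)
    ultimately show ?case
      by (rule_tac LIMSEQ_squeeze_zero) assumption+
  qed
  moreover have "simple_function M (\<lambda>t. s n t - r n t)" for n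
    using s(1) r(1) by (rule simple_function_compose2)
  ultimately show ?thesis
    unfolding bochner_measurable_def using s(2) r(2) diff_mem
    by (intro exI[of _ "\<lambda>n t. s n t - r n t"]) auto
qed

lemma bochner_L2D:
  assumes "w \<in> bochner_L2 M S nrm"
  shows "AE t in M. w t \<in> S" "bochner_measurable M S nrm w"
    "integrable M (\<lambda>t. (nrm (w t))\<^sup>2)" "(\<lambda>t. nrm (w t)) \<in> borel_measurable M"
  using assms nrm_measurable by (auto simp: bochner_L2_def)

lemma bochner_L2_diff:
  assumes w: "w \<in> bochner_L2 M S nrm" and v: "v \<in> bochner_L2 M S nrm"
  shows "(\<lambda>t. w t - v t) \<in> bochner_L2 M S nrm"
proof -
  note w = bochner_L2D[OF w] and v = bochner_L2D[OF v]
  have mem: "AE t in M. w t - v t \<in> S" using w(1) v(1) by eventually_elim (rule diff_mem)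
  have meas: "bochner_measurable M S nrm (\<lambda>t. w t - v t)" by (intro bochner_measurable_diff w v)
  have [measurable]: "(\<lambda>t. nrm (w t - v t)) \<in> borel_measurable M" by (rule nrm_measurable[OF meas mem])
  have "integrable M (\<lambda>t. (nrm (w t - v t))\<^sup>2)"
  proof (rule Bochner_Integration.integrable_bound)
    show "integrable M (\<lambda>t. 2 * (nrm (w t))\<^sup>2 + 2 * (nrm (v t))\<^sup>2)"
      using w v by (intro Bochner_Integration.integrable_add integrable_mult_right)
    show "AE t in M. norm ((nrm (w t - v t))\<^sup>2) \<le> norm (2 * (nrm (w t))\<^sup>2 + 2 * (nrm (v t))\<^sup>2)"
      using w(1) v(1) mem
    proof eventually_elim
      case (elim t)
      have "(nrm (w t - v t))\<^sup>2 \<le> (nrm (w t) + nrm (v t))\<^sup>2"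
        using elim by (intro power_mono nrm_diff_le nrm_nonneg)
      also have "\<dots> \<le> 2 * (nrm (w t))\<^sup>2 + 2 * (nrm (v t))\<^sup>2"
        using sum_squares_bound[of "nrm (w t)" "nrm (v t)"] by (simp add: power2_sum)
      finally show ?case by simp
    qed
  qed measurable
  with mem meas show ?thesis by (simp add: bochner_L2_def)
qed

lemma simple_bochner_L2:
  assumes s: "simple_function M s" "\<And>t. t \<in> space M \<Longrightarrow> s t \<in> S"
  shows "s \<in> bochner_L2 M S nrm"
proof -
  have "bochner_measurable M S nrm s"
    unfolding bochner_measurable_def using s nrm_zero by (intro exI[of _ "\<lambda>_. s"]) auto
  moreover have "integrable M (\<lambda>t. (nrm (s t))\<^sup>2)"
    by (rule integrable_simple_function[OF simple_function_compose1[OF s(1)]]) simp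
  ultimately show ?thesis using s(2) by (simp add: bochner_L2_def)
qed

text \<open>The simple functions supplied by measurability have no common square integrable bound.
  They are therefore replaced by 0 wherever their norm exceeds \<open>nrm (w t) + 1\<close>. The
  slack 1 makes this cut inactive for large \<open>n\<close> at almost every \<open>t\<close>, also
  where \<open>w t\<close> has norm 0.\<close>

lemma bochner_L2_simple_approx:
  assumes w: "w \<in> bochner_L2 M S nrm"
  obtains s where "\<And>n. simple_function M (s n)" "\<And>n t. t \<in> space M \<Longrightarrow> s n t \<in> S"
    "\<And>n. (\<lambda>t. w t - s n t) \<in> bochner_L2 M S nrm"
    "(\<lambda>n. LINT t|M. (nrm (w t - s n t))\<^sup>2) \<longlonglongrightarrow> 0"
proof -
  note w' = bochner_L2D[OF w]
  obtain r where r: "\<And>n. simple_function M (r n)" "\<And>n t. t \<in> space M \<Longrightarrow> r n t \<in> S"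
    "AE t in M. (\<lambda>n. nrm (r n t - w t)) \<longlonglongrightarrow> 0" by (rule bochner_measurableE[OF w'(2)]) (rule that)
  define A where "A n = {t \<in> space M. nrm (r n t) \<le> nrm (w t) + 1}" for n
  define s where "s = (\<lambda>n t. if t \<in> A n then r n t else 0)"
  have nrm_r: "(\<lambda>t. nrm (r n t)) \<in> borel_measurable M" for n
    by (rule borel_measurable_simple_function[OF simple_function_compose1[OF r(1)]])
  have A[measurable]: "A n \<in> sets M" for n
    unfolding A_def using nrm_r[of n] w'(4) by measurable
  have simple: "simple_function M (s n)" for n
  proof -
    have "simple_function M (\<lambda>t. if t \<in> A n then r n t else 0)"
      by (rule simple_function_If_set[OF r(1) simple_function_const]) (rule sets.Int[OF A sets.top])
    then show ?thesis by (simp add: s_def)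
  qed
  have mem: "s n t \<in> S" if "t \<in> space M" for n t using that r(2) zero_mem by (simp add: s_def)
  have simple_L2: "s n \<in> bochner_L2 M S nrm" for n by (rule simple_bochner_L2[OF simple mem])
  have L2: "(\<lambda>t. w t - s n t) \<in> bochner_L2 M S nrm" for n
    by (rule bochner_L2_diff[OF w simple_L2])
  have "(\<lambda>n. LINT t|M. (nrm (w t - s n t))\<^sup>2) \<longlonglongrightarrow> (LINT t|M. 0)"
  \<comment> \<open>After the cut the difference has norm at most \<open>2 * nrm (w t) + 1\<close>;
    its square is at most this bound.\<close>
  proof (rule integral_dominated_convergence[where w="\<lambda>t. 8 * (nrm (w t))\<^sup>2 + 2"])
    show "integrable M (\<lambda>t. 8 * (nrm (w t))\<^sup>2 + 2)"
      using w'(3) by (intro Bochner_Integration.integrable_add integrable_mult_right) auto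
    show "(\<lambda>t. (nrm (w t - s n t))\<^sup>2) \<in> borel_measurable M" for n
      using bochner_L2D(4)[OF L2] by measurable
    show "AE t in M. (\<lambda>n. (nrm (w t - s n t))\<^sup>2) \<longlonglongrightarrow> 0"
      using r(3) w'(1) AE_space
    proof eventually_elim
      case (elim t)
      have "\<forall>\<^sub>F n in sequentially. nrm (r n t - w t) < 1"
        using order_tendstoD(2)[OF elim(1), of 1] by simp
      then have "\<forall>\<^sub>F n in sequentially. nrm (r n t - w t) = nrm (w t - s n t)"
      proof eventually_elim
        case (elim n)
        have "nrm (r n t) \<le> nrm (w t) + 1"
          using elim nrm_le_diff_add[of "r n t" "w t"] r(2) \<open>w t \<in> S\<close> \<open>t \<in> space M\<close> by simp
        then have "s n t = r n t" using \<open>t \<in> space M\<close> by (simp add: s_def A_def)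
        then show ?case using nrm_diff_commute r(2) \<open>w t \<in> S\<close> \<open>t \<in> space M\<close> by simp
      qed
      then have "(\<lambda>n. nrm (w t - s n t)) \<longlonglongrightarrow> 0" by (rule Lim_transform_eventually[OF elim(1)])
      then show ?case using tendsto_power[of _ 0 _ 2] by fastforce
    qed
    show "AE t in M. norm ((nrm (w t - s n t))\<^sup>2) \<le> 8 * (nrm (w t))\<^sup>2 + 2" for n
      using w'(1) AE_space
    proof eventually_elim
      case (elim t)
      have "nrm (s n t) \<le> nrm (w t) + 1"
        using nrm_nonneg[OF elim(1)] nrm_zero by (simp add: s_def A_def)
      then have "nrm (w t - s n t) \<le> 2 * nrm (w t) + 1"
        using nrm_diff_le[OF elim(1) mem[OF elim(2)], of n] by simp
      moreover have "0 \<le> nrm (w t - s n t)" by (intro nrm_nonneg diff_mem elim(1) mem elim(2))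
      ultimately have "(nrm (w t - s n t))\<^sup>2 \<le> (2 * nrm (w t) + 1)\<^sup>2" by (intro power_mono)
      also have "\<dots> \<le> 8 * (nrm (w t))\<^sup>2 + 2"
        using sum_squares_bound[of "2 * nrm (w t)" 1] by (simp add: power2_sum power_mult_distrib)
      finally show ?case by simp
    qed
  qed simp
  then have lim: "(\<lambda>n. LINT t|M. (nrm (w t - s n t))\<^sup>2) \<longlonglongrightarrow> 0" by simp
  show thesis by (rule that[of s, OF simple mem L2 lim])
qed

end

text \<open>Covers both the duality between V and its dual and the inner product of L2; no
  measurable structure on the carriers is assumed.\<close>

locale bochner_pairing =
  A: bochner_space S\<^sub>1 n\<^sub>1 M + B: bochner_space S\<^sub>2 n\<^sub>2 M
  for S\<^sub>1 :: "'b::ab_group_add set" and n\<^sub>1 and S\<^sub>2 :: "'c::ab_group_add set" and n\<^sub>2 and M :: "'t measure" +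
  fixes pr :: "'b \<Rightarrow> 'c \<Rightarrow> real"
  assumes pr_diff_left: "x \<in> S\<^sub>1 \<Longrightarrow> x' \<in> S\<^sub>1 \<Longrightarrow> y \<in> S\<^sub>2 \<Longrightarrow> pr (x - x') y = pr x y - pr x' y"
    and pr_diff_right: "x \<in> S\<^sub>1 \<Longrightarrow> y \<in> S\<^sub>2 \<Longrightarrow> y' \<in> S\<^sub>2 \<Longrightarrow> pr x (y - y') = pr x y - pr x y'"
    and pr_bound: "x \<in> S\<^sub>1 \<Longrightarrow> y \<in> S\<^sub>2 \<Longrightarrow> \<bar>pr x y\<bar> \<le> n\<^sub>1 x * n\<^sub>2 y"
begin

text \<open>The pairing of two simple functions is simple, and the product bound makes these
  pairings converge almost everywhere once the norms of the second approximants converge.\<close>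

lemma pairing_measurable:
  assumes w: "bochner_measurable M S\<^sub>1 n\<^sub>1 w" "AE t in M. w t \<in> S\<^sub>1"
    and v: "bochner_measurable M S\<^sub>2 n\<^sub>2 v" "AE t in M. v t \<in> S\<^sub>2"
  shows "(\<lambda>t. pr (w t) (v t)) \<in> borel_measurable M"
proof -
  obtain s where s: "\<And>n. simple_function M (s n)" "\<And>n t. t \<in> space M \<Longrightarrow> s n t \<in> S\<^sub>1"
    "AE t in M. (\<lambda>n. n\<^sub>1 (s n t - w t)) \<longlonglongrightarrow> 0" by (rule A.bochner_measurableE[OF w(1)]) (rule that)
  obtain r where r: "\<And>n. simple_function M (r n)" "\<And>n t. t \<in> space M \<Longrightarrow> r n t \<in> S\<^sub>2"
    "AE t in M. (\<lambda>n. n\<^sub>2 (r n t - v t)) \<longlonglongrightarrow> 0" by (rule B.bochner_measurableE[OF v(1)]) (rule that)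
  have "(\<lambda>t. pr (s n t) (r n t)) \<in> borel_measurable M" for n
    using simple_function_compose2[OF s(1) r(1), of pr] by (rule borel_measurable_simple_function)
  moreover have "AE t in M. (\<lambda>n. pr (s n t) (r n t)) \<longlonglongrightarrow> pr (w t) (v t)"
    using s(3) r(3) w(2) v(2) AE_space
  proof eventually_elim
    case (elim t)
    note mem = s(2)[OF elim(5)] r(2)[OF elim(5)] elim(3,4)
    have "(\<lambda>n. n\<^sub>1 (s n t - w t) * n\<^sub>2 (r n t) + n\<^sub>1 (w t) * n\<^sub>2 (r n t - v t)) \<longlonglongrightarrow> 0 * n\<^sub>2 (v t) + n\<^sub>1 (w t) * 0"
      by (intro tendsto_add tendsto_mult tendsto_const elim(1,2) B.tendsto_nrm mem)
    moreover have "\<bar>pr (s n t) (r n t) - pr (w t) (v t)\<bar>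
        \<le> n\<^sub>1 (s n t - w t) * n\<^sub>2 (r n t) + n\<^sub>1 (w t) * n\<^sub>2 (r n t - v t)" for n
    proof -
      have "pr (s n t) (r n t) - pr (w t) (v t) = pr (s n t - w t) (r n t) + pr (w t) (r n t - v t)"
        using mem by (simp add: pr_diff_left pr_diff_right)
      moreover have "\<bar>pr (s n t - w t) (r n t)\<bar> \<le> n\<^sub>1 (s n t - w t) * n\<^sub>2 (r n t)"
        using mem by (intro pr_bound A.diff_mem)
      moreover have "\<bar>pr (w t) (r n t - v t)\<bar> \<le> n\<^sub>1 (w t) * n\<^sub>2 (r n t - v t)"
        using mem by (intro pr_bound B.diff_mem)
      ultimately show ?thesis by linarith
    qed
    ultimately have "(\<lambda>n. \<bar>pr (s n t) (r n t) - pr (w t) (v t)\<bar>) \<longlonglongrightarrow> 0"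
      by (intro LIMSEQ_squeeze_zero[where g="\<lambda>n. \<bar>pr (s n t) (r n t) - pr (w t) (v t)\<bar>"]) simp_all
    then show ?case by (simp add: tendsto_rabs_zero_iff LIM_zero_iff)
  qed
  ultimately show ?thesis by (rule A.borel_measurable_AE_limit)
qed

lemma pairing_integrable:
  assumes w: "w \<in> bochner_L2 M S\<^sub>1 n\<^sub>1" and v: "v \<in> bochner_L2 M S\<^sub>2 n\<^sub>2"
  shows "integrable M (\<lambda>t. pr (w t) (v t))"
proof (rule Bochner_Integration.integrable_bound)
  note w = A.bochner_L2D[OF w] and v = B.bochner_L2D[OF v]
  show "integrable M (\<lambda>t. (n\<^sub>1 (w t))\<^sup>2 + (n\<^sub>2 (v t))\<^sup>2)" using w v by simp
  show "(\<lambda>t. pr (w t) (v t)) \<in> borel_measurable M" by (intro pairing_measurable w v)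
  show "AE t in M. norm (pr (w t) (v t)) \<le> norm ((n\<^sub>1 (w t))\<^sup>2 + (n\<^sub>2 (v t))\<^sup>2)"
    using w(1) v(1)
  proof eventually_elim
    case (elim t)
    have "\<bar>pr (w t) (v t)\<bar> \<le> n\<^sub>1 (w t) * n\<^sub>2 (v t)" using elim by (rule pr_bound)
    also have "\<dots> \<le> (n\<^sub>1 (w t))\<^sup>2 + (n\<^sub>2 (v t))\<^sup>2"
      using sum_squares_bound[of "n\<^sub>1 (w t)" "n\<^sub>2 (v t)"]
        mult_nonneg_nonneg[OF A.nrm_nonneg[OF elim(1)] B.nrm_nonneg[OF elim(2)]] by linarith
    finally show ?case by simp
  qed
qed

end

subsection \<open>Functions of time\<close>

lemma finite_complete_measure_time: "finite_complete_measure (time_measure T)"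
  by (intro finite_complete_measure.intro finite_measure_lebesgue_on complete_measure_lebesgue_on) auto

lemma borel_imp_time_measurable:
  "f \<in> borel_measurable borel \<Longrightarrow> f \<in> borel_measurable (time_measure T)"
  by (intro measurable_restrict_space1 measurable_completion) simp

section \<open>Increments of functions with a weak derivative in time\<close>

lemma time_continuous:
  fixes f :: "real \<Rightarrow> real"
  assumes "continuous_on {0..T} f"
  shows "integrable (time_measure T) f" "(LINT t|time_measure T. f t) = integral {0..T} f"
proof -
  have "f absolutely_integrable_on {0<..<T}"
    by (rule set_integrable_subset[OF absolutely_integrable_continuous_real[OF assms]]) auto
  then show *: "integrable (time_measure T) f"
    by (simp add: integrable_restrict_space set_integrable_def)
  show "(LINT t|time_measure T. f t) = integral {0..T} f"
    using lebesgue_integral_eq_integral[OF *] by (simp add: integral_open_interval_real)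
qed

text \<open>The kernel is one-sided: its mass lies in an interval of length \<open>1 / Suc n\<close>
  to the right of \<open>s\<close>. Its integral is 1 because \<open>\<sigma>\<close> increases from
  0 to 1, so the error is an average of \<open>g x - g s\<close> over that interval.\<close>

lemma approximate_identity_limit:
  fixes g \<sigma> \<sigma>' :: "real \<Rightarrow> real"
  assumes g: "continuous_on {0..T} g" and s: "0 < s" "s < T"
    and \<sigma>': "continuous_on UNIV \<sigma>'" "\<And>x. (\<sigma> has_real_derivative \<sigma>' x) (at x)" "\<And>x. 0 \<le> \<sigma>' x"
    and \<sigma>: "\<And>x. x \<le> 0 \<Longrightarrow> \<sigma> x = 0" "\<And>x. 1 \<le> x \<Longrightarrow> \<sigma> x = 1"
    and supp: "\<And>x. x \<le> 0 \<or> 1 \<le> x \<Longrightarrow> \<sigma>' x = 0"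
  shows "(\<lambda>n. LINT x|time_measure T. (real (Suc n) * \<sigma>' (real (Suc n) * (x - s))) * g x) \<longlonglongrightarrow> g s"
proof (rule LIMSEQ_I)
  fix r :: real assume "0 < r"
  define k where "k n x = real (Suc n) * \<sigma>' (real (Suc n) * (x - s))" for n x
  have "continuous (at s within {0..T}) g" using g s by (simp add: continuous_on_eq_continuous_within)
  then obtain d where d: "0 < d" "\<And>x. x \<in> {0..T} \<Longrightarrow> \<bar>x - s\<bar> < d \<Longrightarrow> \<bar>g x - g s\<bar> < r / 2"
    using \<open>0 < r\<close> unfolding continuous_within_eps_delta by (metis dist_real_def half_gt_zero)
  \<comment> \<open>Below \<open>d\<close> the kernel sees only points where \<open>g\<close> is
    close to \<open>g s\<close>; below \<open>T - s\<close> its whole mass lies in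
    \<open>{0..T}\<close>.\<close>
  obtain N where N: "1 / real (Suc N) < min d (T - s)"
    using nat_approx_posE[of "min d (T - s)"] d(1) s by auto
  have "\<bar>(LINT x|time_measure T. k n x * g x) - g s\<bar> \<le> r / 2" if n: "N \<le> n" for n
  proof -
    have "1 / real (Suc n) \<le> 1 / real (Suc N)" using n by (simp add: frac_le)
    then have n': "1 / real (Suc n) < d" "1 / real (Suc n) < T - s" using N by linarith+
    have cont: "continuous_on A (k n)" for A
      unfolding k_def
      by (intro continuous_intros continuous_on_compose2[OF \<sigma>'(1)]) auto
    have k_nonneg: "0 \<le> k n x" for x using \<sigma>'(3) by (simp add: k_def)
    have "((\<lambda>x. \<sigma> (real (Suc n) * (x - s))) has_vector_derivative k n x) (at x within {0..T})" for x
    proof -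
      have "((\<lambda>x. real (Suc n) * (x - s)) has_real_derivative real (Suc n)) (at x)"
        by (auto intro!: derivative_eq_intros)
      from DERIV_chain2[OF \<sigma>'(2) this]
      show ?thesis unfolding k_def
        by (simp add: has_real_derivative_iff_has_vector_derivative[symmetric] mult.commute has_field_derivative_at_within)
    qed
    then have "(k n has_integral \<sigma> (real (Suc n) * (T - s)) - \<sigma> (real (Suc n) * (0 - s))) {0..T}"
      using s by (intro fundamental_theorem_of_calculus) auto
    moreover have "\<sigma> (real (Suc n) * (T - s)) = 1"
      using n'(2) by (intro \<sigma>(2)) (simp add: field_simps)
    moreover have "\<sigma> (real (Suc n) * (0 - s)) = 0"
      using s by (intro \<sigma>(1)) simp
    ultimately have int1: "(k n has_integral 1) {0..T}" by simp
    have "(LINT x|time_measure T. k n x * g x) = integral {0..T} (\<lambda>x. k n x * g x)"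
      by (intro time_continuous continuous_on_mult cont g)
    moreover have "(\<lambda>x. k n x * g x) integrable_on {0..T}"
      by (intro integrable_continuous_real continuous_on_mult cont g)
    ultimately have i1: "((\<lambda>x. k n x * g x - k n x * g s) has_integral
        (LINT x|time_measure T. k n x * g x) - 1 * g s) {0..T}"
      using int1 by (intro has_integral_diff has_integral_mult_left) (simp_all add: integrable_integral)
    have le: "norm (k n x * g x - k n x * g s) \<le> k n x * (r / 2)" if x: "x \<in> {0..T}" for x
    proof (cases "s \<le> x \<and> x \<le> s + 1 / real (Suc n)")
      case True
      then have "\<bar>g x - g s\<bar> < r / 2" using n'(1) by (intro d(2) x) auto
      then have "k n x * \<bar>g x - g s\<bar> \<le> k n x * (r / 2)"
        by (intro mult_left_mono k_nonneg) simp
      moreover have "norm (k n x * g x - k n x * g s) = k n x * \<bar>g x - g s\<bar>"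
        using k_nonneg[of x] by (simp add: abs_mult flip: right_diff_distrib)
      ultimately show ?thesis by simp
    next
      case False
      then consider "x < s" | "s + 1 / real (Suc n) < x" by linarith
      then have "real (Suc n) * (x - s) \<le> 0 \<or> 1 \<le> real (Suc n) * (x - s)"
      proof cases
        case 1
        then show ?thesis by (intro disjI1 mult_nonneg_nonpos) auto
      next
        case 2
        then show ?thesis by (simp add: field_simps)
      qed
      then have "k n x = 0" unfolding k_def using supp by simp
      then show ?thesis by simp
    qed
    have i2: "((\<lambda>x. k n x * (r / 2)) has_integral 1 * (r / 2)) {0..T}"
      by (intro has_integral_mult_left int1)
    have "norm ((LINT x|time_measure T. k n x * g x) - 1 * g s) \<le> 1 * (r / 2)"
      using integral_norm_bound_integral[OF has_integral_integrable[OF i1] has_integral_integrable[OF i2] le]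
      unfolding integral_unique[OF i1] integral_unique[OF i2] .
    then show ?thesis by simp
  qed
  then show "\<exists>no. \<forall>n\<ge>no. norm ((LINT x|time_measure T. (real (Suc n) * \<sigma>' (real (Suc n) * (x - s))) * g x) - g s) < r"
    using \<open>0 < r\<close> unfolding k_def by (intro exI[of _ N]) force
qed

text \<open>The weak derivative is tested with smooth approximations of the indicator of \<open>{s<..t}\<close>.\<close>

lemma weak_derivative_integral:
  fixes g g' :: "real \<Rightarrow> real"
  assumes g: "continuous_on {0..T} g" and g': "integrable (time_measure T) g'"
    and weak: "\<And>\<phi>. \<phi> \<in> test_functions {0<..<T} \<Longrightarrow>
      (LINT t|time_measure T. deriv \<phi> t * g t) = - (LINT t|time_measure T. \<phi> t * g' t)"
    and st: "0 < s" "s \<le> t" "t < T"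
  shows "g t - g s = (LINT r|time_measure T. (if s < r \<and> r \<le> t then g' r else 0))"
proof -
  let ?M = "time_measure T"
  obtain \<sigma> \<sigma>' :: "real \<Rightarrow> real" where \<sigma>: "\<And>k. C_differentiable k \<sigma>" "continuous_on UNIV \<sigma>'"
    "\<And>x. (\<sigma> has_real_derivative \<sigma>' x) (at x)" "\<And>x. 0 \<le> \<sigma>' x"
    "\<And>x. x \<le> 0 \<Longrightarrow> \<sigma> x = 0" "\<And>x. 1 \<le> x \<Longrightarrow> \<sigma> x = 1"
    "\<And>x. x \<le> 0 \<or> 1 \<le> x \<Longrightarrow> \<sigma>' x = 0" by (rule smooth_step_exists) (rule that)
  have mono: "\<sigma> x \<le> \<sigma> y" if "x \<le> y" for x y
    using DERIV_nonneg_imp_nondecreasing[OF that, of \<sigma>] \<sigma>(3,4) by blast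
  have bounds: "0 \<le> \<sigma> x" "\<sigma> x \<le> 1" for x
    using mono[of "min x 0" x] mono[of x "max x 1"] \<sigma>(5)[of "min x 0"] \<sigma>(6)[of "max x 1"] by auto
  \<comment> \<open>A step up at \<open>s\<close> minus a step up at \<open>t\<close>. The
    derivative is a difference of two approximate identities, and the function itself tends to the
    indicator of the interval.\<close>
  define \<phi> where "\<phi> n x = \<sigma> (real (Suc n) * (x - s)) - \<sigma> (real (Suc n) * (x - t))" for n x
  have deriv_step: "((\<lambda>x. \<sigma> (real (Suc n) * (x - p))) has_real_derivative
      real (Suc n) * \<sigma>' (real (Suc n) * (x - p))) (at x)" for n p x
  proof -
    have "((\<lambda>x. real (Suc n) * (x - p)) has_real_derivative real (Suc n)) (at x)"
      by (auto intro!: derivative_eq_intros)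
    from DERIV_chain2[OF \<sigma>(3) this] show ?thesis by (simp add: mult.commute)
  qed
  have deriv_\<phi>: "deriv (\<phi> n) x = real (Suc n) * \<sigma>' (real (Suc n) * (x - s))
      - real (Suc n) * \<sigma>' (real (Suc n) * (x - t))" for n x
    unfolding \<phi>_def[abs_def] by (intro DERIV_imp_deriv DERIV_diff deriv_step)
  \<comment> \<open>The step down ends at \<open>t + 1 / Suc n\<close>, so only for
    \<open>n \<ge> N\<close> is the support certain to be inside \<open>{0<..<T}\<close>.\<close>
  obtain N where N: "1 / real (Suc N) < T - t" using nat_approx_posE[of "T - t"] st by auto
  have test: "\<phi> n \<in> test_functions {0<..<T}" if n: "N \<le> n" for n
  proof (rule test_functionsI)
    show "compact {s..t + 1 / real (Suc n)}" by simp
    have "1 / real (Suc n) \<le> 1 / real (Suc N)" using n by (simp add: frac_le)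
    then show "{s..t + 1 / real (Suc n)} \<subseteq> {0<..<T}" using st N by auto
    have "C_differentiable k (\<lambda>x. \<sigma> (real (Suc n) * (x \<bullet> 1) + (- real (Suc n) * s))
        + (- 1) * \<sigma> (real (Suc n) * (x \<bullet> 1) + (- real (Suc n) * t)))" for k
      by (intro C_differentiable_add C_differentiable_cmult C_differentiable_compose_affine \<sigma>)
    also have "(\<lambda>x. \<sigma> (real (Suc n) * (x \<bullet> 1) + (- real (Suc n) * s))
        + (- 1) * \<sigma> (real (Suc n) * (x \<bullet> 1) + (- real (Suc n) * t))) = \<phi> n"
      by (simp add: \<phi>_def fun_eq_iff right_diff_distrib del: of_nat_Suc)
    finally show "C_differentiable k (\<phi> n)" for k .
    show "\<phi> n x = 0" if "x \<notin> {s..t + 1 / real (Suc n)}" for x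
    proof (cases "x < s")
      case True
      then have "real (Suc n) * (x - s) \<le> 0" "real (Suc n) * (x - t) \<le> 0"
        using st by (auto intro!: mult_nonneg_nonpos)
      then show ?thesis using \<sigma>(5) by (simp add: \<phi>_def)
    next
      case False
      then have "t + 1 / real (Suc n) < x" using that by auto
      then have "1 \<le> real (Suc n) * (x - t)" by (simp add: field_simps)
      moreover have "real (Suc n) * (x - t) \<le> real (Suc n) * (x - s)" using st by simp
      ultimately have "1 \<le> real (Suc n) * (x - s)" "1 \<le> real (Suc n) * (x - t)" by linarith+
      then show ?thesis using \<sigma>(6) by (simp add: \<phi>_def)
    qed
  qed
  have lim1: "(\<lambda>n. LINT x|?M. deriv (\<phi> n) x * g x) \<longlonglongrightarrow> g s - g t"
  proof -
    let ?k = "\<lambda>n p x. real (Suc n) * \<sigma>' (real (Suc n) * (x - p))"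
    have cont: "continuous_on {0..T} (\<lambda>x. ?k n p x * g x)" for n p
      by (intro continuous_intros continuous_on_compose2[OF \<sigma>(2)] g) auto
    have "(LINT x|?M. deriv (\<phi> n) x * g x) = (LINT x|?M. ?k n s x * g x) - (LINT x|?M. ?k n t x * g x)" for n
      unfolding deriv_\<phi> left_diff_distrib
      by (intro Bochner_Integration.integral_diff time_continuous(1) cont)
    moreover have "(\<lambda>n. (LINT x|?M. ?k n s x * g x) - (LINT x|?M. ?k n t x * g x)) \<longlonglongrightarrow> g s - g t"
      using st by (intro tendsto_diff approximate_identity_limit[OF g _ _ \<sigma>(2-7)]) auto
    ultimately show ?thesis by simp
  qed
  have "(\<lambda>n. LINT x|?M. \<phi> n x * g' x) \<longlonglongrightarrow> (LINT r|?M. (if s < r \<and> r \<le> t then g' r else 0))"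
  proof (rule integral_dominated_convergence[where w="\<lambda>x. \<bar>g' x\<bar>"])
    have [measurable]: "g' \<in> borel_measurable ?M" using g' by auto
    have [measurable]: "(\<lambda>r. r) \<in> borel_measurable ?M" by (intro borel_imp_time_measurable) simp
    show "(\<lambda>r. if s < r \<and> r \<le> t then g' r else 0) \<in> borel_measurable ?M" by measurable
    have "isCont (\<phi> n) x" for n x
      unfolding \<phi>_def[abs_def] by (rule DERIV_isCont[OF DERIV_diff[OF deriv_step deriv_step]])
    then have "continuous_on UNIV (\<phi> n)" for n by (intro continuous_at_imp_continuous_on) simp
    then have [measurable]: "\<phi> n \<in> borel_measurable ?M" for n
      by (intro borel_imp_time_measurable borel_measurable_continuous_onI)
    show "(\<lambda>x. \<phi> n x * g' x) \<in> borel_measurable ?M" for n by measurable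
    show "integrable ?M (\<lambda>x. \<bar>g' x\<bar>)" using g' by simp
    have "\<bar>\<phi> n x\<bar> \<le> 1" for n x
      using bounds[of "real (Suc n) * (x - s)"] bounds[of "real (Suc n) * (x - t)"] unfolding \<phi>_def by linarith
    then have "\<bar>\<phi> n x\<bar> * \<bar>g' x\<bar> \<le> 1 * \<bar>g' x\<bar>" for n x by (intro mult_right_mono) auto
    then show "AE x in ?M. norm (\<phi> n x * g' x) \<le> \<bar>g' x\<bar>" for n by (simp add: abs_mult)
    \<comment> \<open>At \<open>x = p\<close> the value is \<open>\<sigma> 0 = 0\<close>, hence the
      interval in the limit is open at \<open>s\<close> and closed at \<open>t\<close>.\<close>
    have step_lim: "(\<lambda>n. \<sigma> (real (Suc n) * (x - p))) \<longlonglongrightarrow> (if p < x then 1 else 0)" for x p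
    proof (cases "p < x")
      case True
      then obtain m where m: "1 / real (Suc m) < x - p" using nat_approx_posE[of "x - p"] by auto
      have "1 \<le> real (Suc n) * (x - p)" if "m \<le> n" for n
      proof -
        have "1 / real (Suc n) \<le> 1 / real (Suc m)" using that by (simp add: frac_le)
        then have "1 / real (Suc n) < x - p" using m by linarith
        then show ?thesis by (simp add: field_simps)
      qed
      then have "\<forall>\<^sub>F n in sequentially. \<sigma> (real (Suc n) * (x - p)) = 1"
        by (intro eventually_sequentiallyI[of m] \<sigma>(6))
      then show ?thesis using True by (simp add: tendsto_eventually)
    next
      case False
      then have "real (Suc n) * (x - p) \<le> 0" for n by (intro mult_nonneg_nonpos) auto
      then show ?thesis using False \<sigma>(5) by simp
    qed
    have "(\<lambda>n. \<phi> n x * g' x) \<longlonglongrightarrow> ((if s < x then 1 else 0) - (if t < x then 1 else 0)) * g' x" for x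
      unfolding \<phi>_def by (intro tendsto_intros step_lim)
    moreover have "((if s < x then 1 else 0) - (if t < x then 1 else 0)) * g' x = (if s < x \<and> x \<le> t then g' x else 0)" for x
      using st by auto
    ultimately show "AE x in ?M. (\<lambda>n. \<phi> n x * g' x) \<longlonglongrightarrow> (if s < x \<and> x \<le> t then g' x else 0)" by simp
  qed
  then have lim2: "(\<lambda>n. - (LINT x|?M. \<phi> n x * g' x)) \<longlonglongrightarrow> - (LINT r|?M. (if s < r \<and> r \<le> t then g' r else 0))"
    by (rule tendsto_minus)
  have ev: "\<forall>\<^sub>F n in sequentially. - (LINT x|?M. \<phi> n x * g' x) = (LINT x|?M. deriv (\<phi> n) x * g x)"
    by (rule eventually_sequentiallyI[of N]) (simp add: weak[OF test])
  have "g s - g t = - (LINT r|?M. (if s < r \<and> r \<le> t then g' r else 0))"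
    by (rule LIMSEQ_unique[OF lim1 Lim_transform_eventually[OF lim2 ev]])
  then show ?thesis by simp
qed

text \<open>With \<open>F n t = K (t + h n) t\<close>, symmetry makes the subtracted term equal to F
  at the time t - h. After a shift of variable only the integrals of F over strips of width h to the
  left of \<open>b\<close> and of \<open>a\<close> remain, and their means tend to the diagonal
  values by continuity of \<open>K\<close>.\<close>

lemma symmetric_kernel_difference_quotient:
  fixes K :: "real \<Rightarrow> real \<Rightarrow> real"
  assumes K: "continuous_on ({0..T} \<times> {0..T}) (\<lambda>(s, t). K s t)" and sym: "\<And>s t. K s t = K t s"
    and ab: "0 < a" "a \<le> b" "b < T" and h: "h \<longlonglongrightarrow> 0" "\<And>n. 0 < h n" "\<And>n. h n \<le> a" "\<And>n. h n \<le> T - b"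
  shows "(\<lambda>n. (1 / h n) * integral {a..b} (\<lambda>t. K (t + h n) t - K (t - h n) t)) \<longlonglongrightarrow> K b b - K a a"
proof -
  have cont: "continuous_on A (\<lambda>t. K (p t) (q t))"
    if "continuous_on A p" "continuous_on A q" "p ` A \<subseteq> {0..T}" "q ` A \<subseteq> {0..T}" for p q :: "real \<Rightarrow> real" and A
    using continuous_on_compose2[OF K continuous_on_Pair[OF that(1,2)]] that(3,4) by auto
  define F where "F n t = K (t + h n) t" for n t
  have F_cont: "continuous_on {c..d} (F n)" if "0 \<le> c" "d \<le> T - h n" for n c d
    unfolding F_def using that h(2)[of n] by (intro cont continuous_intros) auto
  have tail: "(\<lambda>n. (1 / h n) * integral {c - h n..c} (F n)) \<longlonglongrightarrow> K c c"
    if c: "c \<in> {a, b}" for c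
  proof (rule LIMSEQ_I)
    fix r :: real assume "0 < r"
    have "(c, c) \<in> {0..T} \<times> {0..T}" using c ab by auto
    with K have "continuous (at (c, c) within {0..T} \<times> {0..T}) (\<lambda>(s, t). K s t)"
      by (simp add: continuous_on_eq_continuous_within)
    then obtain d where d: "0 < d" "\<And>z. z \<in> {0..T} \<times> {0..T} \<Longrightarrow> dist z (c, c) < d \<Longrightarrow>
        dist (case z of (s, t) \<Rightarrow> K s t) (K c c) < r / 2"
      using \<open>0 < r\<close> unfolding continuous_within_eps_delta by (metis (no_types, lifting) half_gt_zero case_prod_conv)
    obtain N where N: "\<And>n. N \<le> n \<Longrightarrow> \<bar>h n\<bar> < d / 2"
      using LIMSEQ_D[OF h(1), of "d / 2"] d(1) by auto
    have "\<bar>(1 / h n) * integral {c - h n..c} (F n) - K c c\<bar> \<le> r / 2" if n: "N \<le> n" for n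
    proof -
      have hn: "0 < h n" "h n \<le> c" "c \<le> T - h n" "h n < d / 2"
        using h(2-4)[of n] c ab N[OF n] by auto
      have near: "\<bar>F n t - K c c\<bar> \<le> r / 2" if t: "t \<in> {c - h n..c}" for t
      proof -
        have "dist (t + h n, t) (c, c) \<le> \<bar>t + h n - c\<bar> + \<bar>t - c\<bar>"
          unfolding dist_Pair_Pair by (simp add: dist_real_def sqrt_sum_squares_le_sum_abs)
        also have "\<dots> < d" using t hn by auto
        finally show ?thesis using d(2)[of "(t + h n, t)"] t hn by (auto simp: F_def dist_real_def)
      qed
      have Fc: "continuous_on {c - h n..c} (F n)"
        using hn by (intro F_cont) auto
      have "integral {c - h n..c} (\<lambda>t. F n t - K c c) = integral {c - h n..c} (F n) - h n * K c c"
        using hn Fc by (subst Henstock_Kurzweil_Integration.integral_diff) (auto intro: integrable_continuous_real)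
      moreover have "norm (integral {c - h n..c} (\<lambda>t. F n t - K c c)) \<le> r / 2 * (c - (c - h n))"
        using hn near Fc by (intro integral_bound continuous_on_diff continuous_on_const) auto
      ultimately have "\<bar>integral {c - h n..c} (F n) - h n * K c c\<bar> \<le> r / 2 * h n" by simp
      moreover have "(1 / h n) * integral {c - h n..c} (F n) - K c c
          = (integral {c - h n..c} (F n) - h n * K c c) / h n"
        using hn by (simp add: field_simps)
      ultimately show ?thesis using hn by (simp add: abs_divide divide_le_eq)
    qed
    then show "\<exists>no. \<forall>n\<ge>no. norm ((1 / h n) * integral {c - h n..c} (F n) - K c c) < r"
      using \<open>0 < r\<close> by (intro exI[of _ N]) force
  qed
  have eq: "integral {a..b} (\<lambda>t. K (t + h n) t - K (t - h n) t)
     = integral {b - h n..b} (F n) - integral {a - h n..a} (F n)" for n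
  proof -
    have hn: "0 < h n" "h n \<le> a" "b \<le> T - h n" using h(2-4)[of n] by auto
    have G_cont: "continuous_on {a..b} (\<lambda>t. K (t - h n) t)"
      using hn ab by (intro cont continuous_intros) auto
    have "integral {a..b} (\<lambda>t. K (t - h n) t) = integral {a - h n..b - h n} (F n)"
    proof -
      have "integral {a - h n..b - h n} ((\<lambda>t. K (t - h n) t) \<circ> (+) (h n)) = integral {a..b} (\<lambda>t. K (t - h n) t)"
        using integral_shift_Icc_real[of "a - h n" "b - h n" "\<lambda>t. K (t - h n) t" "h n"] by simp
      moreover have "(\<lambda>t. K (t - h n) t) \<circ> (+) (h n) = F n"
        unfolding F_def comp_def by (auto simp: sym add.commute)
      ultimately show ?thesis by simp
    qed
    moreover have "integral {a..b} (\<lambda>t. K (t + h n) t - K (t - h n) t)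
        = integral {a..b} (F n) - integral {a..b} (\<lambda>t. K (t - h n) t)"
      unfolding F_def[symmetric] using hn ab
      by (intro Henstock_Kurzweil_Integration.integral_diff integrable_continuous_real F_cont G_cont) auto
    moreover have "integral {a - h n..a} (F n) + integral {a..b} (F n) = integral {a - h n..b} (F n)"
      using hn ab by (intro Henstock_Kurzweil_Integration.integral_combine integrable_continuous_real F_cont) auto
    moreover have "integral {a - h n..b - h n} (F n) + integral {b - h n..b} (F n) = integral {a - h n..b} (F n)"
      using hn ab by (intro Henstock_Kurzweil_Integration.integral_combine integrable_continuous_real F_cont) auto
    ultimately show ?thesis by simp
  qed
  show ?thesis
    unfolding eq right_diff_distrib using tail by (intro tendsto_diff) auto
qed

section \<open>Averages over moving windows and their convergence in L1\<close>

abbreviation windowed :: "real \<Rightarrow> real \<Rightarrow> (real \<Rightarrow> real) \<Rightarrow> real \<Rightarrow> real" where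
  "windowed h t \<beta> r \<equiv> if t - h < r \<and> r \<le> t + h then \<beta> r else 0"

text \<open>The divisor is the full width \<open>2 * h\<close> even where the window leaves (0, T).
  Near the ends this is not a mean value, but the bound for constants and the contraction in L1 then
  hold without restricting \<open>t\<close>.\<close>

definition window_avg :: "real \<Rightarrow> real \<Rightarrow> (real \<Rightarrow> real) \<Rightarrow> real \<Rightarrow> real" where
  "window_avg T h \<beta> t =
     (1 / (2 * h)) * (LINT r|time_measure T. windowed h t \<beta> r)"

lemma time_measurable_id: "(\<lambda>r. r) \<in> borel_measurable (time_measure T)"
  by (rule borel_imp_time_measurable) simp

lemma window_integrable:
  fixes \<beta> :: "real \<Rightarrow> real"
  assumes "integrable (time_measure T) \<beta>"
  shows "integrable (time_measure T) (\<lambda>r. (if c < r \<and> r \<le> d then \<beta> r else 0))"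
proof (rule Bochner_Integration.integrable_bound[OF assms])
  have [measurable]: "\<beta> \<in> borel_measurable (time_measure T)" using assms by auto
  note [measurable] = time_measurable_id
  show "(\<lambda>r. (if c < r \<and> r \<le> d then \<beta> r else 0)) \<in> borel_measurable (time_measure T)" by measurable
qed auto

lemma time_product_measurable:
  shows "fst \<in> borel_measurable (time_measure T \<Otimes>\<^sub>M time_measure T)"
    and "snd \<in> borel_measurable (time_measure T \<Otimes>\<^sub>M time_measure T)"
    and "\<beta> \<in> borel_measurable (time_measure T) \<Longrightarrow>
      (\<lambda>x. \<beta> (snd x)) \<in> borel_measurable (time_measure T \<Otimes>\<^sub>M time_measure T)"
  using measurable_compose[OF measurable_fst time_measurable_id[of T]]
    measurable_compose[OF measurable_snd time_measurable_id[of T]] measurable_compose[OF measurable_snd, of \<beta>]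
  by simp_all

lemma window_avg_measurable:
  assumes "\<beta> \<in> borel_measurable (time_measure T)"
  shows "window_avg T h \<beta> \<in> borel_measurable (time_measure T)"
proof -
  interpret finite_measure "time_measure T" by (intro finite_measure_lebesgue_on) auto
  note [measurable] = time_product_measurable(1,2)[of T] time_product_measurable(3)[OF assms]
  have "(\<lambda>x. windowed h (fst x) \<beta> (snd x)) \<in> borel_measurable (time_measure T \<Otimes>\<^sub>M time_measure T)"
    by measurable
  then have "(\<lambda>t. LINT r|time_measure T. windowed h t \<beta> r) \<in> borel_measurable (time_measure T)"
    by (intro borel_measurable_lebesgue_integral) (simp add: case_prod_unfold)
  then show ?thesis unfolding window_avg_def[abs_def] by (intro borel_measurable_times borel_measurable_const)
qed

lemma window_avg_mono:
  assumes "integrable (time_measure T) \<beta>" "integrable (time_measure T) \<gamma>" "0 < h"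
    "AE r in time_measure T. t - h < r \<and> r \<le> t + h \<longrightarrow> \<beta> r \<le> \<gamma> r"
  shows "window_avg T h \<beta> t \<le> window_avg T h \<gamma> t"
  unfolding window_avg_def
proof (intro mult_left_mono integral_mono_AE window_integrable assms)
  show "AE r in time_measure T. windowed h t \<beta> r \<le> (windowed h t \<gamma> r)"
    using assms(4) by eventually_elim auto
qed (use assms in auto)

lemma window_avg_lincomb:
  assumes "integrable (time_measure T) \<beta>" "integrable (time_measure T) \<gamma>"
  shows "window_avg T h (\<lambda>r. c * \<beta> r + d * \<gamma> r) t = c * window_avg T h \<beta> t + d * window_avg T h \<gamma> t"
proof -
  have "(LINT r|time_measure T. windowed h t (\<lambda>r. c * \<beta> r + d * \<gamma> r) r)
      = (LINT r|time_measure T. c * (windowed h t \<beta> r) + d * (windowed h t \<gamma> r))"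
    by (intro Bochner_Integration.integral_cong) auto
  also have "\<dots> = c * (LINT r|time_measure T. windowed h t \<beta> r)
      + d * (LINT r|time_measure T. windowed h t \<gamma> r)"
    using window_integrable[OF assms(1)] window_integrable[OF assms(2)] by simp
  finally show ?thesis unfolding window_avg_def by (simp add: algebra_simps)
qed

lemma window_avg_abs_le:
  assumes "integrable (time_measure T) \<beta>" "0 < h"
  shows "\<bar>window_avg T h \<beta> t\<bar> \<le> window_avg T h (\<lambda>r. \<bar>\<beta> r\<bar>) t"
proof -
  have "\<bar>LINT r|time_measure T. windowed h t \<beta> r\<bar>
      \<le> (LINT r|time_measure T. \<bar>windowed h t \<beta> r\<bar>)"
    by (rule integral_abs_bound)
  also have "\<dots> = (LINT r|time_measure T. windowed h t (\<lambda>r. \<bar>\<beta> r\<bar>) r)"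
    by (intro Bochner_Integration.integral_cong) auto
  finally show ?thesis
    using assms(2) unfolding window_avg_def abs_mult by (auto intro!: divide_right_mono)
qed

lemma window_avg_const_le:
  assumes "0 < h" "0 \<le> c"
  shows "window_avg T h (\<lambda>_. c) t \<le> c"
proof -
  have "(LINT r|time_measure T. windowed h t (\<lambda>r. c) r)
      = (LINT r|time_measure T. indicator {t - h<..t + h} r *\<^sub>R c)"
    by (intro Bochner_Integration.integral_cong) auto
  also have "\<dots> = measure (time_measure T) ({t - h<..t + h} \<inter> {0<..<T}) * c"
    by (simp add: measure_restrict_space)
  also have "measure (time_measure T) ({t - h<..t + h} \<inter> {0<..<T}) \<le> 2 * h"
  proof -
    have "measure lebesgue ({t - h<..t + h} \<inter> {0<..<T}) \<le> measure lebesgue {t - h..t + h}"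
      by (intro measure_mono_fmeasurable) auto
    also have "\<dots> = 2 * h" using assms(1) by simp
    finally show ?thesis by (simp add: measure_restrict_space)
  qed
  finally show ?thesis
    using assms unfolding window_avg_def by (simp add: divide_le_eq mult_right_mono mult.commute)
qed

text \<open>By Tonelli each \<open>\<beta> r\<close> is counted for those t whose window contains
  \<open>r\<close>, a set of measure at most \<open>2 * h\<close>, which cancels the
  divisor.\<close>

lemma window_avg_integral_le:
  assumes \<beta>: "integrable (time_measure T) \<beta>" "\<And>r. 0 \<le> \<beta> r" and h: "0 < h"
  shows "integrable (time_measure T) (window_avg T h \<beta>)"
    "(LINT t|time_measure T. window_avg T h \<beta> t) \<le> (LINT r|time_measure T. \<beta> r)"
proof -
  let ?M = "time_measure T"
  interpret finite_measure ?M by (intro finite_measure_lebesgue_on) auto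
  interpret pair_sigma_finite ?M ?M ..
  have [measurable]: "\<beta> \<in> borel_measurable ?M" using \<beta> by auto
  note [measurable] = time_measurable_id[of T]
  note [measurable] = time_product_measurable(1,2)[of T] time_product_measurable(3)[of \<beta> T, OF \<open>\<beta> \<in> _\<close>]
  have nonneg: "0 \<le> window_avg T h \<beta> t" for t
    unfolding window_avg_def using h \<beta>(2) by (intro mult_nonneg_nonneg integral_nonneg_AE) auto
  have eq: "ennreal (window_avg T h \<beta> t)
      = ennreal (1 / (2 * h)) * (\<integral>\<^sup>+r. ennreal (windowed h t \<beta> r) \<partial>?M)" for t
  proof -
    have "(\<integral>\<^sup>+r. ennreal (windowed h t \<beta> r) \<partial>?M)
        = ennreal (LINT r|?M. windowed h t \<beta> r)"
      by (rule nn_integral_eq_integral[OF window_integrable[OF \<beta>(1)]]) (use \<beta>(2) in auto)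
    then show ?thesis
      unfolding window_avg_def using h by (simp only:) (intro ennreal_mult', simp)
  qed
  \<comment> \<open>For fixed \<open>r\<close>, the condition that \<open>r\<close> lies in the
    window of \<open>t\<close> confines \<open>t\<close> to \<open>{r - h..r + h}\<close>.\<close>
  have inner: "(\<integral>\<^sup>+t. ennreal (windowed h t \<beta> r) \<partial>?M) \<le> ennreal (2 * h) * ennreal (\<beta> r)" for r
  proof -
    have "(\<integral>\<^sup>+t. ennreal (windowed h t \<beta> r) \<partial>?M)
        \<le> (\<integral>\<^sup>+t. ennreal (\<beta> r) * indicator ({r - h..r + h} \<inter> {0<..<T}) t \<partial>?M)"
      by (intro nn_integral_mono) (auto simp: indicator_def)
    also have "\<dots> = ennreal (\<beta> r) * emeasure ?M ({r - h..r + h} \<inter> {0<..<T})"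
      by (intro nn_integral_cmult_indicator) (auto simp: sets_restrict_space_iff)
    also have "\<dots> \<le> ennreal (\<beta> r) * ennreal (2 * h)"
    proof (rule mult_left_mono)
      have "emeasure ?M ({r - h..r + h} \<inter> {0<..<T}) = emeasure lebesgue ({r - h..r + h} \<inter> {0<..<T})"
        by (intro emeasure_restrict_space) auto
      also have "\<dots> \<le> emeasure lebesgue {r - h..r + h}" by (intro emeasure_mono) auto
      also have "\<dots> = ennreal (2 * h)" using h by simp
      finally show "emeasure ?M ({r - h..r + h} \<inter> {0<..<T}) \<le> ennreal (2 * h)" .
    qed simp
    finally show ?thesis by (simp only: mult.commute)
  qed
  have le: "(\<integral>\<^sup>+t. ennreal (window_avg T h \<beta> t) \<partial>?M) \<le> ennreal (LINT r|?M. \<beta> r)"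
  proof -
    have "(\<integral>\<^sup>+t. ennreal (window_avg T h \<beta> t) \<partial>?M)
        = ennreal (1 / (2 * h)) * (\<integral>\<^sup>+t. \<integral>\<^sup>+r. ennreal (windowed h t \<beta> r) \<partial>?M \<partial>?M)"
      unfolding eq by (intro nn_integral_cmult) measurable
    also have "(\<integral>\<^sup>+t. \<integral>\<^sup>+r. ennreal (windowed h t \<beta> r) \<partial>?M \<partial>?M)
        = (\<integral>\<^sup>+r. \<integral>\<^sup>+t. ennreal (windowed h t \<beta> r) \<partial>?M \<partial>?M)"
      by (intro Fubini'[symmetric]) (simp add: case_prod_unfold)
    also have "ennreal (1 / (2 * h)) * \<dots> \<le> ennreal (1 / (2 * h)) * (\<integral>\<^sup>+r. ennreal (2 * h) * ennreal (\<beta> r) \<partial>?M)"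
      by (intro mult_left_mono nn_integral_mono inner) simp
    also have "(\<integral>\<^sup>+r. ennreal (2 * h) * ennreal (\<beta> r) \<partial>?M) = ennreal (2 * h) * ennreal (LINT r|?M. \<beta> r)"
      using \<beta> by (subst nn_integral_cmult) (auto simp: nn_integral_eq_integral)
    also have "ennreal (1 / (2 * h)) * (ennreal (2 * h) * ennreal (LINT r|?M. \<beta> r))
        = ennreal (1 / (2 * h) * (2 * h * (LINT r|?M. \<beta> r)))"
      using h by (subst ennreal_mult', simp)+ simp
    also have "1 / (2 * h) * (2 * h * (LINT r|?M. \<beta> r)) = (LINT r|?M. \<beta> r)"
      using h by simp
    finally show ?thesis .
  qed
  show int: "integrable ?M (window_avg T h \<beta>)"
    using le nonneg window_avg_measurable[of \<beta> T h]
    by (intro integrableI_nonneg) (auto intro: le_less_trans simp: ennreal_less_top)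
  show "(LINT t|?M. window_avg T h \<beta> t) \<le> (LINT r|?M. \<beta> r)"
    using le nonneg int \<beta>(2) by (simp add: nn_integral_eq_integral ennreal_le_iff integral_nonneg_AE)
qed

text \<open>\<open>measurable_on\<close> yields continuous functions converging only almost
  everywhere. Truncating \<open>g\<close> at a level \<open>m\<close> first, and the continuous
  functions at the same level, gives the constant bound \<open>2 * real m\<close>, integrable on the
  finite interval.\<close>

lemma time_L1_continuous_approx:
  fixes g :: "real \<Rightarrow> real"
  assumes g: "integrable (time_measure T) g" and "0 < e"
  obtains c where "continuous_on UNIV c" "integrable (time_measure T) c"
    "(LINT t|time_measure T. \<bar>g t - c t\<bar>) < e"
proof -
  let ?M = "time_measure T"
  interpret finite_measure ?M by (intro finite_measure_lebesgue_on) auto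
  have [measurable]: "g \<in> borel_measurable ?M" using g by auto
  define g' where "g' m t = max (- real m) (min (real m) (g t))" for m t
  have "(\<lambda>m. LINT t|?M. \<bar>g t - g' m t\<bar>) \<longlonglongrightarrow> (LINT t|?M. 0)"
  proof (rule integral_dominated_convergence[where w="\<lambda>t. \<bar>g t\<bar>"])
    show "AE t in ?M. (\<lambda>m. \<bar>g t - g' m t\<bar>) \<longlonglongrightarrow> 0"
    proof (rule AE_I2)
      fix t
      obtain m where "\<bar>g t\<bar> \<le> real m" using real_arch_simple by blast
      then have "\<bar>g t - g' n t\<bar> = 0" if "m \<le> n" for n using that unfolding g'_def by (auto simp: max_def min_def)
      then show "(\<lambda>m. \<bar>g t - g' m t\<bar>) \<longlonglongrightarrow> 0"
        by (intro tendsto_eventually eventually_sequentiallyI[of m])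
    qed
    show "AE t in ?M. norm \<bar>g t - g' m t\<bar> \<le> \<bar>g t\<bar>" for m
      unfolding g'_def by (auto simp: max_def min_def)
  qed (use g in \<open>auto simp: g'_def\<close>)
  then obtain m where m: "(LINT t|?M. \<bar>g t - g' m t\<bar>) < e / 2"
    using order_tendstoD(2)[of _ "LINT t|?M. 0" sequentially "e / 2"] \<open>0 < e\<close>
    by (auto simp: eventually_sequentially)
  have g'_meas[measurable]: "g' m \<in> borel_measurable ?M" unfolding g'_def by measurable
  then have "g' m measurable_on {0<..<T}" by (simp add: measurable_on_iff_borel_measurable)
  then obtain N c where N: "negligible N" and c: "\<And>n. continuous_on UNIV (c n)"
    "\<And>x. x \<notin> N \<Longrightarrow> (\<lambda>n. c n x) \<longlonglongrightarrow> (if x \<in> {0<..<T} then g' m x else 0)"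
    unfolding measurable_on_def by metis
  define c' where "c' n t = max (- real m) (min (real m) (c n t))" for n t
  have c'_cont: "continuous_on UNIV (c' n)" for n
    unfolding c'_def by (intro continuous_intros c)
  have c'_meas[measurable]: "c' n \<in> borel_measurable ?M" for n
    by (intro borel_imp_time_measurable borel_measurable_continuous_onI c'_cont)
  have c'_int: "integrable ?M (c' n)" for n
    by (rule integrable_const_bound[of _ "real m"]) (auto simp: c'_def)
  have g'_int: "integrable ?M (g' m)"
    by (rule integrable_const_bound[of _ "real m"]) (auto simp: g'_def)
  have "(\<lambda>n. LINT t|?M. \<bar>g' m t - c' n t\<bar>) \<longlonglongrightarrow> (LINT t|?M. 0)"
  proof (rule integral_dominated_convergence[where w="\<lambda>t. 2 * real m"])
    have "AE t in lebesgue. t \<notin> N" using N by (intro AE_not_in) (simp add: negligible_iff_null_sets)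
    then have "AE t in ?M. t \<notin> N" by (simp add: AE_restrict_space_iff) (auto elim: eventually_mono)
    then show "AE t in ?M. (\<lambda>n. \<bar>g' m t - c' n t\<bar>) \<longlonglongrightarrow> 0"
      using AE_space
    proof eventually_elim
      case (elim t)
      then have "(\<lambda>n. c n t) \<longlonglongrightarrow> g' m t" using c(2)[of t] by simp
      then have "(\<lambda>n. \<bar>g' m t - c' n t\<bar>) \<longlonglongrightarrow> \<bar>g' m t - max (- real m) (min (real m) (g' m t))\<bar>"
        unfolding c'_def by (intro tendsto_intros)
      moreover have "max (- real m) (min (real m) (g' m t)) = g' m t" by (auto simp: g'_def)
      ultimately show ?case by simp
    qed
    show "AE t in ?M. norm \<bar>g' m t - c' n t\<bar> \<le> 2 * real m" for n
      unfolding g'_def c'_def by (auto simp: max_def min_def)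
  qed auto
  then obtain n where n: "(LINT t|?M. \<bar>g' m t - c' n t\<bar>) < e / 2"
    using order_tendstoD(2)[of _ "LINT t|?M. 0" sequentially "e / 2"] \<open>0 < e\<close>
    by (auto simp: eventually_sequentially)
  have "(LINT t|?M. \<bar>g t - c' n t\<bar>) \<le> (LINT t|?M. \<bar>g t - g' m t\<bar> + \<bar>g' m t - c' n t\<bar>)"
    using g g'_int c'_int by (intro integral_mono) auto
  also have "\<dots> = (LINT t|?M. \<bar>g t - g' m t\<bar>) + (LINT t|?M. \<bar>g' m t - c' n t\<bar>)"
    using g g'_int c'_int by (intro Bochner_Integration.integral_add) auto
  also have "\<dots> < e" using m n by simp
  finally show thesis by (rule that[OF c'_cont c'_int])
qed

lemma time_indicator_integrable:
  fixes f :: "real \<Rightarrow> real"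
  assumes f: "integrable (time_measure T) f"
  shows "integrable (time_measure T) (\<lambda>t. indicator {a..b} t * f t)"
proof (rule Bochner_Integration.integrable_bound[OF f])
  have [measurable]: "f \<in> borel_measurable (time_measure T)" using f by auto
  have [measurable]: "indicat_real {a..b} \<in> borel_measurable (time_measure T)"
    by (intro borel_imp_time_measurable) simp
  show "(\<lambda>t. indicator {a..b} t * f t) \<in> borel_measurable (time_measure T)" by measurable
qed (auto simp: indicator_def)

lemma window_avg_const_eq:
  assumes "0 < h" "h \<le> t" "t + h < T"
  shows "window_avg T h (\<lambda>_. c) t = c"
proof -
  have sub: "{t - h<..t + h} \<inter> {0<..<T} = {t - h<..t + h}" using assms by auto
  have "(LINT r|time_measure T. windowed h t (\<lambda>r. c) r)
      = (LINT r|time_measure T. indicator {t - h<..t + h} r *\<^sub>R c)"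
    by (intro Bochner_Integration.integral_cong) auto
  also have "\<dots> = measure (time_measure T) ({t - h<..t + h} \<inter> {0<..<T}) * c"
    by (simp add: measure_restrict_space)
  also have "measure (time_measure T) ({t - h<..t + h} \<inter> {0<..<T}) = 2 * h"
    unfolding sub using assms by (subst measure_restrict_space) auto
  finally show ?thesis using assms unfolding window_avg_def by simp
qed

lemma window_avg_error_integrable:
  assumes g: "integrable (time_measure T) g" and h: "0 < h"
  shows "integrable (time_measure T) (\<lambda>t. indicator {a..b} t * \<bar>window_avg T h g t - g t\<bar>)"
proof (intro time_indicator_integrable integrable_abs Bochner_Integration.integrable_diff g)
  show "integrable (time_measure T) (window_avg T h g)"
  proof (rule Bochner_Integration.integrable_bound)
    show "integrable (time_measure T) (window_avg T h (\<lambda>r. \<bar>g r\<bar>))"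
      using g h by (intro window_avg_integral_le) auto
    show "window_avg T h g \<in> borel_measurable (time_measure T)"
      using g by (intro window_avg_measurable) auto
    show "AE t in time_measure T. norm (window_avg T h g t) \<le> norm (window_avg T h (\<lambda>r. \<bar>g r\<bar>) t)"
      by (simp add: order_trans[OF window_avg_abs_le[OF g h] abs_ge_self])
  qed
qed

text \<open>For a continuous \<open>c\<close> close to \<open>g\<close> in L1 the error splits into
  the average of \<open>g - c\<close>, the oscillation of \<open>c\<close> over the window, and
  \<open>c - g\<close> at the centre. The first is controlled by the L1 contraction, the second by
  uniform continuity.\<close>

lemma window_avg_L1_limit:
  fixes g :: "real \<Rightarrow> real"
  assumes g: "integrable (time_measure T) g" and ab: "0 < a" "b < T" "0 < T"
    and h: "h \<longlonglongrightarrow> 0" "\<And>n. 0 < h n" "\<And>n. h n \<le> a" "\<And>n. h n < T - b"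
  shows "(\<lambda>n. LINT t|time_measure T. indicator {a..b} t * \<bar>window_avg T (h n) g t - g t\<bar>) \<longlonglongrightarrow> 0"
proof (rule LIMSEQ_I)
  let ?M = "time_measure T"
  interpret finite_measure ?M by (intro finite_measure_lebesgue_on) auto
  fix r :: real assume "0 < r"
  \<comment> \<open>The two L1 terms contribute less than \<open>e\<close> each and the oscillation
    at most \<open>e * T\<close>; 3 in place of 2 makes the final inequality strict.\<close>
  define e where "e = r / (T + 3)"
  have e: "0 < e" using \<open>0 < r\<close> ab by (simp add: e_def)
  moreover have "e * (T + 3) = r" using ab by (simp add: e_def)
  ultimately have e: "0 < e" "2 * e + e * T < r" by (simp_all add: algebra_simps)
  obtain c where c: "continuous_on UNIV c" "integrable ?M c" "(LINT t|?M. \<bar>g t - c t\<bar>) < e"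
    by (rule time_L1_continuous_approx[OF g e(1)]) (rule that)
  have "uniformly_continuous_on {0..T} c"
    using c(1) by (intro compact_uniformly_continuous continuous_on_subset[OF c(1)]) auto
  then obtain d where d: "0 < d" "\<And>s t. s \<in> {0..T} \<Longrightarrow> t \<in> {0..T} \<Longrightarrow> \<bar>s - t\<bar> < d \<Longrightarrow> \<bar>c s - c t\<bar> < e"
    using e(1) unfolding uniformly_continuous_on_def dist_real_def by metis
  obtain N where N: "\<And>n. N \<le> n \<Longrightarrow> \<bar>h n\<bar> < d"
    using LIMSEQ_D[OF h(1) d(1)] by auto
  have gc: "integrable ?M (\<lambda>t. \<bar>g t - c t\<bar>)" using g c(2) by simp
  have "(LINT t|?M. indicator {a..b} t * \<bar>window_avg T (h n) g t - g t\<bar>) < r" if n: "N \<le> n" for n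
  proof -
    have le: "indicator {a..b} t * \<bar>window_avg T (h n) g t - g t\<bar>
        \<le> window_avg T (h n) (\<lambda>r. \<bar>g r - c r\<bar>) t + e + \<bar>g t - c t\<bar>" for t
    proof (cases "t \<in> {a..b}")
      case True
      then have t: "h n \<le> t" "t + h n < T" "t \<in> {0..T}"
        using h(2-4)[of n] ab by auto
      have "window_avg T (h n) (\<lambda>r. 1 * g r + (- 1) * c r) t = 1 * window_avg T (h n) g t + (- 1) * window_avg T (h n) c t"
        using g c(2) by (rule window_avg_lincomb)
      moreover have "\<bar>window_avg T (h n) (\<lambda>r. g r - c r) t\<bar> \<le> window_avg T (h n) (\<lambda>r. \<bar>g r - c r\<bar>) t"
        using g c(2) h(2) by (intro window_avg_abs_le) auto
      moreover have "window_avg T (h n) (\<lambda>r. 1 * c r + (- 1) * c t) t = 1 * window_avg T (h n) c t + (- 1) * window_avg T (h n) (\<lambda>_. c t) t"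
        using c(2) by (intro window_avg_lincomb) auto
      moreover have "window_avg T (h n) (\<lambda>_. c t) t = c t"
        using t h(2) by (intro window_avg_const_eq) auto
      moreover have "\<bar>window_avg T (h n) (\<lambda>r. c r - c t) t\<bar> \<le> window_avg T (h n) (\<lambda>r. \<bar>c r - c t\<bar>) t"
        using c(2) h(2) by (intro window_avg_abs_le) auto
      moreover have "window_avg T (h n) (\<lambda>r. \<bar>c r - c t\<bar>) t \<le> window_avg T (h n) (\<lambda>_. e) t"
      proof (rule window_avg_mono)
        have "\<bar>c r - c t\<bar> \<le> e" if "t - h n < r" "r \<le> t + h n" for r
          using d(2)[of r t] that t N[OF n] h(2)[of n] by force
        then show "AE r in ?M. t - h n < r \<and> r \<le> t + h n \<longrightarrow> \<bar>c r - c t\<bar> \<le> e" by simp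
      qed (use c(2) h(2) in auto)
      moreover have "window_avg T (h n) (\<lambda>_. e) t \<le> e"
        using h(2) e(1) by (intro window_avg_const_le) auto
      ultimately have "\<bar>window_avg T (h n) g t - g t\<bar> \<le> window_avg T (h n) (\<lambda>r. \<bar>g r - c r\<bar>) t + e + \<bar>g t - c t\<bar>"
        by simp
      then show ?thesis using True by simp
    next
      case False
      have "0 \<le> window_avg T (h n) (\<lambda>r. \<bar>g r - c r\<bar>) t"
        unfolding window_avg_def using h(2)[of n] by (intro mult_nonneg_nonneg integral_nonneg_AE) auto
      then show ?thesis using False e(1) by simp
    qed
    have avg: "integrable ?M (window_avg T (h n) (\<lambda>r. \<bar>g r - c r\<bar>))"
      "(LINT t|?M. window_avg T (h n) (\<lambda>r. \<bar>g r - c r\<bar>) t) \<le> (LINT t|?M. \<bar>g t - c t\<bar>)"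
      by (rule window_avg_integral_le[OF gc]; use h(2) in simp)+
    have int_bound: "integrable ?M (\<lambda>t. window_avg T (h n) (\<lambda>r. \<bar>g r - c r\<bar>) t + e + \<bar>g t - c t\<bar>)"
      using avg(1) gc by simp
    have "(LINT t|?M. indicator {a..b} t * \<bar>window_avg T (h n) g t - g t\<bar>)
        \<le> (LINT t|?M. window_avg T (h n) (\<lambda>r. \<bar>g r - c r\<bar>) t + e + \<bar>g t - c t\<bar>)"
      by (rule integral_mono[OF window_avg_error_integrable[OF g h(2)] int_bound le])
    also have "\<dots> = (LINT t|?M. window_avg T (h n) (\<lambda>r. \<bar>g r - c r\<bar>) t) + e * T + (LINT t|?M. \<bar>g t - c t\<bar>)"
      using avg(1) gc ab by (simp add: measure_restrict_space)
    also have "\<dots> < r" using avg(2) c(3) e(2) by linarith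
    finally show ?thesis .
  qed
  moreover have "0 \<le> (LINT t|?M. indicator {a..b} t * \<bar>window_avg T (h n) g t - g t\<bar>)" for n
    by (intro integral_nonneg_AE) auto
  ultimately show "\<exists>no. \<forall>n\<ge>no. norm ((LINT t|?M. indicator {a..b} t * \<bar>window_avg T (h n) g t - g t\<bar>) - 0) < r"
    by (intro exI[of _ N]) simp
qed

text \<open>Young's inequality. In the window estimate the weight \<open>e\<close> makes the
  contribution of \<open>w'\<close> small, and the price \<open>1 / e\<close> is paid by the
  approximation error, which can be chosen small afterwards.\<close>

lemma mult_le_scaled_squares:
  fixes x y e :: real
  assumes "0 < e"
  shows "x * y \<le> e / 2 * x\<^sup>2 + y\<^sup>2 / (2 * e)"
proof -
  have "0 \<le> (e * x - y)\<^sup>2" by simp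
  then have "2 * e * (x * y) \<le> e\<^sup>2 * x\<^sup>2 + y\<^sup>2" by (simp add: power2_eq_square algebra_simps)
  then show ?thesis using assms by (simp add: field_simps power2_eq_square)
qed

lemma (in bochner_space) const_bochner_L2: "v \<in> S \<Longrightarrow> (\<lambda>t. v) \<in> bochner_L2 M S nrm"
  by (intro simple_bochner_L2) auto

locale time_pairing = bochner_pairing S\<^sub>1 n\<^sub>1 S\<^sub>2 n\<^sub>2 "time_measure T" pr
  for S\<^sub>1 :: "'b::ab_group_add set" and n\<^sub>1 and S\<^sub>2 :: "'c::ab_group_add set" and n\<^sub>2 and T :: real and pr
begin

text \<open>The error splits over a simple function \<open>s\<close> close to \<open>w\<close> in \<open>L\<^sup>2\<close>: the part with \<open>w - s\<close> is
  small uniformly in the window width, and for \<open>s\<close> only scalar averages remain.\<close>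

lemma pairing_window_error:
  assumes w': "w' \<in> bochner_L2 (time_measure T) S\<^sub>1 n\<^sub>1" and w: "w \<in> bochner_L2 (time_measure T) S\<^sub>2 n\<^sub>2"
    and s: "simple_function (time_measure T) s" "\<And>t. t \<in> space (time_measure T) \<Longrightarrow> s t \<in> S\<^sub>2"
    and h: "0 < h" and e: "0 < e"
    and P: "integrable (time_measure T) (\<lambda>t. indicator {a..b} t * P t)"
      "AE t in time_measure T. t \<in> {a..b} \<longrightarrow>
        P t = (LINT r|time_measure T. windowed h t (\<lambda>r. pr (w' r) (w t)) r)"
  shows "\<bar>(LINT t|time_measure T. indicator {a..b} t * (P t / (2 * h))) - (LINT t|time_measure T. indicator {a..b} t * pr (w' t) (w t))\<bar>
    \<le> e * (LINT t|time_measure T. (n\<^sub>1 (w' t))\<^sup>2) + (LINT t|time_measure T. (n\<^sub>2 (w t - s t))\<^sup>2) / e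
      + (\<Sum>v\<in>s ` space (time_measure T). LINT t|time_measure T. indicator {a..b} t * \<bar>window_avg T h (\<lambda>r. pr (w' r) v) t - pr (w' t) v\<bar>)"
proof -
  let ?M = "time_measure T" and ?V = "s ` space (time_measure T)"
  interpret finite_measure ?M by (intro finite_measure_lebesgue_on) auto
  note w'D = A.bochner_L2D[OF w'] and wD = B.bochner_L2D[OF w]
  have finV: "finite ?V" using s(1) by (simp add: simple_function_def)
  have s_L2: "s \<in> bochner_L2 ?M S\<^sub>2 n\<^sub>2" by (rule B.simple_bochner_L2[OF s])
  note dD = B.bochner_L2D[OF B.bochner_L2_diff[OF w s_L2]]
  \<comment> \<open>Freezing the second argument at a value of \<open>s\<close> leaves a scalar
    integrable function, to which the L1 convergence of window averages applies.\<close>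
  define g where "g v r = pr (w' r) v" for v r
  have g_int: "integrable ?M (g v)" if "v \<in> S\<^sub>2" for v
    unfolding g_def[abs_def] by (rule pairing_integrable[OF w' B.const_bochner_L2[OF that]])
  define E where "E v t = indicator {a..b} t * \<bar>window_avg T h (g v) t - g v t\<bar>" for v t
  have avg_sq: "integrable ?M (window_avg T h (\<lambda>r. (n\<^sub>1 (w' r))\<^sup>2))"
    "(LINT t|?M. window_avg T h (\<lambda>r. (n\<^sub>1 (w' r))\<^sup>2) t) \<le> (LINT t|?M. (n\<^sub>1 (w' t))\<^sup>2)"
    by (rule window_avg_integral_le[OF w'D(3)]; use h in simp)+
  have E_int: "integrable ?M (E v)" if "v \<in> ?V" for v
    unfolding E_def[abs_def] using s(2) that by (intro window_avg_error_integrable g_int h) auto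
  \<comment> \<open>The Young terms arise twice, inside the window and at \<open>t\<close> itself.
    The value \<open>s t\<close> changes with \<open>t\<close>, so its averaging error is bounded by
    the sum over the finitely many values of \<open>s\<close>.\<close>
  define bnd where "bnd t = e / 2 * window_avg T h (\<lambda>r. (n\<^sub>1 (w' r))\<^sup>2) t + e / 2 * (n\<^sub>1 (w' t))\<^sup>2
      + (1 / e) * (n\<^sub>2 (w t - s t))\<^sup>2 + (\<Sum>v\<in>?V. E v t)" for t
  have bnd_int: "integrable ?M bnd"
    unfolding bnd_def[abs_def]
    by (intro Bochner_Integration.integrable_add integrable_mult_right Bochner_Integration.integrable_sum avg_sq w'D dD E_int)
  have pr_int: "integrable ?M (\<lambda>t. indicator {a..b} t * pr (w' t) (w t))"
    by (rule time_indicator_integrable[OF pairing_integrable[OF w' w]])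
  have "AE t in ?M. \<bar>indicator {a..b} t * (P t / (2 * h)) - indicator {a..b} t * pr (w' t) (w t)\<bar> \<le> bnd t"
    using P(2) w'D(1) wD(1) AE_space
  proof eventually_elim
    case (elim t)
    have mem: "s t \<in> S\<^sub>2" "w t - s t \<in> S\<^sub>2" "s t \<in> ?V" using s(2) elim(3,4) B.diff_mem by auto
    have d_int: "integrable ?M (\<lambda>r. pr (w' r) (w t - s t))"
      by (rule pairing_integrable[OF w' B.const_bochner_L2[OF mem(2)]])
    have E_nonneg: "0 \<le> E v t" for v by (simp add: E_def)
    have wa_nonneg: "0 \<le> window_avg T h (\<lambda>r. (n\<^sub>1 (w' r))\<^sup>2) t"
      unfolding window_avg_def using h by (intro mult_nonneg_nonneg integral_nonneg_AE) auto
    show ?case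
    proof (cases "t \<in> {a..b}")
      case True
      have "P t = (LINT r|?M. windowed h t (\<lambda>r. 1 * pr (w' r) (w t - s t) + 1 * g (s t) r) r)"
        using P(1) elim(1) True
      proof -
        have "(LINT r|?M. windowed h t (\<lambda>r. pr (w' r) (w t)) r)
          = (LINT r|?M. windowed h t (\<lambda>r. 1 * pr (w' r) (w t - s t) + 1 * g (s t) r) r)"
        proof (rule integral_cong_AE)
          show "(\<lambda>r. windowed h t (\<lambda>r. pr (w' r) (w t)) r) \<in> borel_measurable ?M"
            using window_integrable[OF pairing_integrable[OF w' B.const_bochner_L2[OF elim(3)]]] by auto
          have "integrable ?M (\<lambda>r. 1 * pr (w' r) (w t - s t) + 1 * g (s t) r)"
            using d_int g_int[OF mem(1)] by simp
          from window_integrable[OF this]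
          show "(\<lambda>r. windowed h t (\<lambda>r. 1 * pr (w' r) (w t - s t) + 1 * g (s t) r) r) \<in> borel_measurable ?M"
            by auto
          show "AE r in ?M. windowed h t (\<lambda>r. pr (w' r) (w t)) r
              = (windowed h t (\<lambda>r. 1 * pr (w' r) (w t - s t) + 1 * g (s t) r) r)"
            using w'D(1)
          proof eventually_elim
            case (elim r)
            show ?case using pr_diff_right[OF elim \<open>w t \<in> S\<^sub>2\<close> mem(1)] by (simp add: g_def)
          qed
        qed
        then show ?thesis using elim(1) True by simp
      qed
      then have "P t / (2 * h) = 1 / (2 * h) * (LINT r|?M. windowed h t (\<lambda>r. 1 * pr (w' r) (w t - s t) + 1 * g (s t) r) r)"
        by (simp only: mult_1 times_divide_eq_left)
      also have "\<dots> = window_avg T h (\<lambda>r. 1 * pr (w' r) (w t - s t) + 1 * g (s t) r) t"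
        by (simp only: window_avg_def)
      also have "\<dots> = window_avg T h (\<lambda>r. pr (w' r) (w t - s t)) t + window_avg T h (g (s t)) t"
        using window_avg_lincomb[OF d_int g_int[OF mem(1)], of h 1 1 t] by simp
      finally have P_eq: "P t / (2 * h) = window_avg T h (\<lambda>r. pr (w' r) (w t - s t)) t + window_avg T h (g (s t)) t" .
      have "\<bar>window_avg T h (\<lambda>r. pr (w' r) (w t - s t)) t\<bar> \<le> window_avg T h (\<lambda>r. \<bar>pr (w' r) (w t - s t)\<bar>) t"
        by (rule window_avg_abs_le[OF d_int h])
      also have "\<dots> \<le> window_avg T h (\<lambda>r. e / 2 * (n\<^sub>1 (w' r))\<^sup>2 + 1 * ((n\<^sub>2 (w t - s t))\<^sup>2 / (2 * e))) t"
      proof (rule window_avg_mono)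
        show "AE r in ?M. t - h < r \<and> r \<le> t + h \<longrightarrow> \<bar>pr (w' r) (w t - s t)\<bar> \<le> e / 2 * (n\<^sub>1 (w' r))\<^sup>2 + 1 * ((n\<^sub>2 (w t - s t))\<^sup>2 / (2 * e))"
          using w'D(1)
        proof eventually_elim
          case (elim r)
          show ?case using pr_bound[OF elim mem(2)] mult_le_scaled_squares[OF e, of "n\<^sub>1 (w' r)" "n\<^sub>2 (w t - s t)"] by simp
        qed
      qed (use d_int w'D(3) h in auto)
      also have "\<dots> = e / 2 * window_avg T h (\<lambda>r. (n\<^sub>1 (w' r))\<^sup>2) t + 1 * window_avg T h (\<lambda>_. (n\<^sub>2 (w t - s t))\<^sup>2 / (2 * e)) t"
        using w'D(3) by (intro window_avg_lincomb) auto
      also have "\<dots> \<le> e / 2 * window_avg T h (\<lambda>r. (n\<^sub>1 (w' r))\<^sup>2) t + (n\<^sub>2 (w t - s t))\<^sup>2 / (2 * e)"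
        using window_avg_const_le[OF h, of "(n\<^sub>2 (w t - s t))\<^sup>2 / (2 * e)" T t] e by simp
      finally have 1: "\<bar>window_avg T h (\<lambda>r. pr (w' r) (w t - s t)) t\<bar>
          \<le> e / 2 * window_avg T h (\<lambda>r. (n\<^sub>1 (w' r))\<^sup>2) t + (n\<^sub>2 (w t - s t))\<^sup>2 / (2 * e)" .
      have 2: "\<bar>window_avg T h (g (s t)) t - g (s t) t\<bar> \<le> (\<Sum>v\<in>?V. E v t)"
        using member_le_sum[OF mem(3) _ finV, of "\<lambda>v. E v t"] E_nonneg True by (simp add: E_def)
      have 3: "\<bar>pr (w' t) (w t) - g (s t) t\<bar> \<le> e / 2 * (n\<^sub>1 (w' t))\<^sup>2 + (n\<^sub>2 (w t - s t))\<^sup>2 / (2 * e)"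
        using pr_diff_right[OF elim(2,3) mem(1)] pr_bound[OF elim(2) mem(2)]
          mult_le_scaled_squares[OF e, of "n\<^sub>1 (w' t)" "n\<^sub>2 (w t - s t)"] by (simp add: g_def)
      have half: "(n\<^sub>2 (w t - s t))\<^sup>2 / (2 * e) + (n\<^sub>2 (w t - s t))\<^sup>2 / (2 * e) = (1 / e) * (n\<^sub>2 (w t - s t))\<^sup>2"
        using e by (simp add: field_simps)
      have "\<bar>P t / (2 * h) - pr (w' t) (w t)\<bar> \<le> bnd t"
        using 1 2 3 half unfolding bnd_def P_eq by linarith
      then show ?thesis using True by simp
    next
      case False
      then show ?thesis
        using wa_nonneg E_nonneg e unfolding bnd_def by (auto intro!: add_nonneg_nonneg sum_nonneg)
    qed
  qed
  then have "AE t in ?M. norm (indicator {a..b} t * (P t / (2 * h)) - indicator {a..b} t * pr (w' t) (w t)) \<le> bnd t"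
    by simp
  moreover have Ph: "integrable ?M (\<lambda>t. indicator {a..b} t * (P t / (2 * h)))"
    using integrable_divide_zero[of "2 * h", OF P(1)] by simp
  ultimately have "norm (LINT t|?M. indicator {a..b} t * (P t / (2 * h)) - indicator {a..b} t * pr (w' t) (w t)) \<le> (LINT t|?M. bnd t)"
    using bnd_int
    by (intro order_trans[OF integral_norm_bound] integral_mono_AE integrable_norm
        Bochner_Integration.integrable_diff pr_int)
  moreover have "(LINT t|?M. bnd t) = e / 2 * (LINT t|?M. window_avg T h (\<lambda>r. (n\<^sub>1 (w' r))\<^sup>2) t)
      + e / 2 * (LINT t|?M. (n\<^sub>1 (w' t))\<^sup>2) + (1 / e) * (LINT t|?M. (n\<^sub>2 (w t - s t))\<^sup>2)
      + (\<Sum>v\<in>?V. LINT t|?M. E v t)"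
    unfolding bnd_def using avg_sq(1) w'D(3) dD(3) E_int
    by (simp add: Bochner_Integration.integral_sum)
  moreover have "e / 2 * (LINT t|?M. window_avg T h (\<lambda>r. (n\<^sub>1 (w' r))\<^sup>2) t) \<le> e / 2 * (LINT t|?M. (n\<^sub>1 (w' t))\<^sup>2)"
    using avg_sq(2) e by (intro mult_left_mono) auto
  moreover have "(LINT t|?M. indicator {a..b} t * (P t / (2 * h)) - indicator {a..b} t * pr (w' t) (w t))
      = (LINT t|?M. indicator {a..b} t * (P t / (2 * h))) - (LINT t|?M. indicator {a..b} t * pr (w' t) (w t))"
    using Ph pr_int by (rule Bochner_Integration.integral_diff)
  moreover have "e / 2 * (LINT t|?M. (n\<^sub>1 (w' t))\<^sup>2) + e / 2 * (LINT t|?M. (n\<^sub>1 (w' t))\<^sup>2) = e * (LINT t|?M. (n\<^sub>1 (w' t))\<^sup>2)"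
    by (simp add: field_simps)
  moreover have "(1 / e) * (LINT t|?M. (n\<^sub>2 (w t - s t))\<^sup>2) = (LINT t|?M. (n\<^sub>2 (w t - s t))\<^sup>2) / e" by simp
  ultimately have "\<bar>(LINT t|?M. indicator {a..b} t * (P t / (2 * h))) - (LINT t|?M. indicator {a..b} t * pr (w' t) (w t))\<bar>
      \<le> e * (LINT t|?M. (n\<^sub>1 (w' t))\<^sup>2) + (LINT t|?M. (n\<^sub>2 (w t - s t))\<^sup>2) / e + (\<Sum>v\<in>?V. LINT t|?M. E v t)"
    unfolding real_norm_def by linarith
  then show ?thesis by (simp only: E_def g_def[abs_def])
qed

text \<open>The window integral has \<open>w t\<close> as a varying second argument, so it is
  represented by a function \<open>P n\<close> whose integrability is a hypothesis; in the
  application it comes from continuity of inner products in time. In the estimate \<open>e\<close>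
  is fixed first, then the simple function, then the index.\<close>

lemma pairing_window_limit:
  assumes w': "w' \<in> bochner_L2 (time_measure T) S\<^sub>1 n\<^sub>1" and w: "w \<in> bochner_L2 (time_measure T) S\<^sub>2 n\<^sub>2"
    and ab: "0 < a" "b < T" "0 < T"
    and h: "h \<longlonglongrightarrow> 0" "\<And>n. 0 < h n" "\<And>n. h n \<le> a" "\<And>n. h n < T - b"
    and P: "\<And>n. integrable (time_measure T) (\<lambda>t. indicator {a..b} t * P n t)"
      "\<And>n. AE t in time_measure T. t \<in> {a..b} \<longrightarrow>
        P n t = (LINT r|time_measure T. windowed (h n) t (\<lambda>r. pr (w' r) (w t)) r)"
  shows "(\<lambda>n. LINT t|time_measure T. indicator {a..b} t * (P n t / (2 * h n)))
    \<longlonglongrightarrow> (LINT t|time_measure T. indicator {a..b} t * pr (w' t) (w t))"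
proof (rule LIMSEQ_I)
  let ?M = "time_measure T"
  fix r :: real assume "0 < r"
  define N where "N = (LINT t|?M. (n\<^sub>1 (w' t))\<^sup>2)"
  have "0 \<le> N" unfolding N_def by (intro integral_nonneg_AE) auto
  \<comment> \<open>The denominator contains \<open>N + 1\<close> because \<open>N\<close> may be
    0.\<close>
  define e where "e = r / (3 * (N + 1))"
  have e: "0 < e" "e * N < r / 3" using \<open>0 < r\<close> \<open>0 \<le> N\<close> by (auto simp: e_def field_simps)
  obtain s where s: "\<And>n. simple_function ?M (s n)" "\<And>n t. t \<in> space ?M \<Longrightarrow> s n t \<in> S\<^sub>2"
    "\<And>n. (\<lambda>t. w t - s n t) \<in> bochner_L2 ?M S\<^sub>2 n\<^sub>2"
    "(\<lambda>n. LINT t|?M. (n\<^sub>2 (w t - s n t))\<^sup>2) \<longlonglongrightarrow> 0"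
    by (rule B.bochner_L2_simple_approx[OF w]) (rule that)
  \<comment> \<open>The threshold carries a factor \<open>e\<close> since this error enters the
    estimate divided by \<open>e\<close>.\<close>
  obtain k where k: "(LINT t|?M. (n\<^sub>2 (w t - s k t))\<^sup>2) < e * r / 3"
    using order_tendstoD(2)[OF s(4), of "e * r / 3"] e(1) \<open>0 < r\<close> by (auto simp: eventually_sequentially)
  let ?V = "s k ` space ?M"
  define Z where "Z n = (\<Sum>v\<in>?V. LINT t|?M. indicator {a..b} t * \<bar>window_avg T (h n) (\<lambda>r. pr (w' r) v) t - pr (w' t) v\<bar>)" for n
  have "Z \<longlonglongrightarrow> (\<Sum>v\<in>?V. 0)"
    unfolding Z_def
  proof (intro tendsto_sum window_avg_L1_limit ab h)
    fix v assume "v \<in> ?V"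
    then have "v \<in> S\<^sub>2" using s(2) by auto
    then show "integrable ?M (\<lambda>r. pr (w' r) v)" by (rule pairing_integrable[OF w' B.const_bochner_L2])
  qed
  then have "\<forall>\<^sub>F n in sequentially. Z n < r / 3"
    using order_tendstoD(2)[of Z 0 sequentially "r / 3"] \<open>0 < r\<close> by simp
  then obtain n0 where n0: "\<And>n. n0 \<le> n \<Longrightarrow> Z n < r / 3" by (auto simp: eventually_sequentially)
  have small: "(LINT t|?M. (n\<^sub>2 (w t - s k t))\<^sup>2) / e < r / 3" using k e(1) by (simp add: divide_less_eq mult.commute)
  have err: "\<bar>(LINT t|?M. indicator {a..b} t * (P n t / (2 * h n))) - (LINT t|?M. indicator {a..b} t * pr (w' t) (w t))\<bar>
      \<le> e * N + (LINT t|?M. (n\<^sub>2 (w t - s k t))\<^sup>2) / e + Z n" for n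
    unfolding Z_def N_def by (rule pairing_window_error[OF w' w s(1) s(2) h(2) e(1) P(1) P(2)])
  have "\<bar>(LINT t|?M. indicator {a..b} t * (P n t / (2 * h n))) - (LINT t|?M. indicator {a..b} t * pr (w' t) (w t))\<bar> < r"
    if "n0 \<le> n" for n
    using err[of n] small n0[OF that] e(2) by linarith
  then show "\<exists>no. \<forall>n\<ge>no. norm ((LINT t|?M. indicator {a..b} t * (P n t / (2 * h n))) - (LINT t|?M. indicator {a..b} t * pr (w' t) (w t))) < r"
    by auto
qed

end

subsection \<open>Integration by parts in time\<close>

lemma time_interval_continuous:
  fixes f :: "real \<Rightarrow> real"
  assumes f: "continuous_on {a..b} f" and ab: "0 < a" "b < T"
  shows "integrable (time_measure T) (\<lambda>t. indicator {a..b} t * f t)"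
    "(LINT t|time_measure T. indicator {a..b} t * f t) = integral {a..b} f"
proof -
  have eq: "indicator {0<..<T} t *\<^sub>R (indicator {a..b} t * f t) = indicator {a..b} t *\<^sub>R f t" for t
    using ab by (auto simp: indicator_def)
  have int: "integrable (lebesgue_on {a..b}) f" by (rule continuous_imp_integrable_real[OF f])
  then have "integrable lebesgue (\<lambda>t. indicator {a..b} t *\<^sub>R f t)"
    by (simp add: integrable_restrict_space)
  then show "integrable (time_measure T) (\<lambda>t. indicator {a..b} t * f t)"
    by (subst integrable_restrict_space) (simp_all only: eq, simp_all)
  have "(LINT t|time_measure T. indicator {a..b} t * f t) = (LINT t|lebesgue. indicator {a..b} t *\<^sub>R f t)"
    by (subst integral_restrict_space) (simp_all only: eq, simp_all)
  also have "\<dots> = (LINT t|lebesgue_on {a..b}. f t)" by (simp add: integral_restrict_space)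
  also have "\<dots> = integral {a..b} f" by (rule lebesgue_integral_eq_integral[OF int]) simp
  finally show "(LINT t|time_measure T. indicator {a..b} t * f t) = integral {a..b} f" .
qed

context bounded_domain
begin

section \<open>The concrete spaces, and continuity of inner products in time\<close>

lemma L2_norm_zero: "L2_norm D 0 = 0"
  by (simp add: L2_norm_def)

lemma bochner_space_L2: "bochner_space (L2_space D) (L2_norm D) (time_measure T)"
  by (intro bochner_space.intro finite_complete_measure_time seminormed_carrier.intro)
     (auto intro: L2_space_zero L2_space_diff L2_norm_nonneg L2_norm_diff_le simp: L2_norm_zero)

lemma bochner_space_V: "bochner_space (V_space D \<Gamma>) (V_norm D) (time_measure T)"
  by (intro bochner_space.intro finite_complete_measure_time seminormed_carrier.intro)
     (auto intro: V_zero V_diff V_norm_nonneg V_norm_diff_le V_norm_zero)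

lemma bochner_space_V_dual: "bochner_space (V_dual D \<Gamma>) (V_dual_norm D \<Gamma>) (time_measure T)"
  by (intro bochner_space.intro finite_complete_measure_time seminormed_carrier.intro)
     (auto intro: V_dual_zero V_dual_diff V_dual_norm_nonneg V_dual_norm_diff_le V_dual_norm_zero)

lemma time_pairing_V:
  "time_pairing (V_dual D \<Gamma>) (V_dual_norm D \<Gamma>) (V_space D \<Gamma>) (V_norm D) T (\<lambda>\<psi> v. \<psi> v)"
  by (intro time_pairing.intro bochner_pairing.intro bochner_space_V bochner_space_V_dual bochner_pairing_axioms.intro)
     (auto intro: V_dual_diff_arg V_dual_le)

lemma bochner_pairing_L2:
  "bochner_pairing (L2_space D) (L2_norm D) (L2_space D) (L2_norm D) (time_measure T) (L2_inner D)"
  by (intro bochner_pairing.intro bochner_space_L2 bochner_pairing_axioms.intro)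
     (auto intro: L2_inner_diff_left L2_inner_diff_right L2_Cauchy_Schwarz)

lemma C0_H_L2: "w \<in> C0_H T D \<Longrightarrow> t \<in> {0..T} \<Longrightarrow> w t \<in> L2_space D"
  by (simp add: C0_H_def)

lemma C0_H_tendsto:
  "w \<in> C0_H T D \<Longrightarrow> t \<in> {0..T} \<Longrightarrow> ((\<lambda>s. L2_norm D (w s - w t)) \<longlongrightarrow> 0) (at t within {0..T})"
  by (simp add: C0_H_def)

lemma C0_H_diff:
  assumes w: "w \<in> C0_H T D" and v: "v \<in> C0_H T D"
  shows "(\<lambda>t. w t - v t) \<in> C0_H T D"
  unfolding C0_H_def
proof (intro CollectI conjI ballI)
  fix t assume t: "t \<in> {0..T}"
  show "w t - v t \<in> L2_space D" by (intro L2_space_diff C0_H_L2[OF w] C0_H_L2[OF v] t)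
  show "((\<lambda>s. L2_norm D (w s - v s - (w t - v t))) \<longlongrightarrow> 0) (at t within {0..T})"
  proof (rule tendsto_sandwich[OF _ _ tendsto_const])
    show "((\<lambda>s. L2_norm D (w s - w t) + L2_norm D (v s - v t)) \<longlongrightarrow> 0) (at t within {0..T})"
      by (intro tendsto_add_zero C0_H_tendsto w v t)
    show "\<forall>\<^sub>F s in at t within {0..T}. L2_norm D (w s - v s - (w t - v t)) \<le> L2_norm D (w s - w t) + L2_norm D (v s - v t)"
      unfolding eventually_at_filter
    proof (rule always_eventually, intro allI impI)
      fix s assume s: "s \<in> {0..T}"
      have eq: "w s - v s - (w t - v t) = (w s - w t) - (v s - v t)" by simp
      show "L2_norm D (w s - v s - (w t - v t)) \<le> L2_norm D (w s - w t) + L2_norm D (v s - v t)"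
        unfolding eq by (intro L2_norm_diff_le L2_space_diff C0_H_L2[OF w] C0_H_L2[OF v] s t)
    qed
  qed (simp add: L2_norm_nonneg)
qed

lemma C0_H_inner_continuous:
  assumes w: "w \<in> C0_H T D" and v: "v \<in> C0_H T D"
  shows "continuous_on ({0..T} \<times> {0..T}) (\<lambda>(s, t). L2_inner D (w s) (v t))"
  unfolding continuous_on_def
proof
  fix z :: "real \<times> real" assume "z \<in> {0..T} \<times> {0..T}"
  then obtain s t where z: "z = (s, t)" and st: "s \<in> {0..T}" "t \<in> {0..T}" by auto
  let ?F = "at (s, t) within {0..T} \<times> {0..T}"
  have ev: "\<forall>\<^sub>F z in ?F. fst z \<in> {0..T} \<and> snd z \<in> {0..T}"
    unfolding eventually_at_filter by (rule always_eventually) auto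
  have lim: "((\<lambda>z. L2_norm D (u (p z) - u x)) \<longlongrightarrow> 0) ?F"
    if u: "u \<in> C0_H T D" and x: "x \<in> {0..T}" and p: "continuous ?F p" "p (s, t) = x" "p ` ({0..T} \<times> {0..T}) \<subseteq> {0..T}"
    for u x and p :: "real \<times> real \<Rightarrow> real"
  proof -
    have "continuous (at x within {0..T}) (\<lambda>s'. L2_norm D (u s' - u x))"
      using C0_H_tendsto[OF u x] by (simp add: continuous_within L2_norm_zero)
    then have "continuous (at (p (s, t)) within p ` ({0..T} \<times> {0..T})) (\<lambda>s'. L2_norm D (u s' - u x))"
      unfolding p(2) by (rule continuous_within_subset) (rule p(3))
    from continuous_within_compose[OF p(1) this]
    show ?thesis by (simp add: continuous_within L2_norm_zero comp_def p(2))
  qed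
  have lim1: "((\<lambda>z. L2_norm D (w (fst z) - w s)) \<longlongrightarrow> 0) ?F"
    by (rule lim[OF w st(1)]) (auto intro: continuous_fst continuous_ident)
  have lim2: "((\<lambda>z. L2_norm D (v (snd z) - v t)) \<longlongrightarrow> 0) ?F"
    by (rule lim[OF v st(2)]) (auto intro: continuous_snd continuous_ident)
  have "((\<lambda>z. L2_inner D (w (fst z)) (v (snd z)) - L2_inner D (w s) (v t)) \<longlongrightarrow> 0) ?F"
  proof (rule tendsto_0_le[where K=1])
    \<comment> \<open>One argument is changed at a time. The norm of \<open>v (snd z)\<close> is
      replaced by its triangle bound, so that only the two limits just shown are used.\<close>
    let ?b = "\<lambda>z. L2_norm D (w (fst z) - w s) * (L2_norm D (v (snd z) - v t) + L2_norm D (v t))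
        + L2_norm D (w s) * L2_norm D (v (snd z) - v t)"
    have "(?b \<longlongrightarrow> 0 * (0 + L2_norm D (v t)) + L2_norm D (w s) * 0) ?F"
      by (intro tendsto_intros lim1 lim2)
    then show "(?b \<longlongrightarrow> 0) ?F" by simp
    show "\<forall>\<^sub>F z in ?F. norm (L2_inner D (w (fst z)) (v (snd z)) - L2_inner D (w s) (v t)) \<le> norm (?b z) * 1"
      using ev
    proof eventually_elim
      case (elim z)
      note mem = C0_H_L2[OF w, of "fst z"] C0_H_L2[OF v, of "snd z"] C0_H_L2[OF w st(1)] C0_H_L2[OF v st(2)]
      let ?w = "w (fst z)" and ?v = "v (snd z)"
      have m: "?w \<in> L2_space D" "?v \<in> L2_space D" using mem elim by auto
      have "L2_inner D ?w ?v - L2_inner D (w s) (v t) = L2_inner D (?w - w s) ?v + L2_inner D (w s) (?v - v t)"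
        using m mem(3,4) by (simp add: L2_inner_diff_left L2_inner_diff_right)
      moreover have "\<bar>L2_inner D (?w - w s) ?v\<bar> \<le> L2_norm D (?w - w s) * L2_norm D ?v"
        by (intro L2_Cauchy_Schwarz L2_space_diff m mem(3))
      moreover have "L2_norm D ?v \<le> L2_norm D (?v - v t) + L2_norm D (v t)"
        using seminormed_carrier.nrm_le_diff_add[OF bochner_space.axioms(1)[OF bochner_space_L2] m(2) mem(4)] .
      then have "L2_norm D (?w - w s) * L2_norm D ?v \<le> L2_norm D (?w - w s) * (L2_norm D (?v - v t) + L2_norm D (v t))"
        by (intro mult_left_mono L2_norm_nonneg)
      moreover have "\<bar>L2_inner D (w s) (?v - v t)\<bar> \<le> L2_norm D (w s) * L2_norm D (?v - v t)"
        by (intro L2_Cauchy_Schwarz L2_space_diff m mem(3,4))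
      ultimately have "\<bar>L2_inner D ?w ?v - L2_inner D (w s) (v t)\<bar> \<le> ?b z" by linarith
      then show ?case by simp
    qed
  qed
  then have "((\<lambda>z. L2_inner D (w (fst z)) (v (snd z))) \<longlongrightarrow> L2_inner D (w s) (v t)) ?F"
    by (simp add: LIM_zero_iff)
  then show "((\<lambda>(s, t). L2_inner D (w s) (v t)) \<longlongrightarrow> (case z of (s, t) \<Rightarrow> L2_inner D (w s) (v t))) (at z within {0..T} \<times> {0..T})"
    unfolding z by (simp add: case_prod_unfold)
qed

lemma C0_H_inner_continuous_diag:
  assumes "w \<in> C0_H T D" "v \<in> C0_H T D"
  shows "continuous_on {0..T} (\<lambda>t. L2_inner D (w t) (v t))"
proof -
  have "continuous_on {0..T} ((\<lambda>(s, t). L2_inner D (w s) (v t)) \<circ> (\<lambda>t. (t, t)))"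
    by (rule continuous_on_compose[OF _ continuous_on_subset[OF C0_H_inner_continuous[OF assms]]])
       (auto intro!: continuous_intros)
  then show ?thesis by (simp add: comp_def)
qed

lemma C0_H_const: "v \<in> L2_space D \<Longrightarrow> (\<lambda>t. v) \<in> C0_H T D"
  by (auto simp: C0_H_def L2_norm_def)

text \<open>For fixed \<open>v\<close> the weak formulation is a statement about the scalar function
  \<open>L2_inner D (w t) v\<close>, which is continuous on the closed interval. Hence the formula
  holds at all interior times, and \<open>v\<close> may later depend on them.\<close>

lemma time_deriv_increment:
  assumes w: "w \<in> C0_H T D" and w': "w' \<in> L2_V_dual T D \<Gamma>" and d: "is_time_deriv T D \<Gamma> w w'"
    and v: "v \<in> V_space D \<Gamma>" and st: "0 < s" "s \<le> t" "t < T"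
  shows "L2_inner D (w t) v - L2_inner D (w s) v
    = (LINT r|time_measure T. (if s < r \<and> r \<le> t then w' r v else 0))"
proof (rule weak_derivative_integral[OF _ _ _ st])
  interpret time_pairing "V_dual D \<Gamma>" "V_dual_norm D \<Gamma>" "V_space D \<Gamma>" "V_norm D" T "\<lambda>\<psi> v. \<psi> v"
    by (rule time_pairing_V)
  show "integrable (time_measure T) (\<lambda>r. w' r v)"
    using pairing_integrable[OF _ B.const_bochner_L2[OF v]] w' by (simp add: L2_V_dual_def)
  show "continuous_on {0..T} (\<lambda>t. L2_inner D (w t) v)"
    by (rule C0_H_inner_continuous_diag[OF w C0_H_const[OF V_L2[OF v]]])
  show "(LINT t|time_measure T. deriv \<phi> t * L2_inner D (w t) v) = - (LINT t|time_measure T. \<phi> t * w' t v)"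
    if "\<phi> \<in> test_functions {0<..<T}" for \<phi>
    using d v that by (simp add: is_time_deriv_def)
qed

text \<open>Averaging \<open>\<langle>w(t + h) - w(t - h), w(t)\<rangle>\<close> over \<open>t\<close> telescopes by the symmetry of the inner
  product, and only values of \<open>w\<close> at the single time \<open>t\<close> need to lie in \<open>V\<close>.\<close>

lemma integration_by_parts_interior:
  assumes w: "w \<in> C0_H T D" "w \<in> L2_V T D \<Gamma>" and w': "w' \<in> L2_V_dual T D \<Gamma>"
    and d: "is_time_deriv T D \<Gamma> w w'" and ab: "0 < a" "a \<le> b" "b < T"
  shows "(L2_norm D (w b))\<^sup>2 - (L2_norm D (w a))\<^sup>2
    = 2 * (LINT t|time_measure T. indicator {a..b} t * w' t (w t))"
proof -
  interpret time_pairing "V_dual D \<Gamma>" "V_dual_norm D \<Gamma>" "V_space D \<Gamma>" "V_norm D" T "\<lambda>\<psi> v. \<psi> v"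
    by (rule time_pairing_V)
  \<comment> \<open>Half of the distance from \<open>{a..b}\<close> to the end points 0 and
    \<open>T\<close>, so all windows around points of \<open>{a..b}\<close> stay strictly
    inside.\<close>
  define c where "c = min a (T - b) / 2"
  have c: "0 < c" "c < a" "c < T - b" using ab by (auto simp: c_def)
  define h where "h n = c / real (Suc n)" for n
  have h: "h \<longlonglongrightarrow> 0" "\<And>n. 0 < h n" "\<And>n. h n \<le> a" "\<And>n. h n < T - b" "\<And>n. h n < a"
  proof -
    show "h \<longlonglongrightarrow> 0" unfolding h_def using LIMSEQ_Suc[OF lim_const_over_n[of c]] by simp
    show "0 < h n" for n using c by (simp add: h_def)
    have "h n \<le> c" for n using c by (simp add: h_def divide_le_eq mult_le_cancel_left1)
    then have "h n < a" "h n < T - b" for n using c by (meson le_less_trans)+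
    then show "h n < a" "h n \<le> a" "h n < T - b" for n by (simp_all add: less_imp_le)
  qed
  define K where "K s t = L2_inner D (w s) (w t)" for s t
  have K_cont: "continuous_on ({0..T} \<times> {0..T}) (\<lambda>(s, t). K s t)"
    unfolding K_def by (rule C0_H_inner_continuous[OF w(1) w(1)])
  have K_sym: "K s t = K t s" for s t by (simp add: K_def L2_inner_commute)
  define P where "P n t = K (t + h n) t - K (t - h n) t" for n t
  have lim1: "(\<lambda>n. (1 / h n) * integral {a..b} (P n)) \<longlonglongrightarrow> K b b - K a a"
    unfolding P_def
    using symmetric_kernel_difference_quotient[OF K_cont K_sym ab h(1,2,3)] h(4) by (simp add: less_imp_le)
  have P_cont: "continuous_on {a..b} (P n)" for n
  proof -
    have diag: "continuous_on {a..b} (\<lambda>t. K (p t) t)" if "continuous_on {a..b} p" "p ` {a..b} \<subseteq> {0..T}" for p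
    proof -
      have "continuous_on {a..b} ((\<lambda>(s, t). K s t) \<circ> (\<lambda>t. (p t, t)))"
        by (rule continuous_on_compose[OF _ continuous_on_subset[OF K_cont]])
           (use that ab in \<open>auto intro!: continuous_intros\<close>)
      then show ?thesis by (simp add: comp_def)
    qed
    show ?thesis
      unfolding P_def using h(2-4)[of n] ab
      by (intro continuous_on_diff diag continuous_on_add continuous_on_id continuous_on_const) auto
  qed
  have lim2: "(\<lambda>n. LINT t|time_measure T. indicator {a..b} t * (P n t / (2 * h n)))
    \<longlonglongrightarrow> (LINT t|time_measure T. indicator {a..b} t * w' t (w t))"
  proof (rule pairing_window_limit[where w'=w' and w=w and h=h and P=P])
    show "w' \<in> bochner_L2 (time_measure T) (V_dual D \<Gamma>) (V_dual_norm D \<Gamma>)"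
      using w' by (simp add: L2_V_dual_def)
    show wL2: "w \<in> bochner_L2 (time_measure T) (V_space D \<Gamma>) (V_norm D)"
      using w(2) by (simp add: L2_V_def)
    show "integrable (time_measure T) (\<lambda>t. indicator {a..b} t * P n t)" for n
      by (rule time_interval_continuous(1)[OF P_cont ab(1,3)])
    show "AE t in time_measure T. t \<in> {a..b} \<longrightarrow>
        P n t = (LINT r|time_measure T. windowed (h n) t (\<lambda>r. w' r (w t)) r)" for n
      \<comment> \<open>Here \<open>w t\<close> is known to lie in V for almost every
        \<open>t\<close>, and it serves as the fixed test vector for the increment between
        \<open>t - h n\<close> and \<open>t + h n\<close>.\<close>
      using B.bochner_L2D(1)[OF wL2]
    proof eventually_elim
      case (elim t)
      show ?case
      proof
        assume t: "t \<in> {a..b}"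
        then have "0 < t - h n" "t - h n \<le> t + h n" "t + h n < T"
          using h(2)[of n] h(4)[of n] h(5)[of n] by auto
        from time_deriv_increment[OF w(1) w' d elim this]
        show "P n t = (LINT r|time_measure T. windowed (h n) t (\<lambda>r. w' r (w t)) r)"
          by (simp add: P_def K_def)
      qed
    qed
  qed (use ab h in auto)
  have eq: "(LINT t|time_measure T. indicator {a..b} t * (P n t / (2 * h n))) = (1 / h n) * integral {a..b} (P n) / 2" for n
  proof -
    have "(LINT t|time_measure T. indicator {a..b} t * (P n t / (2 * h n)))
        = (LINT t|time_measure T. (indicator {a..b} t * P n t) / (2 * h n))" by simp
    also have "\<dots> = (LINT t|time_measure T. indicator {a..b} t * P n t) / (2 * h n)"
      by (rule integral_divide_zero)
    also have "\<dots> = integral {a..b} (P n) / (2 * h n)"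
      by (simp only: time_interval_continuous(2)[OF P_cont ab(1,3)])
    also have "\<dots> = (1 / h n) * integral {a..b} (P n) / 2" by simp
    finally show ?thesis .
  qed
  \<comment> \<open>The windows have width \<open>2 * h n\<close>, whereas the telescoped integral
    is divided by \<open>h n\<close>: this is the origin of the factor 2.\<close>
  have "(\<lambda>n. (1 / h n) * integral {a..b} (P n) / 2) \<longlonglongrightarrow> (K b b - K a a) / 2"
    by (intro tendsto_divide lim1 tendsto_const) simp
  then have "(LINT t|time_measure T. indicator {a..b} t * w' t (w t)) = (K b b - K a a) / 2"
    by (rule LIMSEQ_unique[OF lim2[unfolded eq]])
  then show ?thesis by (simp add: K_def L2_norm_power2)
qed


text \<open>The interval grows to (0, T): the boundary terms converge by continuity of the L2 norm
  up to the end points, the integrals by dominated convergence with the integrable pairing.\<close>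

lemma integration_by_parts:
  assumes T: "0 < T" and w: "w \<in> C0_H T D" "w \<in> L2_V T D \<Gamma>" and w': "w' \<in> L2_V_dual T D \<Gamma>"
    and d: "is_time_deriv T D \<Gamma> w w'"
  shows "(L2_norm D (w T))\<^sup>2 - (L2_norm D (w 0))\<^sup>2 = 2 * (LINT t|time_measure T. w' t (w t))"
proof -
  let ?M = "time_measure T"
  interpret time_pairing "V_dual D \<Gamma>" "V_dual_norm D \<Gamma>" "V_space D \<Gamma>" "V_norm D" T "\<lambda>\<psi> v. \<psi> v"
    by (rule time_pairing_V)
  have int: "integrable ?M (\<lambda>t. w' t (w t))"
    using w' w(2) pairing_integrable[of w' w] by (simp add: L2_V_dual_def L2_V_def)
  have cont: "continuous_on {0..T} (\<lambda>t. (L2_norm D (w t))\<^sup>2)"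
    using C0_H_inner_continuous_diag[OF w(1) w(1)] by (simp add: L2_norm_power2)
  \<comment> \<open>The shift by 2 gives \<open>a n \<le> T / 2\<close>, so the interval from
    \<open>a n\<close> to \<open>T - a n\<close> is never empty.\<close>
  define a where "a n = T / real (n + 2)" for n
  have a: "a \<longlonglongrightarrow> 0" "\<And>n. 0 < a n" "\<And>n. a n \<le> T / 2"
  proof -
    show "a \<longlonglongrightarrow> 0" unfolding a_def using LIMSEQ_ignore_initial_segment[OF lim_const_over_n[of T], of 2] by simp
    show "0 < a n" "a n \<le> T / 2" for n using T by (auto simp: a_def field_simps)
  qed
  have le: "a n \<le> T - a n" "T - a n < T" "a n \<in> {0..T}" "T - a n \<in> {0..T}" for n
    using a(2)[of n] a(3)[of n] T by auto
  have eq: "(L2_norm D (w (T - a n)))\<^sup>2 - (L2_norm D (w (a n)))\<^sup>2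
      = 2 * (LINT t|?M. indicator {a n..T - a n} t * w' t (w t))" for n
    by (rule integration_by_parts_interior[OF w w' d a(2) le(1,2)])
  have "(\<lambda>n. T - a n) \<longlonglongrightarrow> T - 0" by (intro tendsto_intros a(1))
  then have "(\<lambda>n. (L2_norm D (w (T - a n)))\<^sup>2 - (L2_norm D (w (a n)))\<^sup>2)
      \<longlonglongrightarrow> (L2_norm D (w T))\<^sup>2 - (L2_norm D (w 0))\<^sup>2"
    using le T by (intro tendsto_diff continuous_on_tendsto_compose[OF cont] a(1)) (auto intro!: always_eventually)
  moreover have "(\<lambda>n. 2 * (LINT t|?M. indicator {a n..T - a n} t * w' t (w t))) \<longlonglongrightarrow> 2 * (LINT t|?M. w' t (w t))"
  proof (intro tendsto_mult tendsto_const integral_dominated_convergence[where w="\<lambda>t. \<bar>w' t (w t)\<bar>"])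
    show "(\<lambda>t. w' t (w t)) \<in> borel_measurable ?M" using int by auto
    show "(\<lambda>t. indicator {a n..T - a n} t * w' t (w t)) \<in> borel_measurable ?M" for n
      using time_indicator_integrable[OF int] by auto
    show "integrable ?M (\<lambda>t. \<bar>w' t (w t)\<bar>)" using int by simp
    show "AE t in ?M. norm (indicator {a n..T - a n} t * w' t (w t)) \<le> \<bar>w' t (w t)\<bar>" for n
      by (simp add: indicator_def)
    show "AE t in ?M. (\<lambda>n. indicator {a n..T - a n} t * w' t (w t)) \<longlonglongrightarrow> w' t (w t)"
      using AE_space
    proof eventually_elim
      case (elim t)
      then have "0 < min t (T - t)" by auto
      then have "\<forall>\<^sub>F n in sequentially. a n < min t (T - t)" using order_tendstoD(2)[OF a(1)] by blast
      then have "\<forall>\<^sub>F n in sequentially. indicator {a n..T - a n} t * w' t (w t) = w' t (w t)"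
        by eventually_elim auto
      then show ?case by (rule tendsto_eventually)
    qed
  qed
  ultimately show ?thesis unfolding eq by (rule LIMSEQ_unique)
qed

lemma time_deriv_mem: "w \<in> W_space T D \<Gamma> \<Longrightarrow> time_deriv T D \<Gamma> w \<in> L2_V_dual T D \<Gamma>"
  and is_time_deriv_time_deriv: "w \<in> W_space T D \<Gamma> \<Longrightarrow> is_time_deriv T D \<Gamma> w (time_deriv T D \<Gamma> w)"
proof -
  assume "w \<in> W_space T D \<Gamma>"
  then have "\<exists>w'. w' \<in> L2_V_dual T D \<Gamma> \<and> is_time_deriv T D \<Gamma> w w'" by (auto simp: W_space_def)
  from someI_ex[OF this]
  show "time_deriv T D \<Gamma> w \<in> L2_V_dual T D \<Gamma>" "is_time_deriv T D \<Gamma> w (time_deriv T D \<Gamma> w)"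
    by (auto simp: time_deriv_def)
qed

lemma test_functions_deriv_continuous:
  fixes \<phi> :: "real \<Rightarrow> real"
  assumes "\<phi> \<in> test_functions S"
  shows "continuous_on A (deriv \<phi>)"
proof -
  have "partial_deriv 1 \<phi> x = deriv \<phi> x" for x
  proof -
    have "(\<phi> has_real_derivative deriv \<phi> x) (at x)"
      using test_functions_differentiable[OF assms] DERIV_deriv_iff_real_differentiable by blast
    from partial_deriv_has_real_derivative[OF this] show ?thesis by simp
  qed
  then have "deriv \<phi> = partial_deriv 1 \<phi>" by auto
  moreover have "partial_deriv 1 \<phi> \<in> test_functions S" by (rule test_functions_partial_deriv[OF assms]) simp
  ultimately show ?thesis
    using test_functions_continuous continuous_on_subset subset_UNIV by metis
qed

text \<open>\<open>time_deriv\<close> is a choice, so nothing is claimed about its value at a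
  difference. \<open>integration_by_parts\<close> accepts any derivative in the dual space, and the
  difference of two chosen ones is such a derivative.\<close>

lemma is_time_deriv_diff:
  assumes w: "w \<in> C0_H T D" "w' \<in> L2_V_dual T D \<Gamma>" "is_time_deriv T D \<Gamma> w w'"
    and v: "v \<in> C0_H T D" "v' \<in> L2_V_dual T D \<Gamma>" "is_time_deriv T D \<Gamma> v v'"
  shows "is_time_deriv T D \<Gamma> (\<lambda>t. w t - v t) (\<lambda>t. w' t - v' t)"
  unfolding is_time_deriv_def
proof (intro ballI)
  interpret time_pairing "V_dual D \<Gamma>" "V_dual_norm D \<Gamma>" "V_space D \<Gamma>" "V_norm D" T "\<lambda>\<psi> v. \<psi> v"
    by (rule time_pairing_V)
  let ?M = "time_measure T"
  fix x \<phi> assume x: "x \<in> V_space D \<Gamma>" and \<phi>: "\<phi> \<in> test_functions {0<..<T}"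
  have int1: "integrable ?M (\<lambda>t. deriv \<phi> t * L2_inner D (u t) x)" if u: "u \<in> C0_H T D" for u
    by (intro time_continuous(1) continuous_on_mult test_functions_deriv_continuous[OF \<phi>]
        C0_H_inner_continuous_diag[OF u C0_H_const[OF V_L2[OF x]]])
  obtain B where B: "\<And>t. \<bar>\<phi> t\<bar> \<le> B" by (rule test_functions_bounded[OF \<phi>]) (rule that)
  have int2: "integrable ?M (\<lambda>t. \<phi> t * \<psi> t x)" if \<psi>: "\<psi> \<in> L2_V_dual T D \<Gamma>" for \<psi>
  proof (rule Bochner_Integration.integrable_bound)
    have i: "integrable ?M (\<lambda>t. \<psi> t x)"
      using pairing_integrable[OF _ B.const_bochner_L2[OF x], of \<psi>] \<psi> by (simp add: L2_V_dual_def)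
    then show "integrable ?M (\<lambda>t. B * \<bar>\<psi> t x\<bar>)" by simp
    show "(\<lambda>t. \<phi> t * \<psi> t x) \<in> borel_measurable ?M"
      using i test_functions_measurable_lebesgue_on[OF \<phi>] by (intro borel_measurable_times) auto
    have "\<bar>\<phi> t * \<psi> t x\<bar> \<le> B * \<bar>\<psi> t x\<bar>" for t unfolding abs_mult by (intro mult_right_mono B) simp
    then show "AE t in ?M. norm (\<phi> t * \<psi> t x) \<le> norm (B * \<bar>\<psi> t x\<bar>)" by (simp add: order_trans[OF _ abs_ge_self])
  qed
  have "(LINT t|?M. deriv \<phi> t * L2_inner D (w t - v t) x)
      = (LINT t|?M. deriv \<phi> t * L2_inner D (w t) x - deriv \<phi> t * L2_inner D (v t) x)"
    using C0_H_L2[OF w(1)] C0_H_L2[OF v(1)] V_L2[OF x]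
    by (intro Bochner_Integration.integral_cong) (auto simp: L2_inner_diff_left right_diff_distrib)
  also have "\<dots> = (LINT t|?M. deriv \<phi> t * L2_inner D (w t) x) - (LINT t|?M. deriv \<phi> t * L2_inner D (v t) x)"
    by (intro Bochner_Integration.integral_diff int1 w v)
  also have "\<dots> = - (LINT t|?M. \<phi> t * w' t x) - - (LINT t|?M. \<phi> t * v' t x)"
    using w(3) v(3) x \<phi> by (simp add: is_time_deriv_def)
  also have "\<dots> = - (LINT t|?M. \<phi> t * w' t x - \<phi> t * v' t x)"
    using int2[OF w(2)] int2[OF v(2)] by simp
  also have "\<dots> = - (LINT t|?M. \<phi> t * (w' t - v' t) x)" by (simp add: right_diff_distrib)
  finally show "(LINT t|?M. deriv \<phi> t * L2_inner D (w t - v t) x) = - (LINT t|?M. \<phi> t * (w' t - v' t) x)" .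
qed

section \<open>Gradients of Bochner functions and complementarity\<close>

lemma L2_norm_grad_diff:
  assumes "v \<in> V_space D \<Gamma>" "w \<in> V_space D \<Gamma>"
  shows "L2_norm D (grad D v - grad D w) = V_norm D (v - w)"
  unfolding V_norm_def
  using L2_norm_cong_AE[OF grad_diff[OF assms] L2_space_measurable[OF V_grad_L2[OF V_diff[OF assms]]]
      L2_space_measurable[OF L2_space_diff[OF V_grad_L2[OF assms(1)] V_grad_L2[OF assms(2)]]]] by simp

lemma L2_inner_grad_diff:
  assumes "y \<in> L2_space D" "v \<in> V_space D \<Gamma>" "w \<in> V_space D \<Gamma>"
  shows "L2_inner D y (grad D (v - w)) = L2_inner D y (grad D v) - L2_inner D y (grad D w)"
proof -
  have "L2_inner D y (grad D (v - w)) = L2_inner D y (grad D v - grad D w)"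
    by (rule L2_inner_cong_AE[OF AE_I2[OF refl] grad_diff[OF assms(2,3)]
          L2_space_measurable[OF assms(1)] L2_space_measurable[OF assms(1)]
          L2_space_measurable[OF V_grad_L2[OF V_diff[OF assms(2,3)]]]
          L2_space_measurable[OF L2_space_diff[OF V_grad_L2[OF assms(2)] V_grad_L2[OF assms(3)]]]])
  then show ?thesis using assms by (simp add: L2_inner_diff_right V_grad_L2)
qed

text \<open>The norm of V is the L2 norm of the gradient, so taking gradients of the simple
  approximants of \<open>u\<close> gives simple approximants of the gradient with the same
  error.\<close>

lemma grad_L2_Y:
  assumes u: "u \<in> L2_V T D \<Gamma>"
  shows "(\<lambda>t. grad D (u t)) \<in> L2_Y T D"
proof -
  let ?M = "time_measure T"
  interpret bochner_space "V_space D \<Gamma>" "V_norm D" ?M by (rule bochner_space_V)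
  have u': "u \<in> bochner_L2 ?M (V_space D \<Gamma>) (V_norm D)" using u by (simp add: L2_V_def)
  note uD = bochner_L2D[OF u']
  obtain s where s: "\<And>n. simple_function ?M (s n)" "\<And>n t. t \<in> space ?M \<Longrightarrow> s n t \<in> V_space D \<Gamma>"
    "AE t in ?M. (\<lambda>n. V_norm D (s n t - u t)) \<longlonglongrightarrow> 0"
    by (rule bochner_measurableE[OF uD(2)]) (rule that)
  have "AE t in ?M. (\<lambda>n. L2_norm D (grad D (s n t) - grad D (u t))) \<longlonglongrightarrow> 0"
    using s(3) uD(1) AE_space
  proof eventually_elim
    case (elim t)
    show ?case using elim(1) by (simp only: L2_norm_grad_diff[OF s(2)[OF elim(3)] elim(2)])
  qed
  moreover have "simple_function ?M (\<lambda>t. grad D (s n t))" for n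
    by (rule simple_function_compose1[OF s(1)])
  ultimately have "bochner_measurable ?M (L2_space D) (L2_norm D) (\<lambda>t. grad D (u t))"
    unfolding bochner_measurable_def using s(2) V_grad_L2
    by (intro exI[of _ "\<lambda>n t. grad D (s n t)"]) blast
  moreover have "AE t in ?M. grad D (u t) \<in> L2_space D"
    using uD(1) by eventually_elim (rule V_grad_L2)
  ultimately show ?thesis
    using uD(3) by (simp add: L2_Y_def bochner_L2_def V_norm_def)
qed

lemma Q_norm_power2: "(Q_norm T D y)\<^sup>2 = (LINT t|time_measure T. (L2_norm D (y t))\<^sup>2)"
  unfolding Q_norm_def by (intro real_sqrt_pow2 integral_nonneg_AE) auto

text \<open>Both \<open>\<zeta>\<close> and its reflection \<open>2u - \<zeta>\<close> are admissible competitors.\<close>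

lemma normal_cone_complementarity:
  assumes \<nu>: "\<nu> \<in> normal_cone D \<Gamma> (constraint_set D \<Gamma> \<zeta> t) u" and \<zeta>: "\<zeta> t \<in> V_space D \<Gamma>"
  shows "\<nu> (u - \<zeta> t) = 0" "\<nu> \<in> V_dual D \<Gamma>" "u \<in> V_space D \<Gamma>"
proof -
  let ?K = "constraint_set D \<Gamma> \<zeta> t"
  have u: "u \<in> ?K" and "\<nu> \<in> V_dual D \<Gamma>"
    and ineq: "\<And>w. w \<in> V_space D \<Gamma> \<Longrightarrow> indicator_functional ?K u + ereal (\<nu> (w - u)) \<le> indicator_functional ?K w"
    using \<nu> by (auto simp: normal_cone_def subdifferential_def indicator_functional_def split: if_splits)
  then show \<nu>': "\<nu> \<in> V_dual D \<Gamma>" and uV: "u \<in> V_space D \<Gamma>" by (auto simp: constraint_set_def)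
  have neg: "\<nu> w - \<nu> u \<le> 0" if w: "w \<in> ?K" for w
  proof -
    have wV: "w \<in> V_space D \<Gamma>" using w by (simp add: constraint_set_def)
    show ?thesis using ineq[OF wV] w u V_dual_diff_arg[OF \<nu>' wV uV]
      by (simp add: indicator_functional_def)
  qed
  have K\<zeta>: "\<zeta> t \<in> ?K" using \<zeta> by (simp add: constraint_set_def)
  let ?r = "\<lambda>x. 2 * u x + (- 1) * \<zeta> t x"
  have "AE x in lebesgue_on D. u x \<ge> \<zeta> t x" using u by (simp add: constraint_set_def)
  then have "AE x in lebesgue_on D. ?r x \<ge> \<zeta> t x" by eventually_elim simp
  then have Kr: "?r \<in> ?K" using V_lincomb[OF uV \<zeta>, of 2 "-1"] unfolding constraint_set_def by blast
  \<comment> \<open>The competitor \<open>\<zeta> t\<close> gives one sign of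
    \<open>\<nu> (u - \<zeta> t)\<close>; by linearity the reflected one gives the other.\<close>
  have "\<nu> ?r = 2 * \<nu> u - \<nu> (\<zeta> t)" using V_dual_lincomb[OF \<nu>' uV \<zeta>, of 2 "-1"] by simp
  then show "\<nu> (u - \<zeta> t) = 0"
    using neg[OF K\<zeta>] neg[OF Kr] V_dual_diff_arg[OF \<nu>' uV \<zeta>] by simp
qed

end

subsection \<open>The a posteriori identity\<close>

theorem lemma5p11:
  fixes \<Omega> \<Gamma>\<^sub>D \<Gamma>\<^sub>N :: "'a::euclidean_space set"
    and T :: real
    and \<zeta> u lam :: "real \<Rightarrow> 'a \<Rightarrow> real"
    and u\<^sub>0 :: "'a \<Rightarrow> real"
    and y z :: "real \<Rightarrow> 'a \<Rightarrow> 'a"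
    and f \<eta> \<Lambda> :: "real \<Rightarrow> ('a \<Rightarrow> real) \<Rightarrow> real"
  assumes "bounded \<Omega>" "lipschitz_domain \<Omega>" "boundary_partition \<Omega> \<Gamma>\<^sub>D \<Gamma>\<^sub>N"
    and "0 < T"
    and "\<zeta> \<in> L2_V T \<Omega> \<Gamma>\<^sub>D \<inter> C0_H T \<Omega>"
    and "f \<in> L2_V_dual T \<Omega> \<Gamma>\<^sub>D"
    and "u\<^sub>0 \<in> constraint_set \<Omega> \<Gamma>\<^sub>D \<zeta> 0"
    and "obstacle_solution T \<Omega> \<Gamma>\<^sub>D \<zeta> f u\<^sub>0 u"
    and z_def: "z = (\<lambda>t. grad \<Omega> (u t))"
    and Lambda_def: "\<Lambda> = (\<lambda>t. f t - time_deriv T \<Omega> \<Gamma>\<^sub>D u t - grad_adjoint \<Omega> (z t))"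
    and "y \<in> L2_Y T \<Omega>"
    and "lam \<in> W_space T \<Omega> \<Gamma>\<^sub>D"
    and "\<eta> \<in> L2_V_dual T \<Omega> \<Gamma>\<^sub>D"
    and "AE t in time_measure T. lam t \<in> constraint_set \<Omega> \<Gamma>\<^sub>D \<zeta> t"
    and "I_conj T \<Omega> \<Gamma>\<^sub>D \<zeta> \<eta> < \<infinity>"
    and "AE t in time_measure T. V_dual_eq \<Omega> \<Gamma>\<^sub>D (weak_div \<Omega> (y t))
           (\<lambda>v. time_deriv T \<Omega> \<Gamma>\<^sub>D lam t v + \<eta> t v - f t v)"
  shows "1/2 * (Q_norm T \<Omega> (\<lambda>t. y t - z t))\<^sup>2
       + 1/2 * (Q_norm T \<Omega> (\<lambda>t. grad \<Omega> (lam t - u t)))\<^sup>2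
       + 1/2 * (L2_norm \<Omega> (lam T - u T))\<^sup>2
       + pairing T (\<lambda>t. - \<eta> t) (\<lambda>t. u t - \<zeta> t)
       + pairing T (\<lambda>t. - \<Lambda> t) (\<lambda>t. lam t - \<zeta> t)
     = 1/2 * (Q_norm T \<Omega> (\<lambda>t. y t - grad \<Omega> (lam t)))\<^sup>2
       + pairing T (\<lambda>t. - \<eta> t) (\<lambda>t. lam t - \<zeta> t)
       + 1/2 * (L2_norm \<Omega> (lam 0 - u\<^sub>0))\<^sup>2"
proof -
  interpret bounded_domain \<Omega> using assms(1,2) by unfold_locales (auto simp: lipschitz_domain_def)
  interpret time_pairing "V_dual \<Omega> \<Gamma>\<^sub>D" "V_dual_norm \<Omega> \<Gamma>\<^sub>D" "V_space \<Omega> \<Gamma>\<^sub>D" "V_norm \<Omega>" T "\<lambda>\<psi> v. \<psi> v"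
    by (rule time_pairing_V)
  interpret Y: bochner_pairing "L2_space \<Omega>" "L2_norm \<Omega>" "L2_space \<Omega>" "L2_norm \<Omega>" "time_measure T" "L2_inner \<Omega>"
    by (rule bochner_pairing_L2)
  let ?M = "time_measure T"
  define lam' where "lam' = time_deriv T \<Omega> \<Gamma>\<^sub>D lam"
  define u' where "u' = time_deriv T \<Omega> \<Gamma>\<^sub>D u"
  have uW: "u \<in> W_space T \<Omega> \<Gamma>\<^sub>D" and u0: "AE x in lebesgue_on \<Omega>. u 0 x = u\<^sub>0 x"
    and sol: "AE t in ?M. \<exists>\<nu>\<in>normal_cone \<Omega> \<Gamma>\<^sub>D (constraint_set \<Omega> \<Gamma>\<^sub>D \<zeta> t) (u t).
        V_dual_eq \<Omega> \<Gamma>\<^sub>D (f t) (\<lambda>v. u' t v + grad_adjoint \<Omega> (grad \<Omega> (u t)) v + \<nu> v)"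
    using assms(8) by (auto simp: obstacle_solution_def u'_def)
  have uC: "u \<in> C0_H T \<Omega>" and lamC: "lam \<in> C0_H T \<Omega>"
    using uW assms(12) by (auto simp: W_space_def)
  have uL: "u \<in> bochner_L2 ?M (V_space \<Omega> \<Gamma>\<^sub>D) (V_norm \<Omega>)"
    and lamL: "lam \<in> bochner_L2 ?M (V_space \<Omega> \<Gamma>\<^sub>D) (V_norm \<Omega>)"
    and \<zeta>L: "\<zeta> \<in> bochner_L2 ?M (V_space \<Omega> \<Gamma>\<^sub>D) (V_norm \<Omega>)"
    using uW assms(5,12) by (auto simp: W_space_def L2_V_def)
  have fL: "f \<in> bochner_L2 ?M (V_dual \<Omega> \<Gamma>\<^sub>D) (V_dual_norm \<Omega> \<Gamma>\<^sub>D)"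
    and \<eta>L: "\<eta> \<in> bochner_L2 ?M (V_dual \<Omega> \<Gamma>\<^sub>D) (V_dual_norm \<Omega> \<Gamma>\<^sub>D)"
    and u'L: "u' \<in> bochner_L2 ?M (V_dual \<Omega> \<Gamma>\<^sub>D) (V_dual_norm \<Omega> \<Gamma>\<^sub>D)"
    and lam'L: "lam' \<in> bochner_L2 ?M (V_dual \<Omega> \<Gamma>\<^sub>D) (V_dual_norm \<Omega> \<Gamma>\<^sub>D)"
    using assms(6,13) time_deriv_mem[OF uW] time_deriv_mem[OF assms(12)]
    by (simp_all add: L2_V_dual_def u'_def lam'_def)
  have yL: "y \<in> bochner_L2 ?M (L2_space \<Omega>) (L2_norm \<Omega>)" using assms(11) by (simp add: L2_Y_def)
  have gradL: "(\<lambda>t. grad \<Omega> (v t)) \<in> bochner_L2 ?M (L2_space \<Omega>) (L2_norm \<Omega>)"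
    if "v \<in> bochner_L2 ?M (V_space \<Omega> \<Gamma>\<^sub>D) (V_norm \<Omega>)" for v
    using grad_L2_Y[of v T \<Gamma>\<^sub>D] that by (simp add: L2_V_def L2_Y_def)
  have zL: "z \<in> bochner_L2 ?M (L2_space \<Omega>) (L2_norm \<Omega>)" unfolding z_def by (rule gradL[OF uL])
  have wL: "(\<lambda>t. lam t - u t) \<in> bochner_L2 ?M (V_space \<Omega> \<Gamma>\<^sub>D) (V_norm \<Omega>)"
    by (rule B.bochner_L2_diff[OF lamL uL])
  have w'L: "(\<lambda>t. lam' t - u' t) \<in> bochner_L2 ?M (V_dual \<Omega> \<Gamma>\<^sub>D) (V_dual_norm \<Omega> \<Gamma>\<^sub>D)"
    by (rule A.bochner_L2_diff[OF lam'L u'L])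
  have parts: "(L2_norm \<Omega> (lam T - u T))\<^sup>2 - (L2_norm \<Omega> (lam 0 - u 0))\<^sup>2
      = 2 * (LINT t|?M. (lam' t - u' t) (lam t - u t))"
  proof (rule integration_by_parts[OF assms(4), where w="\<lambda>t. lam t - u t" and w'="\<lambda>t. lam' t - u' t"])
    show "(\<lambda>t. lam t - u t) \<in> C0_H T \<Omega>" by (rule C0_H_diff[OF lamC uC])
    show "(\<lambda>t. lam t - u t) \<in> L2_V T \<Omega> \<Gamma>\<^sub>D" using wL by (simp add: L2_V_def)
    show "(\<lambda>t. lam' t - u' t) \<in> L2_V_dual T \<Omega> \<Gamma>\<^sub>D" using w'L by (simp add: L2_V_dual_def)
    show "is_time_deriv T \<Omega> \<Gamma>\<^sub>D (\<lambda>t. lam t - u t) (\<lambda>t. lam' t - u' t)"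
      unfolding lam'_def u'_def
      by (intro is_time_deriv_diff lamC uC time_deriv_mem is_time_deriv_time_deriv uW assms(12))
  qed
  \<comment> \<open>The initial condition holds only almost everywhere, so \<open>u 0\<close> and
    \<open>u\<^sub>0\<close> are different representatives.\<close>
  have init: "L2_norm \<Omega> (lam 0 - u\<^sub>0) = L2_norm \<Omega> (lam 0 - u 0)"
  proof (rule L2_norm_cong_AE)
    show "AE x in lebesgue_on \<Omega>. (lam 0 - u\<^sub>0) x = (lam 0 - u 0) x" using u0 by eventually_elim simp
    have "u\<^sub>0 \<in> L2_space \<Omega>" using assms(7) V_L2 by (auto simp: constraint_set_def)
    then show "lam 0 - u\<^sub>0 \<in> borel_measurable (lebesgue_on \<Omega>)" "lam 0 - u 0 \<in> borel_measurable (lebesgue_on \<Omega>)"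
      using C0_H_L2[OF lamC, of 0] C0_H_L2[OF uC, of 0] assms(4)
      by (auto intro!: L2_space_measurable L2_space_diff)
  qed
  \<comment> \<open>Densities in time of the two sides. The pairing with
    \<open>lam' t - u' t\<close> stands for the boundary terms at 0 and \<open>T\<close>, which
    \<open>parts\<close> restores after integration.\<close>
  let ?A = "\<lambda>t. 1/2 * (L2_norm \<Omega> (y t - z t))\<^sup>2 + 1/2 * (L2_norm \<Omega> (grad \<Omega> (lam t - u t)))\<^sup>2
        + (lam' t - u' t) (lam t - u t) + (- \<eta> t) (u t - \<zeta> t) + (- \<Lambda> t) (lam t - \<zeta> t)"
  let ?B = "\<lambda>t. 1/2 * (L2_norm \<Omega> (y t - grad \<Omega> (lam t)))\<^sup>2 + (- \<eta> t) (lam t - \<zeta> t)"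
  have pointwise: "AE t in ?M. ?A t = ?B t"
    using sol assms(16) B.bochner_L2D(1)[OF uL] B.bochner_L2D(1)[OF lamL] B.bochner_L2D(1)[OF \<zeta>L]
      A.bochner_L2D(1)[OF fL] A.bochner_L2D(1)[OF \<eta>L] A.bochner_L2D(1)[OF u'L] A.bochner_L2D(1)[OF lam'L]
      Y.A.bochner_L2D(1)[OF yL]
  proof eventually_elim
    case (elim t)
    note V = elim(3-5) and D = elim(6-9) and y = elim(10)
    obtain \<nu> where \<nu>: "\<nu> \<in> normal_cone \<Omega> \<Gamma>\<^sub>D (constraint_set \<Omega> \<Gamma>\<^sub>D \<zeta> t) (u t)"
      "V_dual_eq \<Omega> \<Gamma>\<^sub>D (f t) (\<lambda>v. u' t v + grad_adjoint \<Omega> (grad \<Omega> (u t)) v + \<nu> v)"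
      using elim(1) by blast
    note compl = normal_cone_complementarity[OF \<nu>(1) V(3)]
    \<comment> \<open>The inclusion provides some element of the normal cone depending on
      \<open>t\<close>; on V it agrees with the residual \<open>\<Lambda> t\<close>.\<close>
    have \<Lambda>: "\<Lambda> t v = \<nu> v" if "v \<in> V_space \<Omega> \<Gamma>\<^sub>D" for v
      using \<nu>(2) that by (simp add: Lambda_def V_dual_eq_def z_def u'_def)
    let ?w = "lam t - u t" and ?g = "grad \<Omega> (lam t - u t)"
    have wV: "?w \<in> V_space \<Omega> \<Gamma>\<^sub>D" by (rule V_diff[OF V(2,1)])
    note G = V_grad_L2[OF V(1)] V_grad_L2[OF V(2)] V_grad_L2[OF wV]
    have eq: "- L2_inner \<Omega> (y t) ?g = lam' t ?w + \<eta> t ?w - f t ?w"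
      using elim(2) wV by (simp add: V_dual_eq_def weak_div_def grad_adjoint_def lam'_def)
    have f: "f t ?w = u' t ?w + L2_inner \<Omega> (z t) ?g + \<nu> ?w"
      using \<nu>(2) wV by (simp add: V_dual_eq_def grad_adjoint_def z_def)
    have "y t - grad \<Omega> (lam t) = (y t - z t) - (grad \<Omega> (lam t) - grad \<Omega> (u t))"
      by (simp add: z_def)
    then have "(L2_norm \<Omega> (y t - grad \<Omega> (lam t)))\<^sup>2 = (L2_norm \<Omega> (y t - z t))\<^sup>2
        - 2 * L2_inner \<Omega> (y t - z t) (grad \<Omega> (lam t) - grad \<Omega> (u t)) + (L2_norm \<Omega> (grad \<Omega> (lam t) - grad \<Omega> (u t)))\<^sup>2"
      unfolding z_def by (simp only:) (intro L2_norm_diff_power2 L2_space_diff y G)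
    moreover have "L2_inner \<Omega> (y t - z t) (grad \<Omega> (lam t) - grad \<Omega> (u t)) = L2_inner \<Omega> (y t) ?g - L2_inner \<Omega> (z t) ?g"
      using y G unfolding z_def
      by (simp add: L2_inner_diff_left L2_inner_diff_right L2_space_diff L2_inner_grad_diff[OF _ V(2,1)])
    moreover have "L2_norm \<Omega> (grad \<Omega> (lam t) - grad \<Omega> (u t)) = L2_norm \<Omega> ?g"
      using L2_norm_grad_diff[OF V(2,1)] by (simp add: V_norm_def)
    ultimately have sq: "(L2_norm \<Omega> (y t - grad \<Omega> (lam t)))\<^sup>2 = (L2_norm \<Omega> (y t - z t))\<^sup>2
        - 2 * (L2_inner \<Omega> (y t) ?g - L2_inner \<Omega> (z t) ?g) + (L2_norm \<Omega> ?g)\<^sup>2" by simp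
    \<comment> \<open>Complementarity removes \<open>\<nu> (u t - \<zeta> t)\<close>, which replaces
      the obstacle by \<open>u t\<close> in the argument.\<close>
    have \<Lambda>\<zeta>: "\<Lambda> t (lam t - \<zeta> t) = \<nu> ?w"
      using \<Lambda>[OF V_diff[OF V(2,3)]] compl(1) V_dual_diff_arg[OF compl(2) V(2,3)]
        V_dual_diff_arg[OF compl(2) V(1,3)] V_dual_diff_arg[OF compl(2) V(2,1)] by simp
    have \<eta>\<zeta>: "\<eta> t (lam t - \<zeta> t) = \<eta> t ?w + \<eta> t (u t - \<zeta> t)"
      using V_dual_diff_arg[OF D(2) V(2,3)] V_dual_diff_arg[OF D(2) V(1,3)] V_dual_diff_arg[OF D(2) V(2,1)] by simp
    have app: "(lam' t - u' t) ?w = lam' t ?w - u' t ?w" "(- \<eta> t) v = - \<eta> t v" "(- \<Lambda> t) v = - \<Lambda> t v" for v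
      by simp_all
    \<comment> \<open>The remaining claim is linear in these quantities. Here \<open>p\<close> and
      \<open>q\<close> are the inner products of \<open>y t\<close> and \<open>z t\<close> with
      \<open>?g\<close>, \<open>h\<close> and \<open>k\<close> the values of \<open>\<eta> t\<close>
      and \<open>f t\<close> at \<open>?w\<close>, and \<open>e\<close>, \<open>e'\<close> those of
      \<open>\<eta> t\<close> at \<open>u t - \<zeta> t\<close> and
      \<open>lam t - \<zeta> t\<close>.\<close>
    have arith: "1/2 * A + 1/2 * G + (l - u) + - e + - n = 1/2 * (A - 2 * (p - q) + G) + - e'"
      if "- p = l + h - k" "k = u + q + n" "e' = h + e" for A G l u e n p q e' h k :: real
      using that by (simp add: field_simps)
    show ?case unfolding sq app \<Lambda>\<zeta> by (rule arith[OF eq f \<eta>\<zeta>])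
  qed
  have int1: "integrable ?M (\<lambda>t. (L2_norm \<Omega> (y t - z t))\<^sup>2)"
    by (rule Y.A.bochner_L2D(3)[OF Y.A.bochner_L2_diff[OF yL zL]])
  have int2: "integrable ?M (\<lambda>t. (L2_norm \<Omega> (grad \<Omega> (lam t - u t)))\<^sup>2)"
    using B.bochner_L2D(3)[OF wL] by (simp add: V_norm_def)
  have int3: "integrable ?M (\<lambda>t. (lam' t - u' t) (lam t - u t))"
    by (rule pairing_integrable[OF w'L wL])
  have int4: "integrable ?M (\<lambda>t. (- \<eta> t) (v t - \<zeta> t))"
    if "v \<in> bochner_L2 ?M (V_space \<Omega> \<Gamma>\<^sub>D) (V_norm \<Omega>)" for v
    using pairing_integrable[OF \<eta>L B.bochner_L2_diff[OF that \<zeta>L]] by simp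
  have int5: "integrable ?M (\<lambda>t. (- \<Lambda> t) (lam t - \<zeta> t))"
  proof -
    note l\<zeta> = B.bochner_L2_diff[OF lamL \<zeta>L]
    \<comment> \<open>The part of \<open>\<Lambda>\<close> coming from \<open>grad_adjoint\<close>
      is integrated as an inner product in L2, the rest as a duality pairing, so
      \<open>\<Lambda>\<close> itself is not treated as a Bochner function.\<close>
    have "integrable ?M (\<lambda>t. L2_inner \<Omega> (z t) (grad \<Omega> (lam t - \<zeta> t)) - (f t - u' t) (lam t - \<zeta> t))"
      by (intro Bochner_Integration.integrable_diff Y.pairing_integrable[OF zL gradL[OF l\<zeta>]]
          pairing_integrable[OF A.bochner_L2_diff[OF fL u'L] l\<zeta>])
    then show ?thesis by (simp add: Lambda_def grad_adjoint_def u'_def algebra_simps)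
  qed
  have int6: "integrable ?M (\<lambda>t. (L2_norm \<Omega> (y t - grad \<Omega> (lam t)))\<^sup>2)"
    by (rule Y.A.bochner_L2D(3)[OF Y.A.bochner_L2_diff[OF yL gradL[OF lamL]]])
  note ints = int1 int2 int3 int4[OF uL] int5 int6 int4[OF lamL]
  have "(LINT t|?M. ?A t)
      = (LINT t|?M. ?B t)"
    by (intro integral_cong_AE pointwise borel_measurable_integrable Bochner_Integration.integrable_add
        integrable_mult_right ints)
  moreover have "(LINT t|?M. ?A t)
      = 1/2 * (Q_norm T \<Omega> (\<lambda>t. y t - z t))\<^sup>2 + 1/2 * (Q_norm T \<Omega> (\<lambda>t. grad \<Omega> (lam t - u t)))\<^sup>2
        + (LINT t|?M. (lam' t - u' t) (lam t - u t))
        + pairing T (\<lambda>t. - \<eta> t) (\<lambda>t. u t - \<zeta> t) + pairing T (\<lambda>t. - \<Lambda> t) (\<lambda>t. lam t - \<zeta> t)"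
    unfolding Q_norm_power2 pairing_def
    by (subst Bochner_Integration.integral_add;
        (intro Bochner_Integration.integrable_add integrable_mult_right ints)?)+
      (simp only: integral_mult_right_zero)
  moreover have "(LINT t|?M. ?B t)
      = 1/2 * (Q_norm T \<Omega> (\<lambda>t. y t - grad \<Omega> (lam t)))\<^sup>2 + pairing T (\<lambda>t. - \<eta> t) (\<lambda>t. lam t - \<zeta> t)"
    unfolding Q_norm_power2 pairing_def
    by (subst Bochner_Integration.integral_add;
        (intro Bochner_Integration.integrable_add integrable_mult_right ints)?)+
      (simp only: integral_mult_right_zero)
  ultimately show ?thesis using parts unfolding init by simp
qed

end
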